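(* Let $(M,g)$ be an $n$-dimensional closed Riemannian manifold with nonnegative Ricci curvature, let $\lambda$ be the first nonzero eigenvalue of the Laplace operator, and let $a>-\lambda$ be a constant. Let $I\subset(0,\infty)$ be a time interval and let $u=u(x,t)$, $t\in I$, be a smooth positive solution on $M$ of $$\frac{\partial u}{\partial t}=\Delta u+\frac{|\nabla u|^2}{u}$$ (equivalently, $u^2$ solves the heat equation $\partial_t(u^2)=\Delta(u^2)$) with $\int_M u^2\,d\mu=1$ for all $t$. Set $\omega=\omega(u(\cdot,t),a):=\int_M|\nabla u|^2\,d\mu+a$ and assume $\omega>0$ for all $t\in I$. Then the adjusted logarithmic entropy $$\mathcal{Y}_a(u,t):=-\int_M u^2\log u^2\,d\mu+\frac n2\log\left(\int_M|\nabla u|^2\,d\mu+a\right)-4at$$ is monotone decreasing in $t$. More precisely, $$-\frac{d\,\mathcal{Y}_a(u(t),t)}{dt}\ \geq\ \frac{n}{4\omega}\int_M\left[\left|-2\frac{\nabla^2u}{u}+2\frac{\nabla u\otimes\nabla u}{u^2}-\frac{4\omega}{n}g\right|^{2}+4\,Ric\left(\frac{\nabla u}{u},\frac{\nabla u}{u}\right)\right]u^2\,d\mu$$ $$=\ \frac{n}{4\omega}\int_M\left(\left|\bar f_{ij}-\frac{4\omega}{n}g_{ij}\right|^{2}+R_{ij}\bar f_i\bar f_j\right)\frac{e^{-\bar f}}{(4\pi t)^{n/2}}\,d\mu,$$ where $\bar f$ is defined by $u=(4\pi t)^{-n/4}e^{-\bar f/2}$.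
   Context: The metric $g$ is fixed (independent of $t$); $d\mu$ is its Riemannian volume form, $Ric=(R_{ij})$ its Ricci tensor, $\Delta$ the Laplace–Beltrami operator (with $\Delta=\mathrm{tr}\,\nabla^2$; eigenvalues are those of $-\Delta$). $\bar f_i$ and $\bar f_{ij}$ denote components of $\nabla\bar f$ and of the Hessian $\nabla^2\bar f$. "Monotone decreasing" means nonincreasing. *)

theory Defs
  imports "HOL-Analysis.Analysis"
begin

text \<open>
  Smoothness of a map on a set, by iterated Frechet derivatives within the set. The derivative
  within \<open>S\<close> is unique (so that the definition is meaningful) in the two cases used below: \<open>S\<close> open,
  and \<open>S = V \<times> I\<close> with \<open>V\<close> open and \<open>I\<close> an interval with nonempty interior, where the time derivative
  at an endpoint of \<open>I\<close> that belongs to \<open>I\<close> is one-sided.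
\<close>

primrec Ck_on :: "nat \<Rightarrow> 'a::real_normed_vector set \<Rightarrow> ('a \<Rightarrow> 'b::real_normed_vector) \<Rightarrow> bool" where
  "Ck_on 0 S f \<longleftrightarrow> continuous_on S f"
| "Ck_on (Suc k) S f \<longleftrightarrow>
     f differentiable_on S \<and> (\<forall>v. Ck_on k S (\<lambda>x. frechet_derivative f (at x within S) v))"

definition smooth_on :: "'a::real_normed_vector set \<Rightarrow> ('a \<Rightarrow> 'b::real_normed_vector) \<Rightarrow> bool" where
  "smooth_on S f \<longleftrightarrow> (\<forall>k. Ck_on k S f)"


section \<open>Closed Riemannian manifolds\<close>

text \<open>
  The underlying set of the manifold is the type \<open>'m\<close>, its dimension is \<open>CARD('n)\<close>. A chart is a
  pair of a domain and a coordinate map; values of the map outside the domain are irrelevant.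
\<close>

type_synonym ('m, 'n) chart = "'m set \<times> ('m \<Rightarrow> real ^ 'n)"

abbreviation (input) dom_chart :: "('m, 'n) chart \<Rightarrow> 'm set" where
  "dom_chart c \<equiv> fst c"

abbreviation (input) coord :: "('m, 'n) chart \<Rightarrow> 'm \<Rightarrow> real ^ 'n" where
  "coord c \<equiv> snd c"

definition inv_chart :: "('m, 'n) chart \<Rightarrow> real ^ 'n \<Rightarrow> 'm" where
  "inv_chart c = inv_into (dom_chart c) (coord c)"

definition img_chart :: "('m, 'n) chart \<Rightarrow> (real ^ 'n) set" where
  "img_chart c = coord c ` dom_chart c"

definition is_chart :: "('m::topological_space, 'n::finite) chart \<Rightarrow> bool" where
  "is_chart c \<longleftrightarrow> open (dom_chart c) \<and> open (img_chart c) \<and>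
     homeomorphism (dom_chart c) (img_chart c) (coord c) (inv_chart c)"

definition smooth_atlas :: "('m::topological_space, 'n::finite) chart set \<Rightarrow> bool" where
  "smooth_atlas A \<longleftrightarrow>
     (\<forall>c\<in>A. is_chart c) \<and>
     (\<Union>c\<in>A. dom_chart c) = UNIV \<and>
     (\<forall>c\<in>A. \<forall>d\<in>A. smooth_on (coord c ` (dom_chart c \<inter> dom_chart d)) (coord d \<circ> inv_chart c))"

text \<open>
  \<open>metric M c p\<close> is the matrix \<open>g\<^sub>i\<^sub>j\<close> of the metric at the point \<open>p\<close> in the coordinates of the
  chart \<open>c\<close>; it is only meaningful if \<open>c\<close> is in the atlas and \<open>p\<close> in the domain of \<open>c\<close>.
\<close>

record ('m, 'n) riem =
  atlas :: "('m, 'n) chart set"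
  metric :: "('m, 'n) chart \<Rightarrow> 'm \<Rightarrow> real ^ 'n ^ 'n"

text \<open>Jacobian matrix at \<open>p\<close> of the change of coordinates from \<open>c\<close> to \<open>d\<close>.\<close>

definition jacobian :: "('m, 'n::finite) chart \<Rightarrow> ('m, 'n) chart \<Rightarrow> 'm \<Rightarrow> real ^ 'n ^ 'n" where
  "jacobian c d p = matrix (frechet_derivative (coord d \<circ> inv_chart c) (at (coord c p)))"

definition riemannian_metric :: "('m, 'n::finite) riem \<Rightarrow> bool" where
  "riemannian_metric M \<longleftrightarrow>
     (\<forall>c\<in>atlas M.
        smooth_on (img_chart c) (metric M c \<circ> inv_chart c) \<and>
        (\<forall>p\<in>dom_chart c.
           transpose (metric M c p) = metric M c p \<and>
           (\<forall>v. v \<noteq> 0 \<longrightarrow> v \<bullet> (metric M c p *v v) > 0) \<and>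
           (\<forall>d\<in>atlas M. p \<in> dom_chart d \<longrightarrow>
              metric M c p = transpose (jacobian c d p) ** metric M d p ** jacobian c d p)))"

definition closed_riemannian_manifold :: "('m::t2_space, 'n::finite) riem \<Rightarrow> bool" where
  "closed_riemannian_manifold M \<longleftrightarrow>
     compact (UNIV :: 'm set) \<and> smooth_atlas (atlas M) \<and> riemannian_metric M"

definition smooth_fun :: "('m, 'n::finite) riem \<Rightarrow> ('m \<Rightarrow> real) \<Rightarrow> bool" where
  "smooth_fun M f \<longleftrightarrow> (\<forall>c\<in>atlas M. smooth_on (img_chart c) (f \<circ> inv_chart c))"

text \<open>Joint smoothness of a time-dependent function on \<open>M \<times> I\<close>.\<close>

definition smooth_spacetime :: "('m, 'n::finite) riem \<Rightarrow> real set \<Rightarrow> ('m \<Rightarrow> real \<Rightarrow> real) \<Rightarrow> bool" where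
  "smooth_spacetime M I u \<longleftrightarrow>
     (\<forall>c\<in>atlas M. smooth_on (img_chart c \<times> I) (\<lambda>(y, t). u (inv_chart c y) t))"

text \<open>
  The Riemannian volume measure, characterised (uniquely, as finitely many charts cover \<open>M\<close>) by
  \<open>d\<mu> = sqrt (det g) dy\<close> in every chart.
\<close>

definition riemannian_volume :: "('m::topological_space, 'n::finite) riem \<Rightarrow> 'm measure \<Rightarrow> bool" where
  "riemannian_volume M \<mu> \<longleftrightarrow>
     sets \<mu> = sets borel \<and>
     (\<forall>c\<in>atlas M. \<forall>B\<in>sets borel. B \<subseteq> dom_chart c \<longrightarrow>
        emeasure \<mu> B =
          (\<integral>\<^sup>+ y \<in> coord c ` B. ennreal (sqrt (det (metric M c (inv_chart c y)))) \<partial>lborel))"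


section \<open>Tensor calculus in a chart\<close>

text \<open>Below, \<open>y\<close> is a point of the image of the chart \<open>c\<close>.\<close>

definition pd :: "'n::finite \<Rightarrow> (real ^ 'n \<Rightarrow> real) \<Rightarrow> real ^ 'n \<Rightarrow> real" where
  "pd i F y = frechet_derivative F (at y) (axis i 1)"

definition gmat :: "('m, 'n::finite) riem \<Rightarrow> ('m, 'n) chart \<Rightarrow> real ^ 'n \<Rightarrow> real ^ 'n ^ 'n" where
  "gmat M c y = metric M c (inv_chart c y)"

text \<open>\<open>christoffel M c k i j\<close> is \<open>\<Gamma>\<^sup>k\<^sub>i\<^sub>j\<close>.\<close>

definition christoffel ::
    "('m, 'n::finite) riem \<Rightarrow> ('m, 'n) chart \<Rightarrow> 'n \<Rightarrow> 'n \<Rightarrow> 'n \<Rightarrow> real ^ 'n \<Rightarrow> real" where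
  "christoffel M c k i j y =
     (\<Sum>l\<in>UNIV. matrix_inv (gmat M c y) $ k $ l *
        (pd i (\<lambda>z. gmat M c z $ j $ l) y + pd j (\<lambda>z. gmat M c z $ i $ l) y
          - pd l (\<lambda>z. gmat M c z $ i $ j) y)) / 2"

text \<open>
  \<open>riemann_coord M c l k i j\<close> is the \<open>l\<close>-th component of \<open>R(\<partial>\<^sub>i, \<partial>\<^sub>j) \<partial>\<^sub>k\<close>, where
  \<open>R(X, Y) Z = \<nabla>\<^sub>X \<nabla>\<^sub>Y Z - \<nabla>\<^sub>Y \<nabla>\<^sub>X Z - \<nabla>\<^bsub>[X, Y]\<^esub> Z\<close>; its trace over \<open>l = i\<close> is the Ricci tensor
  (positive on round spheres).
\<close>

definition riemann_coord ::
    "('m, 'n::finite) riem \<Rightarrow> ('m, 'n) chart \<Rightarrow> 'n \<Rightarrow> 'n \<Rightarrow> 'n \<Rightarrow> 'n \<Rightarrow> real ^ 'n \<Rightarrow> real" where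
  "riemann_coord M c l k i j y =
     pd i (christoffel M c l j k) y - pd j (christoffel M c l i k) y
     + (\<Sum>m\<in>UNIV. christoffel M c l i m y * christoffel M c m j k y
                 - christoffel M c l j m y * christoffel M c m i k y)"

definition ricci_coord ::
    "('m, 'n::finite) riem \<Rightarrow> ('m, 'n) chart \<Rightarrow> real ^ 'n \<Rightarrow> real ^ 'n ^ 'n" where
  "ricci_coord M c y = (\<chi> j k. \<Sum>i\<in>UNIV. riemann_coord M c i k i j y)"

definition diff_coord ::
    "('m, 'n::finite) chart \<Rightarrow> ('m \<Rightarrow> real) \<Rightarrow> real ^ 'n \<Rightarrow> real ^ 'n" where
  "diff_coord c f y = (\<chi> i. pd i (f \<circ> inv_chart c) y)"

definition hess_coord ::
    "('m, 'n::finite) riem \<Rightarrow> ('m, 'n) chart \<Rightarrow> ('m \<Rightarrow> real) \<Rightarrow> real ^ 'n \<Rightarrow> real ^ 'n ^ 'n" where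
  "hess_coord M c f y =
     (\<chi> i j. pd i (pd j (f \<circ> inv_chart c)) y
        - (\<Sum>k\<in>UNIV. christoffel M c k i j y * pd k (f \<circ> inv_chart c) y))"


section \<open>Geometric operators on the manifold\<close>

text \<open>
  Tensors at \<open>p\<close> are represented by their components in the coordinates of one chosen chart of the
  atlas around \<open>p\<close>. The scalars built from them do not depend on this choice.
\<close>

definition chart_at :: "('m, 'n::finite) riem \<Rightarrow> 'm \<Rightarrow> ('m, 'n) chart" where
  "chart_at M p = (SOME c. c \<in> atlas M \<and> p \<in> dom_chart c)"

definition coord_at :: "('m, 'n::finite) riem \<Rightarrow> 'm \<Rightarrow> real ^ 'n" where
  "coord_at M p = coord (chart_at M p) p"

definition metric_at :: "('m, 'n::finite) riem \<Rightarrow> 'm \<Rightarrow> real ^ 'n ^ 'n" where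
  "metric_at M p = metric M (chart_at M p) p"

definition differential :: "('m, 'n::finite) riem \<Rightarrow> ('m \<Rightarrow> real) \<Rightarrow> 'm \<Rightarrow> real ^ 'n" where
  "differential M f p = diff_coord (chart_at M p) f (coord_at M p)"

definition grad :: "('m, 'n::finite) riem \<Rightarrow> ('m \<Rightarrow> real) \<Rightarrow> 'm \<Rightarrow> real ^ 'n" where
  "grad M f p = matrix_inv (metric_at M p) *v differential M f p"

definition grad_sq :: "('m, 'n::finite) riem \<Rightarrow> ('m \<Rightarrow> real) \<Rightarrow> 'm \<Rightarrow> real" where
  "grad_sq M f p = grad M f p \<bullet> (metric_at M p *v grad M f p)"

definition hess :: "('m, 'n::finite) riem \<Rightarrow> ('m \<Rightarrow> real) \<Rightarrow> 'm \<Rightarrow> real ^ 'n ^ 'n" where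
  "hess M f p = hess_coord M (chart_at M p) f (coord_at M p)"

definition laplacian :: "('m, 'n::finite) riem \<Rightarrow> ('m \<Rightarrow> real) \<Rightarrow> 'm \<Rightarrow> real" where
  "laplacian M f p =
     (\<Sum>i\<in>UNIV. \<Sum>j\<in>UNIV. matrix_inv (metric_at M p) $ i $ j * hess M f p $ i $ j)"

definition Ric :: "('m, 'n::finite) riem \<Rightarrow> 'm \<Rightarrow> real ^ 'n \<Rightarrow> real ^ 'n \<Rightarrow> real" where
  "Ric M p v w = v \<bullet> (ricci_coord M (chart_at M p) (coord_at M p) *v w)"

text \<open>Squared norm \<open>|T|\<^sup>2 = g\<^sup>i\<^sup>k g\<^sup>j\<^sup>l T\<^sub>i\<^sub>j T\<^sub>k\<^sub>l\<close> of a covariant 2-tensor at \<open>p\<close>.\<close>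

definition tensor_norm_sq :: "('m, 'n::finite) riem \<Rightarrow> 'm \<Rightarrow> real ^ 'n ^ 'n \<Rightarrow> real" where
  "tensor_norm_sq M p T =
     (let G = matrix_inv (metric_at M p) in
      \<Sum>i\<in>UNIV. \<Sum>j\<in>UNIV. \<Sum>k\<in>UNIV. \<Sum>l\<in>UNIV. G $ i $ k * G $ j $ l * T $ i $ j * T $ k $ l)"

definition tensor_prod :: "real ^ 'n::finite \<Rightarrow> real ^ 'n \<Rightarrow> real ^ 'n ^ 'n" where
  "tensor_prod \<alpha> \<beta> = (\<chi> i j. \<alpha> $ i * \<beta> $ j)"

definition nonneg_ricci :: "('m, 'n::finite) riem \<Rightarrow> bool" where
  "nonneg_ricci M \<longleftrightarrow> (\<forall>p v. Ric M p v v \<ge> 0)"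

definition laplace_eigenvalue :: "('m, 'n::finite) riem \<Rightarrow> real \<Rightarrow> bool" where
  "laplace_eigenvalue M lam \<longleftrightarrow>
     (\<exists>\<phi>. smooth_fun M \<phi> \<and> (\<exists>p. \<phi> p \<noteq> 0) \<and> (\<forall>p. - laplacian M \<phi> p = lam * \<phi> p))"

definition first_nonzero_eigenvalue :: "('m, 'n::finite) riem \<Rightarrow> real \<Rightarrow> bool" where
  "first_nonzero_eigenvalue M lam \<longleftrightarrow>
     laplace_eigenvalue M lam \<and> lam \<noteq> 0 \<and>
     (\<forall>\<nu>. laplace_eigenvalue M \<nu> \<and> \<nu> \<noteq> 0 \<longrightarrow> lam \<le> \<nu>)"


section \<open>The adjusted logarithmic entropy\<close>

text \<open>In this section \<open>w\<close> is the function \<open>u(\<cdot>, t)\<close> on \<open>M\<close> at a fixed time.\<close>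

definition omega :: "('m, 'n::finite) riem \<Rightarrow> 'm measure \<Rightarrow> ('m \<Rightarrow> real) \<Rightarrow> real \<Rightarrow> real" where
  "omega M \<mu> w a = (\<integral>p. grad_sq M w p \<partial>\<mu>) + a"

definition log_entropy ::
    "('m, 'n::finite) riem \<Rightarrow> 'm measure \<Rightarrow> real \<Rightarrow> ('m \<Rightarrow> real) \<Rightarrow> real \<Rightarrow> real" where
  "log_entropy M \<mu> a w t =
     - (\<integral>p. (w p)\<^sup>2 * ln ((w p)\<^sup>2) \<partial>\<mu>)
     + real CARD('n) / 2 * ln (omega M \<mu> w a) - 4 * a * t"

end

theory Submission
  imports Defs
begin

text \<open>
  Write \<open>u = exp h\<close>, \<open>P = |\<nabla>h|\<^sup>2\<close> and \<open>L = \<Delta>h\<close>, so that \<open>\<partial>\<^sub>t u = u (L + 2 P)\<close> and \<open>f\<close> differs from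
  \<open>- 2 h\<close> by a function of time. Green's formula \<open>\<integral> \<langle>\<nabla>\<phi>, \<nabla>\<psi>\<rangle> + \<phi> \<Delta>\<psi> d\<mu> = 0\<close> gives
  \<open>d/dt \<integral> u\<^sup>2 log u\<^sup>2 = - 4 \<integral> P u\<^sup>2\<close>, and with Bochner's formula
  \<open>\<Delta>P / 2 = |\<nabla>\<^sup>2h|\<^sup>2 + \<langle>\<nabla>L, \<nabla>h\<rangle> + Ric(\<nabla>h, \<nabla>h)\<close> also
  \<open>d/dt \<integral> |\<nabla>u|\<^sup>2 = - 2 \<integral> (|\<nabla>\<^sup>2h|\<^sup>2 + Ric(\<nabla>h, \<nabla>h)) u\<^sup>2\<close>. Expanding the square
  \<open>|- 2 \<nabla>\<^sup>2h - (4 \<omega> / n) g|\<^sup>2\<close> then turns the lower bound for \<open>- dY/dt\<close> into an identity.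
\<close>

section \<open>Functions of class \<open>C\<^sup>k\<close>\<close>

text \<open>The operators of the statement are computed at p in an arbitrary chart chosen around p,
  and this choice varies with p without any regularity. No operator can be differentiated or
  integrated before its value is known to be independent of the chart. For the pairing of two
  gradients this is linear algebra of first order. For the Laplacian a direct check would need
  second derivatives of coordinate changes and the transformation law of \<Gamma>. Instead, Green's
  formula inside each chart identifies the Laplacian as the adjoint of the gradient, and the adjoint
  is unique. The Hessian and the Ricci tensor occur only pointwise and are never compared between
  charts.

  The coefficient 4 \<omega> / n is the one for which the trace term and |g|^2 = n, together with
  \<omega> = \<integral> P u^2 + a, leave -4 \<integral> P u^2 + 4 a; the summand -4 a t of the
  entropy accounts for 4 a.

  I may contain its endpoints. Time derivatives are one-sided there, and commuting them with spatial
  ones passes to the limit from the interior.\<close>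

lemma has_derivative_cong_on:
  assumes "x \<in> S" "\<And>y. y \<in> S \<Longrightarrow> f y = g y"
  shows "(f has_derivative f') (at x within S) \<longleftrightarrow> (g has_derivative f') (at x within S)"
  using has_derivative_transform[OF assms(1), of g f] has_derivative_transform[OF assms(1), of f g]
    assms(2) by metis

lemma frechet_derivative_cong_on:
  assumes "x \<in> S" "\<And>y. y \<in> S \<Longrightarrow> f y = g y"
  shows "frechet_derivative f (at x within S) = frechet_derivative g (at x within S)"
  unfolding frechet_derivative_def by (simp add: has_derivative_cong_on[OF assms])

lemma Ck_on_cong:
  assumes "\<And>x. x \<in> S \<Longrightarrow> f x = g x"
  shows "Ck_on k S f \<longleftrightarrow> Ck_on k S g" using assms
proof (induction k arbitrary: f g)
  case 0
  then show ?case by (simp cong: continuous_on_cong)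
next
  case (Suc k)
  have "f differentiable_on S \<longleftrightarrow> g differentiable_on S"
    unfolding differentiable_on_def differentiable_def using has_derivative_cong_on Suc.prems by blast
  moreover have "Ck_on k S (\<lambda>x. frechet_derivative f (at x within S) v)
      \<longleftrightarrow> Ck_on k S (\<lambda>x. frechet_derivative g (at x within S) v)" for v
    by (rule Suc.IH) (simp add: frechet_derivative_cong_on[OF _ Suc.prems])
  ultimately show ?case by simp
qed

lemma Ck_on_Suc_imp:
  assumes "Ck_on (Suc k) S f"
  shows "Ck_on k S f" using assms
proof (induction k arbitrary: f)
  case 0
  then show ?case by (simp add: differentiable_imp_continuous_on)
next
  case (Suc k)
  then show ?case by (metis Ck_on.simps(2))
qed

lemma Ck_on_mono:
  assumes "Ck_on k S f" "j \<le> k"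
  shows "Ck_on j S f"
  using assms(2,1) by (induction rule: dec_induct) (auto dest: Ck_on_Suc_imp simp del: Ck_on.simps)

text \<open>On an open set the derivative is unique, so any explicit formula \<open>f'\<close> may
  replace \<open>frechet_derivative\<close>. Each closure property below then becomes a
  differentiation rule plus regularity of the derivative one order lower.\<close>

lemma Ck_on_SucI:
  assumes "open S" "\<And>x. x \<in> S \<Longrightarrow> (f has_derivative f' x) (at x)"
    "\<And>v. Ck_on k S (\<lambda>x. f' x v)"
  shows "Ck_on (Suc k) S f"
proof -
  have "frechet_derivative f (at x within S) = f' x" if "x \<in> S" for x
    using assms(1,2) that frechet_derivative_at by (metis at_within_open)
  then have "Ck_on k S (\<lambda>x. frechet_derivative f (at x within S) v)" for v
    using assms(3)[of v] by (subst Ck_on_cong[where g = "\<lambda>x. f' x v"]) auto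
  moreover have "f differentiable_on S" unfolding differentiable_on_def differentiable_def
    using assms(2) has_derivative_at_withinI by blast
  ultimately show ?thesis by simp
qed

lemma Ck_on_Suc_has_derivative:
  assumes "open S" "Ck_on (Suc k) S f" "x \<in> S"
  shows "(f has_derivative frechet_derivative f (at x)) (at x)"
  using assms by (simp add: differentiable_on_def frechet_derivative_works[symmetric] at_within_open[OF assms(3,1)])
    (metis at_within_open)

lemma Ck_on_Suc_derivative:
  assumes "open S" "Ck_on (Suc k) S f"
  shows "Ck_on k S (\<lambda>x. frechet_derivative f (at x) v)"
proof -
  have "Ck_on k S (\<lambda>x. frechet_derivative f (at x within S) v)" using assms by simp
  then show ?thesis by (subst Ck_on_cong[where g = "\<lambda>x. frechet_derivative f (at x within S) v"])
      (auto simp: at_within_open[OF _ assms(1)])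
qed

lemma Ck_on_continuous_on: "Ck_on k S f \<Longrightarrow> continuous_on S f"
  using Ck_on_mono[of k S f 0] by simp

lemma Ck_on_const:
  fixes S :: "'a::real_normed_vector set"
  assumes "open S"
  shows "Ck_on k S (\<lambda>x. c)"
proof (induction k arbitrary: c)
  case (Suc k)
  show ?case
    by (rule Ck_on_SucI[OF assms, where f' = "\<lambda>x v. 0"]) (auto intro!: derivative_eq_intros Suc simp del: Ck_on.simps)
qed (simp)

lemma Ck_on_bounded_linear:
  assumes "open S" "bounded_linear L" "Ck_on k S f"
  shows "Ck_on k S (\<lambda>x. L (f x))" using assms(3)
proof (induction k arbitrary: f)
  case 0
  then show ?case using linear_continuous_on_compose assms(2) by (simp add: bounded_linear.continuous_on)
next
  case (Suc k)
  show ?case by (rule Ck_on_SucI[OF assms(1)])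
      (auto intro!: bounded_linear.has_derivative[OF assms(2)] Ck_on_Suc_has_derivative[OF assms(1) Suc.prems]
         Suc.IH Ck_on_Suc_derivative[OF assms(1) Suc.prems])
qed

lemma Ck_on_add:
  assumes "open S" "Ck_on k S f" "Ck_on k S g"
  shows "Ck_on k S (\<lambda>x. f x + g x)" using assms(2,3)
proof (induction k arbitrary: f g)
  case 0
  then show ?case by (simp add: continuous_on_add)
next
  case (Suc k)
  show ?case by (rule Ck_on_SucI[OF assms(1)])
      (auto intro!: has_derivative_add Ck_on_Suc_has_derivative[OF assms(1) Suc.prems(1)]
        Ck_on_Suc_has_derivative[OF assms(1) Suc.prems(2)]
         Suc.IH Ck_on_Suc_derivative[OF assms(1) Suc.prems(1)] Ck_on_Suc_derivative[OF assms(1) Suc.prems(2)])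
qed

lemma Ck_on_mult:
  fixes f g :: "'a::real_normed_vector \<Rightarrow> real"
  assumes "open S" "Ck_on k S f" "Ck_on k S g"
  shows "Ck_on k S (\<lambda>x. f x * g x)" using assms(2,3)
proof (induction k arbitrary: f g)
  case 0
  then show ?case by (simp add: continuous_on_mult)
next
  case (Suc k)
  note d = Ck_on_Suc_has_derivative[OF assms(1) Suc.prems(1)] Ck_on_Suc_has_derivative[OF assms(1) Suc.prems(2)]
    Ck_on_Suc_derivative[OF assms(1) Suc.prems(1)] Ck_on_Suc_derivative[OF assms(1) Suc.prems(2)]
    Suc.prems[THEN Ck_on_Suc_imp]
  show ?case by (rule Ck_on_SucI[OF assms(1)])
      (auto intro!: has_derivative_mult d Suc.IH Ck_on_add[OF assms(1)])
qed

text \<open>The derivative of 1/f is a product of f' with two factors 1/f, so f stays fixed in the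
  induction and the hypothesis for k is reused on 1/f itself.\<close>

lemma Ck_on_inverse:
  fixes f :: "'a::real_normed_vector \<Rightarrow> real"
  assumes "open S" "Ck_on k S f" "\<And>x. x \<in> S \<Longrightarrow> f x \<noteq> 0"
  shows "Ck_on k S (\<lambda>x. inverse (f x))" using assms(2)
proof (induction k)
  case 0
  then show ?case using assms(3) by (auto intro!: continuous_on_inverse)
next
  case (Suc k)
  note d = Ck_on_Suc_has_derivative[OF assms(1) Suc.prems] Ck_on_Suc_derivative[OF assms(1) Suc.prems]
    Suc.IH[OF Suc.prems[THEN Ck_on_Suc_imp]]
  show ?case
    by (rule Ck_on_SucI[OF assms(1), where f' = "\<lambda>x v. inverse (f x) * frechet_derivative f (at x) v * (- 1 * inverse (f x))"])
      (auto intro!: derivative_eq_intros d assms Ck_on_mult[OF assms(1)] Ck_on_bounded_linear[OF assms(1) bounded_linear_minus[OF bounded_linear_ident]]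
        simp del: Ck_on.simps)
qed

lemma Ck_on_ln:
  fixes f :: "'a::real_normed_vector \<Rightarrow> real"
  assumes "open S" "Ck_on k S f" "\<And>x. x \<in> S \<Longrightarrow> f x > 0"
  shows "Ck_on k S (\<lambda>x. ln (f x))"
proof (cases k)
  case 0
  then show ?thesis using assms(2,3) by (auto intro!: continuous_on_ln) (metis less_irrefl)
next
  case (Suc j)
  then have f: "Ck_on (Suc j) S f" using assms by simp
  note d = Ck_on_Suc_has_derivative[OF assms(1) f] Ck_on_Suc_derivative[OF assms(1) f]
    f[THEN Ck_on_Suc_imp]
  have nz: "f x \<noteq> 0" if "x \<in> S" for x using assms(3)[OF that] by simp
  show ?thesis unfolding Suc
    by (rule Ck_on_SucI[OF assms(1), where f' = "\<lambda>x v. inverse (f x) * frechet_derivative f (at x) v"])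
      (auto intro!: derivative_eq_intros d Ck_on_mult[OF assms(1)] Ck_on_inverse assms nz simp: divide_inverse simp del: Ck_on.simps)
qed

text \<open>The second difference over a parallelogram is symmetric in v and w, which is what makes
  mixed derivatives commute. The mean value theorem evaluates it in two rounds: along v for the
  difference over the step in direction w, then along w for the derivative in direction v.\<close>

lemma second_difference_mean_value:
  fixes f :: "'a::real_normed_vector \<Rightarrow> real"
  assumes S: "open S" and f: "Ck_on 2 S f" and s: "s > 0"
    and sub: "\<And>a b. 0 \<le> a \<Longrightarrow> a \<le> s \<Longrightarrow> 0 \<le> b \<Longrightarrow> b \<le> s \<Longrightarrow> x + a *\<^sub>R v + b *\<^sub>R w \<in> S"
  shows "\<exists>a b. 0 \<le> a \<and> a \<le> s \<and> 0 \<le> b \<and> b \<le> s \<and>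
    f (x + s *\<^sub>R v + s *\<^sub>R w) - f (x + s *\<^sub>R v) - f (x + s *\<^sub>R w) + f x
     = s * (s * frechet_derivative (\<lambda>z. frechet_derivative f (at z) v) (at (x + a *\<^sub>R v + b *\<^sub>R w)) w)"
proof -
  have f2: "Ck_on (Suc (Suc 0)) S f" using f by (simp only: numeral_2_eq_2)
  note d1 = Ck_on_Suc_has_derivative[OF S f2]
  note d2 = Ck_on_Suc_has_derivative[OF S Ck_on_Suc_derivative[OF S f2, of v]]
  define D where "D z = frechet_derivative f (at z)" for z
  have lin: "linear (frechet_derivative f (at z))" if "z \<in> S" for z
    using d1[OF that] has_derivative_linear by blast
  have 1: "((\<lambda>r. f (x + r *\<^sub>R v + b *\<^sub>R w)) has_real_derivative D (x + r *\<^sub>R v + b *\<^sub>R w) v) (at r)"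
    if "0 \<le> r" "r \<le> s" "0 \<le> b" "b \<le> s" for r b
  proof -
    have z: "x + r *\<^sub>R v + b *\<^sub>R w \<in> S" using sub that by auto
    have "((\<lambda>r. f (x + r *\<^sub>R v + b *\<^sub>R w)) has_derivative
        (\<lambda>h. frechet_derivative f (at (x + r *\<^sub>R v + b *\<^sub>R w)) (h *\<^sub>R v))) (at r)"
      by (rule has_derivative_compose[where f = "\<lambda>r. x + r *\<^sub>R v + b *\<^sub>R w", OF _ d1[OF z]]) (auto intro!: derivative_eq_intros)
    then show ?thesis unfolding has_field_derivative_def D_def using linear_scale[OF lin[OF z]]
      by (simp add: mult_commute_abs)
  qed
  have "\<exists>a. 0 < a \<and> a < s \<and> (f (x + s *\<^sub>R v + s *\<^sub>R w) - f (x + s *\<^sub>R v + 0 *\<^sub>R w))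
      - (f (x + 0 *\<^sub>R v + s *\<^sub>R w) - f (x + 0 *\<^sub>R v + 0 *\<^sub>R w))
     = (s - 0) * (D (x + a *\<^sub>R v + s *\<^sub>R w) v - D (x + a *\<^sub>R v + 0 *\<^sub>R w) v)"
    by (rule MVT2[OF s, of "\<lambda>r. f (x + r *\<^sub>R v + s *\<^sub>R w) - f (x + r *\<^sub>R v + 0 *\<^sub>R w)"])
      (use s in \<open>auto intro!: derivative_eq_intros 1 simp del: scaleR_zero_left\<close>)
  then obtain a where a: "0 < a" "a < s" and e1: "f (x + s *\<^sub>R v + s *\<^sub>R w) - f (x + s *\<^sub>R v)
      - (f (x + s *\<^sub>R w) - f x) = s * (D (x + a *\<^sub>R v + s *\<^sub>R w) v - D (x + a *\<^sub>R v) v)"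
    by auto
  have 2: "((\<lambda>r. D (x + a *\<^sub>R v + r *\<^sub>R w) v) has_real_derivative
      frechet_derivative (\<lambda>z. D z v) (at (x + a *\<^sub>R v + r *\<^sub>R w)) w) (at r)"
    if "0 \<le> r" "r \<le> s" for r
  proof -
    have z: "x + a *\<^sub>R v + r *\<^sub>R w \<in> S" using sub that a by auto
    have "((\<lambda>r. D (x + a *\<^sub>R v + r *\<^sub>R w) v) has_derivative
        (\<lambda>h. frechet_derivative (\<lambda>z. D z v) (at (x + a *\<^sub>R v + r *\<^sub>R w)) (h *\<^sub>R w))) (at r)"
      unfolding D_def
      by (rule has_derivative_compose[where f = "\<lambda>r. x + a *\<^sub>R v + r *\<^sub>R w", OF _ d2[OF z]]) (auto intro!: derivative_eq_intros)
    then show ?thesis unfolding has_field_derivative_def D_def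
      using linear_scale[OF has_derivative_linear[OF d2[OF z]]] by (simp add: mult_commute_abs)
  qed
  have "\<exists>b. 0 < b \<and> b < s \<and> D (x + a *\<^sub>R v + s *\<^sub>R w) v - D (x + a *\<^sub>R v + 0 *\<^sub>R w) v
     = (s - 0) * frechet_derivative (\<lambda>z. D z v) (at (x + a *\<^sub>R v + b *\<^sub>R w)) w"
    by (rule MVT2[OF s, of "\<lambda>r. D (x + a *\<^sub>R v + r *\<^sub>R w) v"]) (use s 2 in auto)
  then obtain b where b: "0 < b" "b < s" and e2: "D (x + a *\<^sub>R v + s *\<^sub>R w) v - D (x + a *\<^sub>R v) v
     = s * frechet_derivative (\<lambda>z. D z v) (at (x + a *\<^sub>R v + b *\<^sub>R w)) w" by auto
  show ?thesis using a b e1 unfolding e2 unfolding D_def by (rule_tac exI[of _ a], rule_tac exI[of _ b]) auto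
qed

text \<open>Schwarz's theorem. The two mixed derivatives agree when taken at suitable, possibly
  different, points of one small parallelogram; continuity at x moves both points to x at the cost
  of an arbitrary e.\<close>

lemma frechet_derivative_commute:
  fixes f :: "'a::real_normed_vector \<Rightarrow> real"
  assumes S: "open S" and f: "Ck_on 2 S f" and x: "x \<in> S"
  shows "frechet_derivative (\<lambda>z. frechet_derivative f (at z) v) (at x) w
       = frechet_derivative (\<lambda>z. frechet_derivative f (at z) w) (at x) v"
proof -
  have f2: "Ck_on (Suc (Suc 0)) S f" using f by (simp only: numeral_2_eq_2)
  define A where "A v w z = frechet_derivative (\<lambda>z. frechet_derivative f (at z) v) (at z) w" for v w z
  have cont: "isCont (A v w) x" for v w
    using Ck_on_continuous_on[OF Ck_on_Suc_derivative[OF S Ck_on_Suc_derivative[OF S f2]]]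
      continuous_on_eq_continuous_at S x unfolding A_def by blast
  have "\<bar>A v w x - A w v x\<bar> \<le> e" if e: "e > 0" for e
  proof -
    obtain d1 where d1: "d1 > 0" "\<And>y. dist y x < d1 \<Longrightarrow> dist (A v w y) (A v w x) < e/2"
      using cont[of v w] e unfolding continuous_at_eps_delta by (meson half_gt_zero)
    obtain d2 where d2: "d2 > 0" "\<And>y. dist y x < d2 \<Longrightarrow> dist (A w v y) (A w v x) < e/2"
      using cont[of w v] e unfolding continuous_at_eps_delta by (meson half_gt_zero)
    obtain d3 where d3: "d3 > 0" "ball x d3 \<subseteq> S" using S x openE by blast
    define d where "d = min d1 (min d2 d3)"
    have d: "d > 0" using d1 d2 d3 by (simp add: d_def)
    \<comment> \<open>The parallelogram with sides s v and s w then stays within d / 2 of x; the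
      summand 1 keeps the quotient meaningful when v = w = 0.\<close>
    define s where "s = d / (2 * (norm v + norm w + 1))"
    have nn: "norm v + norm w + 1 > 0" by (simp add: add_nonneg_pos)
    have s: "s > 0" using d nn by (simp add: s_def)
    have close: "dist (x + a *\<^sub>R v + b *\<^sub>R w) x < d" if "0 \<le> a" "a \<le> s" "0 \<le> b" "b \<le> s" for a b
    proof -
      have "dist (x + a *\<^sub>R v + b *\<^sub>R w) x \<le> a * norm v + b * norm w"
        using norm_triangle_ineq[of "a *\<^sub>R v" "b *\<^sub>R w"] that by (simp add: dist_norm)
      also have "\<dots> \<le> s * norm v + s * norm w" using that by (intro add_mono mult_right_mono) auto
      also have "\<dots> \<le> s * (norm v + norm w + 1)" using s by (simp add: algebra_simps)
      also have "\<dots> = d / 2" using nn unfolding s_def by (metis (no_types, lifting) divide_divide_eq_left less_irrefl nonzero_eq_divide_eq)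
      finally show ?thesis using d by simp
    qed
    have sub: "x + a *\<^sub>R v + b *\<^sub>R w \<in> S" if "0 \<le> a" "a \<le> s" "0 \<le> b" "b \<le> s" for a b
      using close[OF that] d3(2) by (auto simp: d_def dist_commute)
    have sub': "x + a *\<^sub>R w + b *\<^sub>R v \<in> S" if "0 \<le> a" "a \<le> s" "0 \<le> b" "b \<le> s" for a b
      using sub[OF that(3,4,1,2)] by (simp add: algebra_simps)
    obtain a b where ab: "0 \<le> a" "a \<le> s" "0 \<le> b" "b \<le> s"
      "f (x + s *\<^sub>R v + s *\<^sub>R w) - f (x + s *\<^sub>R v) - f (x + s *\<^sub>R w) + f x
       = s * (s * A v w (x + a *\<^sub>R v + b *\<^sub>R w))"
      using second_difference_mean_value[OF S f s sub] unfolding A_def by blast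
    obtain a' b' where ab': "0 \<le> a'" "a' \<le> s" "0 \<le> b'" "b' \<le> s"
      "f (x + s *\<^sub>R w + s *\<^sub>R v) - f (x + s *\<^sub>R w) - f (x + s *\<^sub>R v) + f x
       = s * (s * A w v (x + a' *\<^sub>R w + b' *\<^sub>R v))"
      using second_difference_mean_value[OF S f s sub'] unfolding A_def by blast
    have "f (x + s *\<^sub>R w + s *\<^sub>R v) = f (x + s *\<^sub>R v + s *\<^sub>R w)" by (simp add: algebra_simps)
    then have "s * (s * A v w (x + a *\<^sub>R v + b *\<^sub>R w)) = s * (s * A w v (x + a' *\<^sub>R w + b' *\<^sub>R v))"
      using ab(5) ab'(5) by linarith
    then have eq: "A v w (x + a *\<^sub>R v + b *\<^sub>R w) = A w v (x + a' *\<^sub>R w + b' *\<^sub>R v)"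
      using s by simp
    have "dist (A v w (x + a *\<^sub>R v + b *\<^sub>R w)) (A v w x) < e/2"
      using close[OF ab(1-4)] by (intro d1) (simp add: d_def)
    moreover have "dist (A w v (x + a' *\<^sub>R w + b' *\<^sub>R v)) (A w v x) < e/2"
    proof (intro d2)
      have swap: "x + a' *\<^sub>R w + b' *\<^sub>R v = x + b' *\<^sub>R v + a' *\<^sub>R w" by (simp add: algebra_simps)
      show "dist (x + a' *\<^sub>R w + b' *\<^sub>R v) x < d2"
        unfolding swap using close[OF ab'(3,4,1,2)] by (simp add: d_def)
    qed
    ultimately show ?thesis unfolding eq dist_real_def by linarith
  qed
  then have "\<bar>A v w x - A w v x\<bar> \<le> 0" by (rule field_le_epsilon) (simp)
  then show ?thesis by (simp add: A_def)
qed

section \<open>Closure properties of smooth functions\<close>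

lemma smooth_on_cong: "(\<And>x. x \<in> S \<Longrightarrow> f x = g x) \<Longrightarrow> smooth_on S f \<longleftrightarrow> smooth_on S g"
  unfolding smooth_on_def using Ck_on_cong by blast

lemma smooth_on_const: "open S \<Longrightarrow> smooth_on S (\<lambda>x. c)"
  unfolding smooth_on_def using Ck_on_const by blast

lemma smooth_on_add: "open S \<Longrightarrow> smooth_on S f \<Longrightarrow> smooth_on S g \<Longrightarrow> smooth_on S (\<lambda>x. f x + g x)"
  unfolding smooth_on_def using Ck_on_add by blast

lemma smooth_on_bounded_linear:
  "open S \<Longrightarrow> bounded_linear L \<Longrightarrow> smooth_on S f \<Longrightarrow> smooth_on S (\<lambda>x. L (f x))"
  unfolding smooth_on_def using Ck_on_bounded_linear by blast

lemma smooth_on_minus: "open S \<Longrightarrow> smooth_on S f \<Longrightarrow> smooth_on S (\<lambda>x. - f x)"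
  by (rule smooth_on_bounded_linear) (auto intro: bounded_linear_minus bounded_linear_ident)

lemma smooth_on_diff: "open S \<Longrightarrow> smooth_on S f \<Longrightarrow> smooth_on S g \<Longrightarrow> smooth_on S (\<lambda>x. f x - g x)"
  using smooth_on_add[of S f "\<lambda>x. - g x"] smooth_on_minus[of S g] by simp

lemma smooth_on_mult:
  fixes f g :: "'a::real_normed_vector \<Rightarrow> real"
  shows "open S \<Longrightarrow> smooth_on S f \<Longrightarrow> smooth_on S g \<Longrightarrow> smooth_on S (\<lambda>x. f x * g x)"
  unfolding smooth_on_def using Ck_on_mult by blast

lemma smooth_on_inverse:
  fixes f :: "'a::real_normed_vector \<Rightarrow> real"
  shows "open S \<Longrightarrow> smooth_on S f \<Longrightarrow> (\<And>x. x \<in> S \<Longrightarrow> f x \<noteq> 0) \<Longrightarrow> smooth_on S (\<lambda>x. inverse (f x))"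
  unfolding smooth_on_def using Ck_on_inverse by blast

lemma smooth_on_divide:
  fixes f g :: "'a::real_normed_vector \<Rightarrow> real"
  shows "open S \<Longrightarrow> smooth_on S f \<Longrightarrow> smooth_on S g \<Longrightarrow> (\<And>x. x \<in> S \<Longrightarrow> g x \<noteq> 0)
    \<Longrightarrow> smooth_on S (\<lambda>x. f x / g x)"
  unfolding divide_inverse by (intro smooth_on_mult smooth_on_inverse)

lemma smooth_on_ln:
  fixes f :: "'a::real_normed_vector \<Rightarrow> real"
  shows "open S \<Longrightarrow> smooth_on S f \<Longrightarrow> (\<And>x. x \<in> S \<Longrightarrow> f x > 0) \<Longrightarrow> smooth_on S (\<lambda>x. ln (f x))"
  unfolding smooth_on_def using Ck_on_ln by blast

lemma smooth_on_sum:
  fixes f :: "'i \<Rightarrow> 'a::real_normed_vector \<Rightarrow> 'b::real_normed_vector"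
  assumes "open S" "\<And>i. i \<in> A \<Longrightarrow> smooth_on S (f i)"
  shows "smooth_on S (\<lambda>x. \<Sum>i\<in>A. f i x)" using assms(2)
  by (induction A rule: infinite_finite_induct) (auto intro: smooth_on_const smooth_on_add assms(1))

lemma smooth_on_prod:
  fixes f :: "'i \<Rightarrow> 'a::real_normed_vector \<Rightarrow> real"
  assumes "open S" "\<And>i. i \<in> A \<Longrightarrow> smooth_on S (f i)"
  shows "smooth_on S (\<lambda>x. \<Prod>i\<in>A. f i x)" using assms(2)
  by (induction A rule: infinite_finite_induct) (auto intro: smooth_on_const smooth_on_mult assms(1))

lemma smooth_on_has_derivative:
  "open S \<Longrightarrow> smooth_on S f \<Longrightarrow> x \<in> S \<Longrightarrow> (f has_derivative frechet_derivative f (at x)) (at x)"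
  unfolding smooth_on_def using Ck_on_Suc_has_derivative by blast

lemma smooth_on_differentiable: "open S \<Longrightarrow> smooth_on S f \<Longrightarrow> x \<in> S \<Longrightarrow> f differentiable (at x)"
  using smooth_on_has_derivative differentiable_def by blast

lemma smooth_on_continuous_on: "smooth_on S f \<Longrightarrow> continuous_on S f"
  unfolding smooth_on_def using Ck_on_continuous_on by blast

section \<open>Partial derivatives in coordinates\<close>

lemma smooth_on_pd: "open S \<Longrightarrow> smooth_on S f \<Longrightarrow> smooth_on S (pd i f)"
  unfolding smooth_on_def pd_def[abs_def] using Ck_on_Suc_derivative by blast

lemma pd_commute:
  assumes "open S" "smooth_on S f" "y \<in> S"
  shows "pd i (pd j f) y = pd j (pd i f) y" using frechet_derivative_commute[OF assms(1) _ assms(3)] assms(2)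
  unfolding smooth_on_def pd_def[abs_def] by blast

lemma pd_eq: "(f has_derivative f') (at y) \<Longrightarrow> pd i f y = f' (axis i 1)"
  unfolding pd_def using frechet_derivative_at by metis

lemma pd_has_derivative: "f differentiable at y \<Longrightarrow> (f has_derivative frechet_derivative f (at y)) (at y)"
  by (simp add: frechet_derivative_works[symmetric])

lemma pd_const: "pd i (\<lambda>z. c) y = 0" by (rule pd_eq[where f' = "\<lambda>_. 0", simplified]) simp

lemma pd_add: "f differentiable at y \<Longrightarrow> g differentiable at y \<Longrightarrow> pd i (\<lambda>z. f z + g z) y = pd i f y + pd i g y"
  by (subst pd_eq[OF has_derivative_add[OF pd_has_derivative pd_has_derivative]]) (simp_all add: pd_def)

lemma pd_mult: "f differentiable at y \<Longrightarrow> g differentiable at y \<Longrightarrow>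
    pd i (\<lambda>z. f z * g z) y = pd i f y * g y + f y * pd i g y"
  by (subst pd_eq[OF has_derivative_mult[OF pd_has_derivative pd_has_derivative]]) (simp_all add: pd_def)

lemma pd_cmult: "f differentiable at y \<Longrightarrow> pd i (\<lambda>z. c * f z) y = c * pd i f y"
  by (subst pd_mult) (simp_all add: pd_const)

lemma differentiable_sum:
  assumes "\<And>a. a \<in> A \<Longrightarrow> (f a :: 'a::real_normed_vector \<Rightarrow> real) differentiable at y"
  shows "(\<lambda>z. \<Sum>a\<in>A. f a z) differentiable at y"
  using assms by (induction A rule: infinite_finite_induct) auto

lemma pd_sum:
  assumes "\<And>a. a \<in> A \<Longrightarrow> f a differentiable at y"
  shows "pd i (\<lambda>z. \<Sum>a\<in>A. f a z) y = (\<Sum>a\<in>A. pd i (f a) y)" using assms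
  by (induction A rule: infinite_finite_induct) (auto simp: pd_const pd_add differentiable_sum)

lemma pd_chain:
  assumes "f differentiable at y" "(\<phi> has_real_derivative d) (at (f y))"
  shows "pd i (\<lambda>z. \<phi> (f z)) y = d * pd i f y"
proof -
  have "((\<lambda>z. \<phi> (f z)) has_derivative (\<lambda>h. d * frechet_derivative f (at y) h)) (at y)"
    by (rule has_derivative_compose[OF pd_has_derivative[OF assms(1)], of \<phi> "(*) d"])
      (use assms(2) in \<open>simp add: has_field_derivative_def\<close>)
  from pd_eq[OF this, of i] show ?thesis by (simp only: pd_def)
qed

lemma pd_cong:
  assumes "open S" "y \<in> S" "\<And>z. z \<in> S \<Longrightarrow> f z = g z"
  shows "pd i f y = pd i g y"
  using frechet_derivative_cong_on[OF assms(2,3)] unfolding pd_def at_within_open[OF assms(2,1)] by simp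

lemma frechet_derivative_pd:
  assumes "f differentiable at y"
  shows "frechet_derivative f (at y) v = (\<Sum>i\<in>UNIV. v $ i * pd i f y)"
proof -
  have l: "linear (frechet_derivative f (at y))" by (rule linear_frechet_derivative[OF assms])
  have "frechet_derivative f (at y) v = frechet_derivative f (at y) (\<Sum>i\<in>UNIV. v $ i *\<^sub>R axis i 1)"
    using basis_expansion[of v] unfolding scalar_mult_eq_scaleR by simp
  then show ?thesis unfolding pd_def by (simp add: linear_sum[OF l] linear_scale[OF l])
qed

section \<open>Positive definite matrices and determinants\<close>

definition pos_def :: "real ^ 'n ^ 'n \<Rightarrow> bool" where
  "pos_def A \<longleftrightarrow> transpose A = A \<and> (\<forall>v. v \<noteq> 0 \<longrightarrow> v \<bullet> (A *v v) > 0)"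

lemma pos_def_sym: "pos_def A \<Longrightarrow> A $ i $ j = A $ j $ i"
  unfolding pos_def_def transpose_def by (metis vec_lambda_beta)

lemma pos_def_invertible:
  assumes "pos_def A"
  shows "invertible A" unfolding invertible_left_inverse matrix_left_invertible_ker
  using assms unfolding pos_def_def by (metis inner_zero_right less_irrefl)

lemma matrix_inv_props:
  fixes A :: "real ^ 'n ^ 'n"
  assumes "invertible A"
  shows matrix_inv_right: "A ** matrix_inv A = mat 1" and matrix_inv_left: "matrix_inv A ** A = mat 1"
proof -
  have "\<exists>A'. A ** A' = mat 1 \<and> A' ** A = mat 1" using assms unfolding invertible_def by blast
  from someI_ex[OF this] show "A ** matrix_inv A = mat 1" "matrix_inv A ** A = mat 1"
    unfolding matrix_inv_def by auto
qed

lemma pos_def_matrix_inv: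
  assumes "pos_def A"
  shows "pos_def (matrix_inv A)"
proof -
  have inv: "A ** matrix_inv A = mat 1" "matrix_inv A ** A = mat 1"
    using matrix_inv_props[OF pos_def_invertible[OF assms]] by auto
  have "transpose (matrix_inv A) ** A = mat 1"
    using arg_cong[OF inv(1), of transpose] assms unfolding pos_def_def by (simp add: matrix_transpose_mul)
  then have tr: "transpose (matrix_inv A) = matrix_inv A"
    using inv by (metis matrix_mul_assoc matrix_mul_lid matrix_mul_rid)
  have "v \<bullet> (matrix_inv A *v v) > 0" if "v \<noteq> 0" for v
  proof -
    define w where "w = matrix_inv A *v v"
    have v: "A *v w = v" unfolding w_def by (simp add: matrix_vector_mul_assoc inv)
    then have "w \<noteq> 0" using that by auto
    then have "w \<bullet> (A *v w) > 0" using assms unfolding pos_def_def by blast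
    then show ?thesis unfolding v by (simp add: w_def[symmetric] inner_commute)
  qed
  with tr show ?thesis unfolding pos_def_def by blast
qed

text \<open>The segment from the identity to A consists of positive definite, hence invertible,
  matrices, so the determinant cannot cross 0 on its way from 1 to det A. The segment is given
  entrywise to exhibit its determinant as a polynomial in s.\<close>

lemma pos_def_det_pos:
  assumes "pos_def (A :: real ^ 'n ^ 'n)"
  shows "det A > 0"
proof (rule ccontr)
  assume "\<not> det A > 0"
  define B where "B s = (\<chi> i j. (1 - s) * (mat 1 :: real ^ 'n ^ 'n) $ i $ j + s * A $ i $ j)" for s :: real
  have B: "B s = (1 - s) *\<^sub>R mat 1 + s *\<^sub>R A" for s by (simp add: B_def vec_eq_iff)
  have pd: "pos_def (B s)" if "0 \<le> s" "s \<le> 1" for s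
  proof -
    have "transpose (B s) = B s"
      using pos_def_sym[OF assms] by (auto simp: B_def transpose_def vec_eq_iff mat_def)
    moreover have "v \<bullet> (B s *v v) > 0" if "v \<noteq> 0" for v
    proof -
      have "v \<bullet> (B s *v v) = (1 - s) * (v \<bullet> v) + s * (v \<bullet> (A *v v))"
        by (simp add: B matrix_vector_mult_add_rdistrib scaleR_matrix_vector_assoc[symmetric] inner_add_right)
      moreover have "v \<bullet> v > 0" "v \<bullet> (A *v v) > 0" using that assms unfolding pos_def_def by auto
      ultimately show ?thesis using \<open>0 \<le> s\<close> \<open>s \<le> 1\<close>
        by (cases "s = 0") (auto intro: add_nonneg_pos)
    qed
    ultimately show ?thesis unfolding pos_def_def by blast
  qed
  have "continuous_on {0..1} (\<lambda>s. det (B s))"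
    unfolding det_def B_def by (auto intro!: continuous_intros)
  then obtain s where "0 \<le> s" "s \<le> 1" "det (B s) = 0"
    using IVT2'[of "\<lambda>s. det (B s)" 1 0 0] \<open>\<not> det A > 0\<close> by (auto simp: B)
  with pos_def_invertible[OF pd] show False by (simp add: invertible_det_nz)
qed

text \<open>Exhibits the entries of the inverse as quotients of polynomials in the entries of A;
  this is how smoothness passes from the metric to its inverse.\<close>

lemma matrix_inv_cramer:
  fixes A :: "real ^ 'n ^ 'n"
  assumes "invertible A"
  shows "matrix_inv A $ k $ l = det (\<chi> i j. if j = k then (axis l 1 :: real ^ 'n) $ i else A $ i $ j) / det A"
proof -
  have "A *v (matrix_inv A *v axis l 1) = axis l 1"
    by (simp add: matrix_vector_mul_assoc matrix_inv_right[OF assms])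
  then have "matrix_inv A *v axis l 1
      = (\<chi> k. det (\<chi> i j. if j = k then (axis l 1 :: real ^ 'n) $ i else A $ i $ j) / det A)"
    using cramer assms invertible_det_nz by blast
  moreover have "(matrix_inv A *v axis l 1) $ k = matrix_inv A $ k $ l"
    by (simp add: matrix_vector_mul_component inner_axis)
  ultimately show ?thesis by simp
qed

text \<open>Jacobi's formula. Differentiating the Leibniz expansion one factor at a time gives the
  determinants of A with row i replaced by that of A'. Writing A' = C A makes this row a combination
  of rows of A, of which only the i-th survives, with coefficient C_ii.\<close>

lemma has_derivative_det:
  fixes A :: "'a::real_normed_vector \<Rightarrow> real ^ 'n ^ 'n"
  assumes "\<And>i j. ((\<lambda>z. A z $ i $ j) has_derivative (\<lambda>h. A' h $ i $ j)) (at y)" and inv: "invertible (A y)"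
  shows "((\<lambda>z. det (A z)) has_derivative (\<lambda>h. det (A y) * trace (A' h ** matrix_inv (A y)))) (at y)"
proof -
  have "((\<lambda>z. det (A z)) has_derivative
     (\<lambda>h. \<Sum>p\<in>{p. p permutes (UNIV::'n set)}. of_int (sign p) *
       (\<Sum>i\<in>UNIV. A' h $ i $ p i * (\<Prod>j\<in>UNIV - {i}. A y $ j $ p j)))) (at y)"
    unfolding det_def by (intro has_derivative_sum has_derivative_mult_right has_derivative_prod assms)
  moreover have "(\<Sum>p\<in>{p. p permutes (UNIV::'n set)}. of_int (sign p) *
       (\<Sum>i\<in>UNIV. A' h $ i $ p i * (\<Prod>j\<in>UNIV - {i}. A y $ j $ p j)))
     = det (A y) * trace (A' h ** matrix_inv (A y))" for h
  proof -
    define C where "C = A' h ** matrix_inv (A y)"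
    have C: "A' h = C ** A y"
      unfolding C_def by (simp add: matrix_mul_assoc[symmetric] matrix_inv_left[OF inv])
    have row: "row i (A' h) = (\<Sum>k\<in>UNIV. C $ i $ k *s row k (A y))" for i
      by (simp add: C row_def matrix_matrix_mult_def vec_eq_iff)
    have "(\<Sum>p\<in>{p. p permutes (UNIV::'n set)}. of_int (sign p) *
        (\<Sum>i\<in>UNIV. A' h $ i $ p i * (\<Prod>j\<in>UNIV - {i}. A y $ j $ p j)))
      = (\<Sum>i\<in>UNIV. \<Sum>p\<in>{p. p permutes (UNIV::'n set)}. of_int (sign p) *
        (A' h $ i $ p i * (\<Prod>j\<in>UNIV - {i}. A y $ j $ p j)))"
      unfolding sum_distrib_left by (rule sum.swap)
    also have "\<dots> = (\<Sum>i\<in>UNIV. det (\<chi> k. if k = i then row i (A' h) else row k (A y)))"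
    proof (rule sum.cong[OF refl])
      fix i :: 'n
      have "(\<Prod>k\<in>UNIV. (\<chi> k. if k = i then row i (A' h) else row k (A y)) $ k $ p k)
          = A' h $ i $ p i * (\<Prod>j\<in>UNIV - {i}. A y $ j $ p j)" for p
        by (subst prod.remove[of _ i]) (auto simp: row_def intro!: prod.cong)
      then show "(\<Sum>p\<in>{p. p permutes (UNIV::'n set)}. of_int (sign p) *
        (A' h $ i $ p i * (\<Prod>j\<in>UNIV - {i}. A y $ j $ p j)))
        = det (\<chi> k. if k = i then row i (A' h) else row k (A y))" unfolding det_def by simp
    qed
    also have "\<dots> = (\<Sum>i\<in>UNIV. C $ i $ i * det (A y))"
      unfolding row using cramer_lemma_transpose[of _ "C $ _" "A y"] by simp
    finally show ?thesis by (simp add: C_def trace_def sum_distrib_left mult.commute)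
  qed
  ultimately show ?thesis by simp
qed

lemma trace_transpose: "trace (transpose A) = trace A" by (simp add: trace_def transpose_def)

section \<open>Riemannian calculus in a chart\<close>

definition gup :: "('m, 'n::finite) riem \<Rightarrow> ('m, 'n) chart \<Rightarrow> 'n \<Rightarrow> 'n \<Rightarrow> real ^ 'n \<Rightarrow> real" where
  "gup M c i j y = matrix_inv (gmat M c y) $ i $ j"

text \<open>The operators from here to \<open>lap_c\<close> act on functions of the coordinates in a
  fixed chart, not on functions on the manifold, so their values can be differentiated again.
  \<open>grad_c M c w j\<close> is the contravariant component, with upper index j.\<close>

definition grad_c :: "('m, 'n::finite) riem \<Rightarrow> ('m, 'n) chart \<Rightarrow> (real ^ 'n \<Rightarrow> real) \<Rightarrow> 'n \<Rightarrow> real ^ 'n \<Rightarrow> real" where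
  "grad_c M c w j y = (\<Sum>a\<in>UNIV. gup M c j a y * pd a w y)"

definition inner_c :: "('m, 'n::finite) riem \<Rightarrow> ('m, 'n) chart \<Rightarrow> (real ^ 'n \<Rightarrow> real) \<Rightarrow> (real ^ 'n \<Rightarrow> real) \<Rightarrow> real ^ 'n \<Rightarrow> real" where
  "inner_c M c v w y = (\<Sum>j\<in>UNIV. pd j v y * grad_c M c w j y)"

definition hess_c :: "('m, 'n::finite) riem \<Rightarrow> ('m, 'n) chart \<Rightarrow> (real ^ 'n \<Rightarrow> real) \<Rightarrow> 'n \<Rightarrow> 'n \<Rightarrow> real ^ 'n \<Rightarrow> real" where
  "hess_c M c w i j y = pd i (pd j w) y - (\<Sum>k\<in>UNIV. christoffel M c k i j y * pd k w y)"

definition lap_c :: "('m, 'n::finite) riem \<Rightarrow> ('m, 'n) chart \<Rightarrow> (real ^ 'n \<Rightarrow> real) \<Rightarrow> real ^ 'n \<Rightarrow> real" where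
  "lap_c M c w y = (\<Sum>i\<in>UNIV. \<Sum>j\<in>UNIV. gup M c i j y * hess_c M c w i j y)"

definition vol_c :: "('m, 'n::finite) riem \<Rightarrow> ('m, 'n) chart \<Rightarrow> real ^ 'n \<Rightarrow> real" where
  "vol_c M c y = sqrt (det (gmat M c y))"

lemma matrix_add_rdistrib: "(A + B) ** C = A ** C + B ** C"
  by (vector matrix_matrix_mult_def sum.distrib[symmetric] field_simps)

lemma sum_delta_mult:
  fixes f :: "'n::finite \<Rightarrow> real"
  shows "(\<Sum>k\<in>UNIV. (if i = k then 1 else 0) * f k) = f i" "(\<Sum>k\<in>UNIV. (if k = i then 1 else 0) * f k) = f i"
    "(\<Sum>k\<in>UNIV. f k * (if i = k then 1 else 0)) = f i" "(\<Sum>k\<in>UNIV. f k * (if k = i then 1 else 0)) = f i"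
  by (simp_all add: if_distrib if_distribR cong: if_cong)

lemma sum3_swap:
  fixes f :: "'a \<Rightarrow> 'b \<Rightarrow> 'c \<Rightarrow> real"
  shows "(\<Sum>a\<in>A. \<Sum>b\<in>B. \<Sum>c\<in>C. f a b c) = (\<Sum>c\<in>C. \<Sum>b\<in>B. \<Sum>a\<in>A. f a b c)"
    and "(\<Sum>a\<in>A. \<Sum>b\<in>B. \<Sum>c\<in>C. f a b c) = (\<Sum>b\<in>B. \<Sum>c\<in>C. \<Sum>a\<in>A. f a b c)"
proof -
  have 1: "(\<Sum>b\<in>B. \<Sum>c\<in>C. f a b c) = (\<Sum>c\<in>C. \<Sum>b\<in>B. f a b c)" for a by (rule sum.swap)
  have 2: "(\<Sum>a\<in>A. \<Sum>b\<in>B. f a b c) = (\<Sum>b\<in>B. \<Sum>a\<in>A. f a b c)" for c by (rule sum.swap)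
  have "(\<Sum>a\<in>A. \<Sum>b\<in>B. \<Sum>c\<in>C. f a b c) = (\<Sum>c\<in>C. \<Sum>a\<in>A. \<Sum>b\<in>B. f a b c)"
    unfolding 1 by (rule sum.swap)
  then show 3: "(\<Sum>a\<in>A. \<Sum>b\<in>B. \<Sum>c\<in>C. f a b c) = (\<Sum>c\<in>C. \<Sum>b\<in>B. \<Sum>a\<in>A. f a b c)"
    unfolding 2 .
  show "(\<Sum>a\<in>A. \<Sum>b\<in>B. \<Sum>c\<in>C. f a b c) = (\<Sum>b\<in>B. \<Sum>c\<in>C. \<Sum>a\<in>A. f a b c)"
    unfolding 3 by (rule sum.swap)
qed

text \<open>Index form, at one point, of div(\<nabla>_X X) = tr((\<nabla>X)^2) + X(div X) + Ric(X,
  X) for a vector field X and a torsion-free connection; no metric occurs. Here A j m is \<nabla>_j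
  X^m, dX j m is \<partial>_j X^m, dd j m is \<partial>_j \<partial>_m X^j, G k i j is
  \<Gamma>^k_ij, dG i k a b is \<partial>_i \<Gamma>^k_ab, and L = div X.\<close>

lemma bochner_algebra:
  fixes X dL :: "'n::finite \<Rightarrow> real" and A dX dd R :: "'n \<Rightarrow> 'n \<Rightarrow> real"
    and G :: "'n \<Rightarrow> 'n \<Rightarrow> 'n \<Rightarrow> real" and dG :: "'n \<Rightarrow> 'n \<Rightarrow> 'n \<Rightarrow> 'n \<Rightarrow> real"
  assumes dX: "\<And>j m. dX j m = A j m - (\<Sum>p\<in>UNIV. G m j p * X p)"
    and dL: "\<And>m. dL m = (\<Sum>j\<in>UNIV. dd j m) + (\<Sum>j\<in>UNIV. \<Sum>l\<in>UNIV. dG m j j l * X l + G j j l * dX m l)"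
    and sym: "\<And>i j k. G k i j = G k j i"
    and R: "\<And>m p. R p m = (\<Sum>j\<in>UNIV. dG j j p m - dG p j j m + (\<Sum>a\<in>UNIV. G j j a * G a p m - G j p a * G a j m))"
  shows "(\<Sum>j\<in>UNIV. \<Sum>m\<in>UNIV. dX j m * A m j + X m * (dd j m + (\<Sum>p\<in>UNIV. dG j j m p * X p + G j m p * dX j p)))
      + (\<Sum>j\<in>UNIV. \<Sum>l\<in>UNIV. G j j l * (\<Sum>m\<in>UNIV. X m * A m l))
    = (\<Sum>j\<in>UNIV. \<Sum>m\<in>UNIV. A j m * A m j) + (\<Sum>m\<in>UNIV. X m * dL m) + (\<Sum>m\<in>UNIV. \<Sum>p\<in>UNIV. X m * R m p * X p)"
    (is "?L = _")
proof -
  let ?U = "UNIV :: 'n set"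
  define a2 where "a2 = (\<Sum>j\<in>?U. \<Sum>m\<in>?U. \<Sum>p\<in>?U. G m j p * X p * A m j)"
  define a3 where "a3 = (\<Sum>j\<in>?U. \<Sum>m\<in>?U. X m * dd j m)"
  define a4 where "a4 = (\<Sum>j\<in>?U. \<Sum>m\<in>?U. \<Sum>p\<in>?U. X m * (dG j j m p * X p))"
  define a5 where "a5 = (\<Sum>j\<in>?U. \<Sum>m\<in>?U. \<Sum>p\<in>?U. X m * (G j m p * A j p))"
  define a6 where "a6 = (\<Sum>j\<in>?U. \<Sum>m\<in>?U. \<Sum>p\<in>?U. \<Sum>q\<in>?U. X m * (G j m p * (G p j q * X q)))"
  define a7 where "a7 = (\<Sum>j\<in>?U. \<Sum>l\<in>?U. \<Sum>m\<in>?U. G j j l * (X m * A m l))"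
  define b1 where "b1 = (\<Sum>m\<in>?U. \<Sum>j\<in>?U. \<Sum>l\<in>?U. X m * (dG m j j l * X l))"
  define b3 where "b3 = (\<Sum>m\<in>?U. \<Sum>j\<in>?U. \<Sum>l\<in>?U. \<Sum>q\<in>?U. X m * (G j j l * (G l m q * X q)))"
  have lhs: "?L
     = (\<Sum>j\<in>UNIV. \<Sum>m\<in>UNIV. A j m * A m j) - a2 + a3 + a4 + a5 - a6 + a7"
    unfolding dX a2_def a3_def a4_def a5_def a6_def a7_def
    by (simp add: left_diff_distrib right_diff_distrib distrib_left sum.distrib sum_subtractf
        sum_distrib_left sum_distrib_right)
  have "(\<Sum>m\<in>?U. X m * dL m) = (\<Sum>m\<in>?U. \<Sum>j\<in>?U. X m * dd j m) + b1
      + (\<Sum>m\<in>?U. \<Sum>j\<in>?U. \<Sum>l\<in>?U. X m * (G j j l * A m l)) - b3"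
    unfolding dL dX b1_def b3_def
    by (simp add: left_diff_distrib right_diff_distrib distrib_left sum.distrib sum_subtractf
        sum_distrib_left sum_distrib_right)
  also have "(\<Sum>m\<in>?U. \<Sum>j\<in>?U. X m * dd j m) = a3" unfolding a3_def by (rule sum.swap)
  also have "(\<Sum>m\<in>?U. \<Sum>j\<in>?U. \<Sum>l\<in>?U. X m * (G j j l * A m l)) = a7"
    unfolding a7_def by (subst sum3_swap(2)) (simp add: mult.left_commute)
  finally have dl: "(\<Sum>m\<in>?U. X m * dL m) = a3 + b1 + a7 - b3" .
  \<comment> \<open>Exchanging the indices of R costs nothing, because X m * X p is symmetric;
    symmetry of the Ricci tensor is not invoked.\<close>
  have "(\<Sum>m\<in>?U. \<Sum>p\<in>?U. X m * R m p * X p) = (\<Sum>m\<in>?U. \<Sum>p\<in>?U. X m * R p m * X p)"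
    by (subst sum.swap) (simp add: mult_ac)
  also have "\<dots>
    = (\<Sum>m\<in>?U. \<Sum>p\<in>?U. \<Sum>j\<in>?U. X m * dG j j p m * X p) - (\<Sum>m\<in>?U. \<Sum>p\<in>?U. \<Sum>j\<in>?U. X m * dG p j j m * X p)
     + (\<Sum>m\<in>?U. \<Sum>p\<in>?U. \<Sum>j\<in>?U. \<Sum>a\<in>?U. X m * (G j j a * G a p m) * X p)
     - (\<Sum>m\<in>?U. \<Sum>p\<in>?U. \<Sum>j\<in>?U. \<Sum>a\<in>?U. X m * (G j p a * G a j m) * X p)"
    unfolding R
    by (simp add: left_diff_distrib right_diff_distrib distrib_left distrib_right sum.distrib sum_subtractf
        sum_distrib_left sum_distrib_right)
  also have "(\<Sum>m\<in>?U. \<Sum>p\<in>?U. \<Sum>j\<in>?U. X m * dG j j p m * X p) = a4"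
    unfolding a4_def by (subst sum3_swap(1)) (simp add: mult_ac)
  also have "(\<Sum>m\<in>?U. \<Sum>p\<in>?U. \<Sum>j\<in>?U. X m * dG p j j m * X p) = b1"
    unfolding b1_def by (subst sum3_swap(2)) (simp add: mult_ac)
  also have "(\<Sum>m\<in>?U. \<Sum>p\<in>?U. \<Sum>j\<in>?U. \<Sum>a\<in>?U. X m * (G j j a * G a p m) * X p) = b3"
    unfolding b3_def
  proof (rule sum.cong[OF refl], subst sum3_swap(2))
    fix m
    have "G a p m = G a m p" for a p by (rule sym)
    then show "(\<Sum>j\<in>?U. \<Sum>a\<in>?U. \<Sum>p\<in>?U. X m * (G j j a * G a p m) * X p)
      = (\<Sum>j\<in>?U. \<Sum>l\<in>?U. \<Sum>q\<in>?U. X m * (G j j l * (G l m q * X q)))"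
      by (simp add: mult.assoc)
  qed
  also have "(\<Sum>m\<in>?U. \<Sum>p\<in>?U. \<Sum>j\<in>?U. \<Sum>a\<in>?U. X m * (G j p a * G a j m) * X p) = a6"
    unfolding a6_def
  proof (rule trans[OF sum3_swap(1)], rule sum.cong[OF refl], rule sum.cong[OF refl])
    fix j p
    show "(\<Sum>m\<in>?U. \<Sum>a\<in>?U. X m * (G j p a * G a j m) * X p) = (\<Sum>a\<in>?U. \<Sum>m\<in>?U. X p * (G j p a * (G a j m * X m)))"
      by (subst sum.swap) (simp add: mult_ac)
  qed
  finally have ric: "(\<Sum>m\<in>?U. \<Sum>p\<in>?U. X m * R m p * X p) = a4 - b1 + b3 - a6" .
  \<comment> \<open>The two sums that combine one \<Gamma> with one \<nabla>X cancel: they differ by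
    a renaming and by the order of the lower indices of \<Gamma>.\<close>
  have "a2 = (\<Sum>m\<in>?U. \<Sum>j\<in>?U. \<Sum>p\<in>?U. G m j p * X p * A m j)"
    unfolding a2_def by (rule sum.swap)
  also have "\<dots> = a5" unfolding a5_def
  proof (rule sum.cong[OF refl])
    fix m
    have "(\<Sum>j\<in>?U. \<Sum>p\<in>?U. G m j p * X p * A m j) = (\<Sum>p\<in>?U. \<Sum>j\<in>?U. G m j p * X p * A m j)"
      by (rule sum.swap)
    also have "\<dots> = (\<Sum>q\<in>?U. \<Sum>p\<in>?U. X q * (G m q p * A m p))"
    proof (intro sum.cong refl)
      fix p j
      show "G m j p * X p * A m j = X p * (G m p j * A m j)" using sym[of m j p] by simp
    qed
    finally show "(\<Sum>j\<in>?U. \<Sum>p\<in>?U. G m j p * X p * A m j) = (\<Sum>q\<in>?U. \<Sum>p\<in>?U. X q * (G m q p * A m p))" .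
  qed
  finally have "a2 = a5" .
  then show ?thesis unfolding lhs dl ric by simp
qed

locale riem_chart =
  fixes M :: "('m::t2_space, 'n::finite) riem" and c :: "('m, 'n) chart"
  assumes closed: "closed_riemannian_manifold M" and atlas: "c \<in> atlas M"
begin

abbreviation V where "V \<equiv> img_chart c"
abbreviation \<Gamma> where "\<Gamma> \<equiv> christoffel M c"
abbreviation g where "g i j y \<equiv> gmat M c y $ i $ j"
abbreviation gi where "gi \<equiv> gup M c"

lemma is_chart: "is_chart c"
  using closed atlas unfolding closed_riemannian_manifold_def smooth_atlas_def by blast

lemma V_open: "open V" and dom_open: "open (fst c)"
  and homeo: "homeomorphism (fst c) V (snd c) (inv_chart c)" using is_chart unfolding is_chart_def by auto

lemma inv_chart_dom: "y \<in> V \<Longrightarrow> inv_chart c y \<in> fst c"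
  and coord_inv: "y \<in> V \<Longrightarrow> snd c (inv_chart c y) = y"
  and inv_coord: "p \<in> fst c \<Longrightarrow> inv_chart c (snd c p) = p"
  and coord_img: "p \<in> fst c \<Longrightarrow> snd c p \<in> V"
  using homeo unfolding homeomorphism_def by auto

lemma metric_facts: "smooth_on V (metric M c \<circ> inv_chart c)"
  "y \<in> V \<Longrightarrow> pos_def (gmat M c y)"
proof -
  have *: "riemannian_metric M" using closed unfolding closed_riemannian_manifold_def by blast
  show "smooth_on V (metric M c \<circ> inv_chart c)" using * atlas unfolding riemannian_metric_def by blast
  show "pos_def (gmat M c y)" if "y \<in> V"
    using * atlas inv_chart_dom[OF that] unfolding riemannian_metric_def pos_def_def gmat_def by blast
qed

lemma g_smooth: "smooth_on V (g i j)"
proof -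
  have "bounded_linear (\<lambda>A::real^'n^'n. A $ i $ j)"
    by (rule bounded_linear_compose[OF bounded_linear_vec_nth bounded_linear_vec_nth])
  from smooth_on_bounded_linear[OF V_open this metric_facts(1)] show ?thesis by (simp add: gmat_def o_def)
qed

lemma g_sym: "y \<in> V \<Longrightarrow> g i j y = g j i y" using pos_def_sym metric_facts(2) by blast

lemma gi_sym: "y \<in> V \<Longrightarrow> gi i j y = gi j i y"
  unfolding gup_def using pos_def_sym pos_def_matrix_inv metric_facts(2) by blast

lemma g_inv: "y \<in> V \<Longrightarrow> invertible (gmat M c y)"
  using pos_def_invertible metric_facts(2) by blast

lemma det_pos: "y \<in> V \<Longrightarrow> det (gmat M c y) > 0"
  using pos_def_det_pos metric_facts(2) by blast

lemma smooth_det: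
  assumes "\<And>i j. smooth_on V (\<lambda>y. A y $ i $ j)"
  shows "smooth_on V (\<lambda>y. det (A y :: real^'k::finite^'k))" unfolding det_def
  by (intro smooth_on_sum smooth_on_mult smooth_on_prod smooth_on_const V_open assms)

lemma gi_smooth: "smooth_on V (gi i j)"
proof -
  have "smooth_on V (\<lambda>y. det (\<chi> i' j'. if j' = i then (axis j 1 :: real ^ 'n) $ i' else gmat M c y $ i' $ j')
      / det (gmat M c y))"
  proof (intro smooth_on_divide smooth_det V_open g_smooth)
    show "smooth_on V (\<lambda>y. (\<chi> i' j'. if j' = i then (axis j 1 :: real ^ 'n) $ i' else g i' j' y) $ k $ l)" for k l
      by (cases "l = i") (auto intro: smooth_on_const V_open g_smooth)
  qed (use det_pos in force)
  then show ?thesis by (subst smooth_on_cong) (auto simp: gup_def matrix_inv_cramer g_inv)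
qed

lemma christoffel_smooth: "smooth_on V (\<Gamma> k i j)"
proof -
  have "smooth_on V (\<lambda>y. (\<Sum>l\<in>UNIV. gi k l y * (pd i (g j l) y + pd j (g i l) y - pd l (g i j) y)) / 2)"
    by (intro smooth_on_divide smooth_on_sum smooth_on_mult smooth_on_diff smooth_on_add smooth_on_pd
        smooth_on_const V_open gi_smooth g_smooth) auto
  then show ?thesis by (simp add: christoffel_def[abs_def] gup_def)
qed

section \<open>Metric compatibility and the volume density\<close>

lemma pd_g_sym: "y \<in> V \<Longrightarrow> pd k (g i j) y = pd k (g j i) y"
  by (rule pd_cong[OF V_open]) (auto simp: g_sym)

lemma christoffel_sym: "y \<in> V \<Longrightarrow> \<Gamma> k i j y = \<Gamma> k j i y"
  unfolding christoffel_def using pd_g_sym[of y _ i j] by (simp add: algebra_simps)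

lemma differentiable_in_chart: "y \<in> V \<Longrightarrow> smooth_on V f \<Longrightarrow> f differentiable at y"
  using smooth_on_differentiable V_open by blast

text \<open>Compatibility of the Levi-Civita connection with the metric. Lowering the upper index of
  \<Gamma> cancels the inverse metric and leaves the symbols of the first kind; symmetrising them in
  a and b removes all but \<partial>_k g_ab.\<close>

lemma pd_metric:
  assumes "y \<in> V"
  defines "C k \<equiv> \<chi> i j. \<Gamma> i k j y"
  shows "(\<chi> a b. pd k (g a b) y) = gmat M c y ** C k + transpose (gmat M c y ** C k)"
proof -
  have 1: "(gmat M c y ** C k) $ a $ b = (pd k (g b a) y + pd b (g k a) y - pd a (g k b) y) / 2" for a b
  proof -
    have inv: "(\<Sum>l\<in>UNIV. g a l y * gi l m y) = (if a = m then 1 else 0)" for m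
      using arg_cong[OF matrix_inv_right[OF g_inv[OF assms(1)]], of "\<lambda>A. A $ a $ m"]
      by (simp add: matrix_matrix_mult_def mat_def gup_def)
    have "(gmat M c y ** C k) $ a $ b = (\<Sum>l\<in>UNIV. g a l y * \<Gamma> l k b y)"
      by (simp add: matrix_matrix_mult_def C_def)
    also have "\<dots> = (\<Sum>l\<in>UNIV. \<Sum>m\<in>UNIV. g a l y * gi l m y * (pd k (g b m) y + pd b (g k m) y - pd m (g k b) y)) / 2"
      by (simp add: christoffel_def gup_def sum_distrib_left sum_divide_distrib mult.assoc)
    also have "\<dots> = (\<Sum>m\<in>UNIV. (\<Sum>l\<in>UNIV. g a l y * gi l m y) * (pd k (g b m) y + pd b (g k m) y - pd m (g k b) y)) / 2"
      by (subst sum.swap) (simp add: sum_distrib_right)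
    finally show ?thesis unfolding inv sum_delta_mult by simp
  qed
  show ?thesis
    by (simp add: vec_eq_iff transpose_def 1 pd_g_sym[OF assms(1), of k] pd_g_sym[OF assms(1), of _ k] field_simps)
qed

text \<open>Differentiating g g^-1 = 1 expresses the derivative of the inverse as minus g^-1
  (\<partial>_k g) g^-1, into which \<open>pd_metric\<close> is inserted.\<close>

lemma pd_gi:
  assumes y: "y \<in> V"
  shows "pd k (gi i j) y = - (\<Sum>l\<in>UNIV. \<Gamma> i k l y * gi l j y) - (\<Sum>l\<in>UNIV. \<Gamma> j k l y * gi l i y)"
proof -
  define C where "C = (\<chi> i j. \<Gamma> i k j y)"
  define D where "D = (\<chi> i j. pd k (gi i j) y)"
  define A where "A = gmat M c y"
  define B where "B = matrix_inv A"
  define E where "E = (\<chi> a b. pd k (g a b) y)"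
  have AB: "A ** B = mat 1" "B ** A = mat 1" unfolding A_def B_def using matrix_inv_props g_inv[OF y] by auto
  have sym: "transpose A = A" using metric_facts(2)[OF y] unfolding pos_def_def A_def by blast
  have E: "E = A ** C + transpose C ** A"
    unfolding E_def A_def C_def pd_metric[OF y] using sym by (simp add: matrix_transpose_mul A_def)
  have "pd k (\<lambda>z. \<Sum>b\<in>UNIV. g a b z * gi b j z) y = 0" for a j
  proof -
    have "(\<Sum>b\<in>UNIV. g a b z * gi b j z) = mat 1 $ a $ j" if "z \<in> V" for z
      using arg_cong[OF matrix_inv_right[OF g_inv[OF that]], of "\<lambda>A. A $ a $ j"]
      by (simp add: matrix_matrix_mult_def gup_def)
    then have "pd k (\<lambda>z. \<Sum>b\<in>UNIV. g a b z * gi b j z) y = pd k (\<lambda>z. mat 1 $ a $ j) y"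
      by (intro pd_cong[OF V_open y])
    then show ?thesis by (simp add: pd_const)
  qed
  then have "(\<Sum>b\<in>UNIV. pd k (g a b) y * gi b j y + g a b y * pd k (gi b j) y) = 0" for a j
    using pd_sum[of UNIV "\<lambda>b z. g a b z * gi b j z" y k] pd_mult[OF differentiable_in_chart[OF y g_smooth] differentiable_in_chart[OF y gi_smooth]]
    by (simp add: differentiable_in_chart[OF y g_smooth] differentiable_in_chart[OF y gi_smooth])
  then have "E ** B + A ** D = 0"
    by (simp add: vec_eq_iff matrix_matrix_mult_def E_def D_def A_def B_def gup_def sum.distrib)
  then have "B ** (E ** B) + B ** (A ** D) = 0"
    by (subst matrix_add_ldistrib[symmetric]) (simp add: matrix_matrix_mult_def vec_eq_iff)
  then have "D = - (B ** E ** B)" by (simp add: matrix_mul_assoc AB eq_neg_iff_add_eq_0 add.commute)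
  also have "B ** E ** B = (B ** A) ** (C ** B) + B ** transpose C ** (A ** B)"
    unfolding E by (simp add: matrix_add_ldistrib matrix_add_rdistrib matrix_mul_assoc)
  also have "\<dots> = C ** B + B ** transpose C" unfolding AB by simp
  finally have "D $ i $ j = - ((C ** B) $ i $ j + (B ** transpose C) $ i $ j)" by simp
  then show ?thesis
    by (simp add: D_def C_def B_def A_def gup_def[symmetric] matrix_matrix_mult_def transpose_def
        gi_sym[OF y, of i] mult.commute)
qed

lemma vol_pos: "y \<in> V \<Longrightarrow> vol_c M c y > 0" unfolding vol_c_def using det_pos by simp

text \<open>The divergence theorem differentiates the density only once, so one order of regularity
  is established for the square root.\<close>

lemma vol_C1: "Ck_on 1 V (vol_c M c)"
proof -
  have sd: "smooth_on V (\<lambda>y. det (gmat M c y))" by (rule smooth_det) (rule g_smooth)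
  have "Ck_on (Suc 0) V (vol_c M c)" unfolding vol_c_def[abs_def]
  proof (rule Ck_on_SucI[OF V_open])
    show "((\<lambda>y. sqrt (det (gmat M c y))) has_derivative
       (\<lambda>v. frechet_derivative (\<lambda>y. det (gmat M c y)) (at x) v * (inverse (sqrt (det (gmat M c x))) / 2))) (at x)" if "x \<in> V" for x
      using det_pos[OF that] by (intro has_derivative_real_sqrt smooth_on_has_derivative[OF V_open sd that]) auto
    have "continuous_on V (\<lambda>x. frechet_derivative (\<lambda>y. det (gmat M c y)) (at x) v)" for v
      using Ck_on_Suc_derivative[OF V_open] sd Ck_on_continuous_on unfolding smooth_on_def by blast
    then show "Ck_on 0 V (\<lambda>x. frechet_derivative (\<lambda>y. det (gmat M c y)) (at x) v * (inverse (sqrt (det (gmat M c x))) / 2))" for v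
      using smooth_on_continuous_on[OF sd] det_pos by (fastforce intro!: continuous_intros)
  qed
  then show ?thesis by simp
qed

lemma vol_diff: "y \<in> V \<Longrightarrow> vol_c M c differentiable at y"
  using Ck_on_Suc_has_derivative[OF V_open] vol_C1 unfolding One_nat_def differentiable_def by blast

text \<open>By Jacobi's formula the logarithmic derivative of det g is the trace of g^-1
  \<partial>_k g. Metric compatibility makes this trace 2 \<Gamma>^i_ik, and the square root halves
  it.\<close>

lemma pd_vol:
  assumes y: "y \<in> V"
  shows "pd k (vol_c M c) y = vol_c M c y * (\<Sum>i\<in>UNIV. \<Gamma> i i k y)"
proof -
  define A where "A = gmat M c y"
  define C where "C = (\<chi> i j. \<Gamma> i k j y)"
  have AB: "A ** matrix_inv A = mat 1" "matrix_inv A ** A = mat 1"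
    unfolding A_def using matrix_inv_props g_inv[OF y] by auto
  have sym: "transpose A = A" using metric_facts(2)[OF y] unfolding pos_def_def A_def by blast
  define A' where "A' h = (\<chi> i j. frechet_derivative (g i j) (at y) h)" for h
  have "((\<lambda>z. det (gmat M c z)) has_derivative
      (\<lambda>h. det (gmat M c y) * trace (A' h ** matrix_inv (gmat M c y)))) (at y)"
    by (rule has_derivative_det)
      (simp_all add: A'_def smooth_on_has_derivative[OF V_open g_smooth y] g_inv y)
  then have "pd k (\<lambda>z. det (gmat M c z)) y = det A * trace (A' (axis k 1) ** matrix_inv A)"
    unfolding A_def by (rule pd_eq)
  also have "A' (axis k 1) = A ** C + transpose C ** A" using pd_metric[OF y, of k] sym
    by (simp add: A'_def pd_def matrix_transpose_mul A_def C_def)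
  also have "trace ((A ** C + transpose C ** A) ** matrix_inv A) = 2 * trace C"
  proof -
    have "(A ** C + transpose C ** A) ** matrix_inv A = (A ** C) ** matrix_inv A + transpose C"
      by (simp add: matrix_add_rdistrib matrix_mul_assoc[symmetric] AB)
    moreover have "trace ((A ** C) ** matrix_inv A) = trace C"
      by (subst trace_mul_sym) (simp add: matrix_mul_assoc AB)
    ultimately show ?thesis by (simp add: trace_add trace_transpose)
  qed
  also have "trace C = (\<Sum>i\<in>UNIV. \<Gamma> i i k y)"
    by (simp add: trace_def C_def christoffel_sym[OF y, of _ k])
  finally have d: "pd k (\<lambda>z. det (gmat M c z)) y = 2 * det A * (\<Sum>i\<in>UNIV. \<Gamma> i i k y)" by simp
  have "pd k (vol_c M c) y = inverse (sqrt (det A)) / 2 * pd k (\<lambda>z. det (gmat M c z)) y"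
    unfolding vol_c_def[abs_def] A_def
    by (rule pd_chain) (use det_pos[OF y] smooth_det[OF g_smooth] differentiable_in_chart[OF y] in
        \<open>auto intro!: derivative_eq_intros\<close>)
  also have "\<dots> = vol_c M c y * (\<Sum>i\<in>UNIV. \<Gamma> i i k y)"
    using det_pos[OF y] unfolding d vol_c_def A_def by (simp add: field_simps real_sqrt_mult_self)
  finally show ?thesis .
qed

section \<open>Gradient, Hessian and Laplacian in a chart; Bochner's formula\<close>

lemma grad_c_smooth: "smooth_on V w \<Longrightarrow> smooth_on V (grad_c M c w j)"
  unfolding grad_c_def[abs_def] by (intro smooth_on_sum smooth_on_mult smooth_on_pd V_open gi_smooth)

lemma inner_c_smooth: "smooth_on V v \<Longrightarrow> smooth_on V w \<Longrightarrow> smooth_on V (inner_c M c v w)"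
  unfolding inner_c_def[abs_def] by (intro smooth_on_sum smooth_on_mult smooth_on_pd grad_c_smooth V_open)

lemma hess_c_smooth: "smooth_on V w \<Longrightarrow> smooth_on V (hess_c M c w i j)"
  unfolding hess_c_def[abs_def]
  by (intro smooth_on_diff smooth_on_sum smooth_on_mult smooth_on_pd V_open christoffel_smooth)

lemma lap_c_smooth: "smooth_on V w \<Longrightarrow> smooth_on V (lap_c M c w)"
  unfolding lap_c_def[abs_def] by (intro smooth_on_sum smooth_on_mult hess_c_smooth V_open gi_smooth)

lemma hess_c_sym: "y \<in> V \<Longrightarrow> smooth_on V w \<Longrightarrow> hess_c M c w i j y = hess_c M c w j i y"
  unfolding hess_c_def using pd_commute[OF V_open] christoffel_sym by simp

text \<open>Raising an index commutes with covariant differentiation: one of the two \<Gamma> terms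
  of \<open>pd_gi\<close> completes the second derivatives of w to the Hessian, the other is the
  connection term of the vector field \<nabla>w.\<close>

lemma pd_grad_c:
  assumes y: "y \<in> V" and w: "smooth_on V w"
  shows "pd k (grad_c M c w j) y = (\<Sum>a\<in>UNIV. gi j a y * hess_c M c w k a y) - (\<Sum>l\<in>UNIV. \<Gamma> j k l y * grad_c M c w l y)"
proof -
  let ?U = "UNIV :: 'n set"
  have "pd k (grad_c M c w j) y = (\<Sum>a\<in>?U. pd k (gi j a) y * pd a w y + gi j a y * pd k (pd a w) y)"
    unfolding grad_c_def[abs_def]
    by (subst pd_sum) (auto intro!: differentiable_in_chart[OF y] smooth_on_mult gi_smooth smooth_on_pd V_open w sum.cong pd_mult)
  also have "\<dots> = (\<Sum>a\<in>?U. gi j a y * pd k (pd a w) y) - (\<Sum>a\<in>?U. \<Sum>l\<in>?U. \<Gamma> j k l y * gi l a y * pd a w y)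
      - (\<Sum>a\<in>?U. \<Sum>l\<in>?U. \<Gamma> a k l y * gi l j y * pd a w y)"
    by (simp add: pd_gi[OF y] sum.distrib sum_subtractf left_diff_distrib sum_distrib_right sum_negf)
  also have "(\<Sum>a\<in>?U. \<Sum>l\<in>?U. \<Gamma> j k l y * gi l a y * pd a w y) = (\<Sum>l\<in>UNIV. \<Gamma> j k l y * grad_c M c w l y)"
    by (subst sum.swap) (simp add: grad_c_def sum_distrib_left mult_ac)
  also have "(\<Sum>a\<in>?U. \<Sum>l\<in>?U. \<Gamma> a k l y * gi l j y * pd a w y) = (\<Sum>l\<in>?U. gi j l y * (\<Sum>a\<in>?U. \<Gamma> a k l y * pd a w y))"
    by (subst sum.swap) (simp add: sum_distrib_left mult_ac gi_sym[OF y, of _ j])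
  finally show ?thesis by (simp add: hess_c_def right_diff_distrib sum_subtractf)
qed

text \<open>The trace of \<open>pd_grad_c\<close>. Since \<Gamma>^k_kl is the logarithmic derivative
  of the volume density, this makes the density times the Laplacian a plain coordinate divergence,
  the form that integration by parts needs.\<close>

lemma lap_c_divergence:
  assumes y: "y \<in> V" and w: "smooth_on V w"
  shows "lap_c M c w y = (\<Sum>k\<in>UNIV. pd k (grad_c M c w k) y) + (\<Sum>k\<in>UNIV. \<Sum>l\<in>UNIV. \<Gamma> k k l y * grad_c M c w l y)"
  by (simp add: pd_grad_c[OF y w] lap_c_def sum_subtractf gi_sym[OF y] hess_c_sym[OF y w])

text \<open>The derivative of the gradient factor yields one copy of the Hessian and a \<Gamma>
  term; that term turns the plain second derivatives coming from the other factor into the second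
  copy.\<close>

lemma pd_inner_c:
  assumes y: "y \<in> V" and w: "smooth_on V w"
  shows "pd k (inner_c M c w w) y = 2 * (\<Sum>j\<in>UNIV. hess_c M c w k j y * grad_c M c w j y)"
proof -
  let ?U = "UNIV :: 'n set"
  have "pd k (inner_c M c w w) y = (\<Sum>j\<in>?U. pd k (pd j w) y * grad_c M c w j y + pd j w y * pd k (grad_c M c w j) y)"
    unfolding inner_c_def[abs_def]
    by (subst pd_sum) (auto intro!: differentiable_in_chart[OF y] smooth_on_mult grad_c_smooth smooth_on_pd V_open w sum.cong pd_mult)
  also have "\<dots> = (\<Sum>j\<in>?U. pd k (pd j w) y * grad_c M c w j y) + (\<Sum>j\<in>?U. \<Sum>a\<in>?U. pd j w y * (gi j a y * hess_c M c w k a y))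
     - (\<Sum>j\<in>?U. \<Sum>l\<in>?U. pd j w y * (\<Gamma> j k l y * grad_c M c w l y))"
    by (simp add: pd_grad_c[OF y w] sum.distrib sum_subtractf right_diff_distrib sum_distrib_left)
  also have "(\<Sum>j\<in>?U. \<Sum>a\<in>?U. pd j w y * (gi j a y * hess_c M c w k a y)) = (\<Sum>j\<in>?U. hess_c M c w k j y * grad_c M c w j y)"
    by (subst sum.swap) (simp add: grad_c_def sum_distrib_left mult_ac gi_sym[OF y])
  also have "(\<Sum>j\<in>?U. \<Sum>l\<in>?U. pd j w y * (\<Gamma> j k l y * grad_c M c w l y))
      = (\<Sum>l\<in>?U. (\<Sum>j\<in>?U. \<Gamma> j k l y * pd j w y) * grad_c M c w l y)"
    by (subst sum.swap) (simp add: sum_distrib_left sum_distrib_right mult_ac)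
  finally show ?thesis by (simp add: hess_c_def left_diff_distrib sum_subtractf)
qed

text \<open>With X = \<nabla>w, half the gradient of |\<nabla>w|^2 is \<nabla>_X X by
  \<open>pd_inner_c\<close>, so the left-hand side is its divergence and
  \<open>bochner_algebra\<close> applies.\<close>

lemma bochner_c:
  assumes y: "y \<in> V" and w: "smooth_on V w"
  shows "lap_c M c (inner_c M c w w) y / 2 =
     (\<Sum>i\<in>UNIV. \<Sum>j\<in>UNIV. \<Sum>k\<in>UNIV. \<Sum>l\<in>UNIV. gi i k y * gi j l y * hess_c M c w i j y * hess_c M c w k l y)
     + (\<Sum>m\<in>UNIV. grad_c M c w m y * pd m (lap_c M c w) y)
     + (\<Sum>m\<in>UNIV. \<Sum>p\<in>UNIV. grad_c M c w m y * ricci_coord M c y $ m $ p * grad_c M c w p y)"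
proof -
  let ?U = "UNIV :: 'n set"
  let ?X = "grad_c M c w"
  \<comment> \<open>This is \<nabla>_k X^j: the Hessian with its second index raised.\<close>
  define A where "A k j z = (\<Sum>a\<in>?U. gi j a z * hess_c M c w k a z)" for k j z
  have A_smooth: "smooth_on V (A k j)" for k j
    unfolding A_def[abs_def] by (intro smooth_on_sum smooth_on_mult hess_c_smooth gi_smooth V_open w)
  have A: "A k j z = pd k (?X j) z + (\<Sum>l\<in>?U. \<Gamma> j k l z * ?X l z)" if "z \<in> V" for k j z
    using pd_grad_c[OF that w, of k j] by (simp add: A_def)
  note sm = differentiable_in_chart[OF y] grad_c_smooth A_smooth smooth_on_pd[OF V_open] w christoffel_smooth
  have gQ: "grad_c M c (inner_c M c w w) j z = (\<Sum>m\<in>?U. 2 * (?X m z * A m j z))" if z: "z \<in> V" for j z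
  proof -
    have "grad_c M c (inner_c M c w w) j z = (\<Sum>a\<in>?U. \<Sum>m\<in>?U. gi j a z * (2 * (hess_c M c w a m z * ?X m z)))"
      by (simp add: grad_c_def[of M c "inner_c M c w w"] pd_inner_c[OF z w] sum_distrib_left)
    also have "\<dots> = (\<Sum>m\<in>?U. 2 * (?X m z * A m j z))"
      by (subst sum.swap) (simp add: A_def sum_distrib_left mult_ac hess_c_sym[OF z w])
    finally show ?thesis .
  qed
  have dgQ: "pd j (grad_c M c (inner_c M c w w) j) y
      = 2 * (\<Sum>m\<in>?U. pd j (?X m) y * A m j y + ?X m y * pd j (A m j) y)" for j
  proof -
    have "pd j (grad_c M c (inner_c M c w w) j) y = pd j (\<lambda>z. \<Sum>m\<in>?U. 2 * (?X m z * A m j z)) y"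
      by (rule pd_cong[OF V_open y gQ])
    also have "\<dots> = (\<Sum>m\<in>?U. 2 * (pd j (?X m) y * A m j y + ?X m y * pd j (A m j) y))"
    proof -
      have d: "(\<lambda>z. ?X m z * A m j z) differentiable at y" for m by (intro differentiable_mult sm)
      then show ?thesis by (subst pd_sum) (auto simp: pd_cmult[OF d] pd_mult sm)
    qed
    finally show ?thesis by (simp add: sum_distrib_left)
  qed
  have dA: "pd j (A m j) y = pd j (pd m (?X j)) y
      + (\<Sum>p\<in>?U. pd j (\<Gamma> j m p) y * ?X p y + \<Gamma> j m p y * pd j (?X p) y)" for j m
  proof -
    have "pd j (A m j) y = pd j (\<lambda>z. pd m (?X j) z + (\<Sum>l\<in>?U. \<Gamma> j m l z * ?X l z)) y"
      by (rule pd_cong[OF V_open y A])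
    also have "\<dots> = pd j (pd m (?X j)) y + (\<Sum>p\<in>?U. pd j (\<lambda>z. \<Gamma> j m p z * ?X p z) y)"
      by (subst pd_add, (intro differentiable_sum differentiable_mult sm)+, subst pd_sum)
        (auto intro!: sm smooth_on_mult V_open)
    also have "\<dots> = pd j (pd m (?X j)) y + (\<Sum>p\<in>?U. pd j (\<Gamma> j m p) y * ?X p y + \<Gamma> j m p y * pd j (?X p) y)"
      by (simp add: pd_mult sm)
    finally show ?thesis .
  qed
  have dL: "pd m (lap_c M c w) y = (\<Sum>j\<in>?U. pd j (pd m (?X j)) y)
     + (\<Sum>j\<in>?U. \<Sum>l\<in>?U. pd m (\<Gamma> j j l) y * ?X l y + \<Gamma> j j l y * pd m (?X l) y)" for m
  proof -
    have "pd m (lap_c M c w) y = pd m (\<lambda>z. (\<Sum>k\<in>?U. pd k (?X k) z) + (\<Sum>k\<in>?U. \<Sum>l\<in>?U. \<Gamma> k k l z * ?X l z)) y"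
      by (rule pd_cong[OF V_open y lap_c_divergence[OF _ w]])
    also have "\<dots> = (\<Sum>k\<in>?U. pd m (pd k (?X k)) y) + (\<Sum>k\<in>?U. pd m (\<lambda>z. \<Sum>l\<in>?U. \<Gamma> k k l z * ?X l z) y)"
    proof -
      have d: "(\<lambda>z. \<Sum>l\<in>?U. \<Gamma> k k l z * ?X l z) differentiable at y" for k
        by (intro differentiable_sum differentiable_mult sm)
      have d': "(pd k (?X k)) differentiable at y" for k by (intro sm)
      show ?thesis by (simp add: pd_add differentiable_sum d d'
          pd_sum[of ?U "\<lambda>k z. \<Sum>l\<in>?U. \<Gamma> k k l z * ?X l z", OF d] pd_sum[of ?U "\<lambda>k. pd k (?X k)", OF d'])
    qed
    also have "(\<Sum>k\<in>?U. pd m (\<lambda>z. \<Sum>l\<in>?U. \<Gamma> k k l z * ?X l z) y)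
        = (\<Sum>j\<in>?U. \<Sum>l\<in>?U. pd m (\<Gamma> j j l) y * ?X l y + \<Gamma> j j l y * pd m (?X l) y)"
      by (intro sum.cong refl, subst pd_sum) (auto intro!: sm smooth_on_mult V_open sum.cong pd_mult)
    finally show ?thesis using pd_commute[OF V_open grad_c_smooth[OF w] y, of m] by simp
  qed
  have "lap_c M c (inner_c M c w w) y / 2 =
     (\<Sum>j\<in>?U. \<Sum>m\<in>?U. pd j (?X m) y * A m j y + ?X m y * (pd j (pd m (?X j)) y
      + (\<Sum>p\<in>?U. pd j (\<Gamma> j m p) y * ?X p y + \<Gamma> j m p y * pd j (?X p) y)))
      + (\<Sum>j\<in>?U. \<Sum>l\<in>?U. \<Gamma> j j l y * (\<Sum>m\<in>?U. ?X m y * A m l y))"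
    by (simp add: lap_c_divergence[OF y inner_c_smooth[OF w w]] dgQ dA gQ[OF y] sum_distrib_left[symmetric] sum_divide_distrib add_divide_distrib)
  also have "\<dots> = (\<Sum>j\<in>?U. \<Sum>m\<in>?U. A j m y * A m j y) + (\<Sum>m\<in>?U. ?X m y * pd m (lap_c M c w) y)
      + (\<Sum>m\<in>?U. \<Sum>p\<in>?U. ?X m y * ricci_coord M c y $ m $ p * ?X p y)"
  proof (rule bochner_algebra[where dG = "\<lambda>i k a b. pd i (\<Gamma> k a b) y" and G = "\<lambda>k i j. \<Gamma> k i j y"])
    show "\<Gamma> i j k y = \<Gamma> i k j y" for i j k by (rule christoffel_sym[OF y])
    show "ricci_coord M c y $ p $ m = (\<Sum>j\<in>?U. pd j (\<Gamma> j p m) y - pd p (\<Gamma> j j m) y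
        + (\<Sum>a\<in>?U. \<Gamma> j j a y * \<Gamma> a p m y - \<Gamma> j p a y * \<Gamma> a j m y))" for p m
      by (simp add: ricci_coord_def riemann_coord_def)
  qed (simp_all add: A[OF y] dL)
  \<comment> \<open>Here the vector field being a gradient matters: the trace of the square of
    \<nabla>X is the full squared norm because the Hessian is symmetric.\<close>
  also have "(\<Sum>j\<in>?U. \<Sum>m\<in>?U. A j m y * A m j y) =
     (\<Sum>i\<in>?U. \<Sum>j\<in>?U. \<Sum>k\<in>?U. \<Sum>l\<in>?U. gi i k y * gi j l y * hess_c M c w i j y * hess_c M c w k l y)"
  proof -
    have "(\<Sum>j\<in>?U. \<Sum>m\<in>?U. A j m y * A m j y)
      = (\<Sum>i\<in>?U. \<Sum>l\<in>?U. \<Sum>j\<in>?U. \<Sum>k\<in>?U. gi i k y * gi j l y * hess_c M c w i j y * hess_c M c w k l y)"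
    proof (intro sum.cong refl)
      fix i l
      show "A i l y * A l i y = (\<Sum>j\<in>?U. \<Sum>k\<in>?U. gi i k y * gi j l y * hess_c M c w i j y * hess_c M c w k l y)"
        by (simp add: A_def sum_product gi_sym[OF y, of l] hess_c_sym[OF y w, of l] mult_ac)
    qed
    also have "\<dots> = (\<Sum>i\<in>?U. \<Sum>j\<in>?U. \<Sum>k\<in>?U. \<Sum>l\<in>?U. gi i k y * gi j l y * hess_c M c w i j y * hess_c M c w k l y)"
      by (rule sum.cong[OF refl]) (rule sum3_swap(2))
    finally show ?thesis .
  qed
  finally show ?thesis .
qed

end

section \<open>Invariance and bump functions\<close>

declare Ck_on.simps(2) [simp del]

lemma Ck_on_1I:
  fixes f :: "real ^ 'n \<Rightarrow> real"
  assumes "open S" "\<And>y. y \<in> S \<Longrightarrow> f differentiable at y" "\<And>i. continuous_on S (pd i f)"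
  shows "Ck_on 1 S f"
proof -
  have "Ck_on (Suc 0) S f"
  proof (rule Ck_on_SucI[OF assms(1)])
    show "(f has_derivative frechet_derivative f (at x)) (at x)" if "x \<in> S" for x
      using assms(2)[OF that] frechet_derivative_works by blast
    have "continuous_on S (\<lambda>x. \<Sum>i\<in>UNIV. v $ i * pd i f x)" for v
      by (intro continuous_intros assms)
    then show "Ck_on 0 S (\<lambda>x. frechet_derivative f (at x) v)" for v
      by (simp add: frechet_derivative_pd assms(2) cong: continuous_on_cong)
  qed
  then show ?thesis by simp
qed

lemma Ck_on_1_differentiable: "Ck_on 1 S f \<Longrightarrow> open S \<Longrightarrow> y \<in> S \<Longrightarrow> f differentiable at y"
  using Ck_on_Suc_has_derivative[of S 0 f y] differentiable_def by force

lemma Ck_on_1_pd: "Ck_on 1 S f \<Longrightarrow> open S \<Longrightarrow> continuous_on S (pd i f)"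
  using Ck_on_Suc_derivative[of S 0 f "axis i 1"] by (simp add: pd_def[abs_def])

text \<open>Serves functions extended by zero, which are checked separately on the open set carrying
  them and on the complement of their support.\<close>

lemma Ck_on_1_local:
  fixes f :: "real ^ 'n \<Rightarrow> real"
  assumes S: "open S" and loc: "\<And>x. x \<in> S \<Longrightarrow> \<exists>T. open T \<and> x \<in> T \<and> Ck_on 1 T f"
  shows "Ck_on 1 S f"
proof (rule Ck_on_1I[OF S])
  show "f differentiable at y" if "y \<in> S" for y using loc[OF that] Ck_on_1_differentiable by blast
  show "continuous_on S (pd i f)" for i unfolding continuous_on_eq_continuous_at[OF S]
    using loc Ck_on_1_pd continuous_on_eq_continuous_at by blast
qed

lemma Ck_on_1_compose:
  fixes f :: "real ^ 'k \<Rightarrow> real" and h :: "real ^ 'n \<Rightarrow> real ^ 'k"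
  assumes S: "open S" and T: "open T" and h: "smooth_on S h" and f: "Ck_on 1 T f" and sub: "h ` S \<subseteq> T"
  shows "Ck_on 1 S (\<lambda>x. f (h x))"
proof -
  have fd: "f differentiable at (h x)" if "x \<in> S" for x
    using Ck_on_1_differentiable[OF f T] that sub by blast
  have "Ck_on (Suc 0) S (\<lambda>x. f (h x))"
  proof (rule Ck_on_SucI[OF S])
    show "((\<lambda>x. f (h x)) has_derivative (\<lambda>v. \<Sum>i\<in>UNIV. frechet_derivative h (at x) v $ i * pd i f (h x))) (at x)"
      if x: "x \<in> S" for x
      using has_derivative_compose[OF smooth_on_has_derivative[OF S h x], of f, OF pd_has_derivative[OF fd[OF x]]]
      unfolding frechet_derivative_pd[OF fd[OF x]] .
    have 1: "continuous_on S (\<lambda>x. pd i f (h x))" for i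
      by (rule continuous_on_compose2[OF Ck_on_1_pd[OF f T] smooth_on_continuous_on[OF h] sub])
    have "continuous_on S (\<lambda>x. frechet_derivative h (at x) v)" for v
      using Ck_on_Suc_derivative[OF S] h Ck_on_continuous_on unfolding smooth_on_def by blast
    then show "Ck_on 0 S (\<lambda>x. \<Sum>i\<in>UNIV. frechet_derivative h (at x) v $ i * pd i f (h x))" for v
      using 1 by (auto intro!: continuous_intros)
  qed
  then show ?thesis by simp
qed

text \<open>The regularity required of test functions: integration by parts differentiates them
  once, and an elementary cut-off of class C^1 is at hand.\<close>

definition C1_fun :: "('m, 'n::finite) riem \<Rightarrow> ('m \<Rightarrow> real) \<Rightarrow> bool" where
  "C1_fun M f \<longleftrightarrow> (\<forall>c\<in>atlas M. Ck_on 1 (img_chart c) (f \<circ> inv_chart c))"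

definition ginner :: "('m, 'n::finite) riem \<Rightarrow> ('m \<Rightarrow> real) \<Rightarrow> ('m \<Rightarrow> real) \<Rightarrow> 'm \<Rightarrow> real" where
  "ginner M f h p = differential M f p \<bullet> grad M h p"

lemma smooth_fun_C1: "smooth_fun M f \<Longrightarrow> C1_fun M f"
  unfolding smooth_fun_def C1_fun_def smooth_on_def by blast

text \<open>The squared positive part vanishes to second order at 0, so the kink of the maximum
  disappears; this is the profile of the cut-off functions.\<close>

lemma has_derivative_max_sq: "((\<lambda>s::real. (max 0 s)\<^sup>2) has_real_derivative 2 * max 0 s) (at s)"
proof -
  consider "s > 0" | "s < 0" | "s = 0" by linarith
  then show ?thesis
  proof cases
    case 1
    have "((\<lambda>s::real. s\<^sup>2) has_real_derivative 2 * max 0 s) (at s)"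
      using 1 by (auto intro!: derivative_eq_intros)
    then show ?thesis by (rule has_field_derivative_transform_within_open[of _ _ _ "{0<..}"]) (use 1 in auto)
  next
    case 2
    have "((\<lambda>s::real. 0) has_real_derivative 2 * max 0 s) (at s)"
      using 2 by (auto intro!: derivative_eq_intros)
    then show ?thesis by (rule has_field_derivative_transform_within_open[of _ _ _ "{..<0}"]) (use 2 in auto)
  next
    case 3
    have "((\<lambda>s::real. (max 0 s)\<^sup>2 / s) \<longlongrightarrow> 0) (at 0)"
    proof (rule Lim_null_comparison)
      show "\<forall>\<^sub>F s::real in at 0. norm ((max 0 s)\<^sup>2 / s) \<le> norm s"
        by (rule always_eventually) (auto simp: max_def power2_eq_square)
      show "((\<lambda>s::real. norm s) \<longlongrightarrow> 0) (at 0)" by (intro tendsto_eq_intros) auto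
    qed
    then show ?thesis unfolding 3 by (simp add: has_field_derivative_iff)
  qed
qed

lemma bump_C1:
  fixes y0 :: "real ^ 'k"
  shows "Ck_on 1 UNIV (\<lambda>y. (max 0 (r - (y - y0) \<bullet> (y - y0)))\<^sup>2)"
proof -
  have "Ck_on (Suc 0) UNIV (\<lambda>y. (max 0 (r - (y - y0) \<bullet> (y - y0)))\<^sup>2)"
  proof (rule Ck_on_SucI[OF open_UNIV])
    show "((\<lambda>y. (max 0 (r - (y - y0) \<bullet> (y - y0)))\<^sup>2) has_derivative
        (\<lambda>v. 2 * max 0 (r - (x - y0) \<bullet> (x - y0)) * (- 2 * (v \<bullet> (x - y0))))) (at x)" for x
    proof (rule has_derivative_compose[where f = "\<lambda>y. r - (y - y0) \<bullet> (y - y0)" and g = "\<lambda>s. (max 0 s)\<^sup>2"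
        and f' = "\<lambda>v. - 2 * (v \<bullet> (x - y0))" and g' = "\<lambda>h. 2 * max 0 (r - (x - y0) \<bullet> (x - y0)) * h"])
      show "((\<lambda>y. r - (y - y0) \<bullet> (y - y0)) has_derivative (\<lambda>v. - 2 * (v \<bullet> (x - y0)))) (at x)"
        by (auto intro!: derivative_eq_intros simp: inner_commute)
      show "((\<lambda>s. (max 0 s)\<^sup>2) has_derivative (\<lambda>h. 2 * max 0 (r - (x - y0) \<bullet> (x - y0)) * h)) (at (r - (x - y0) \<bullet> (x - y0)))"
        using has_derivative_max_sq by (simp add: has_field_derivative_def)
    qed
  qed (auto intro!: continuous_intros)
  then show ?thesis by simp
qed

locale closed_riem =
  fixes M :: "('m::t2_space, 'n::finite) riem"
  assumes closed: "closed_riemannian_manifold M"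
begin

lemma chart: "c \<in> atlas M \<Longrightarrow> riem_chart M c" using closed by unfold_locales

lemma compact_M: "compact (UNIV :: 'm set)" using closed unfolding closed_riemannian_manifold_def by blast

lemma chart_at: "chart_at M p \<in> atlas M" "p \<in> fst (chart_at M p)"
proof -
  have "\<exists>c. c \<in> atlas M \<and> p \<in> fst c"
    using closed unfolding closed_riemannian_manifold_def smooth_atlas_def by blast
  from someI_ex[OF this] show "chart_at M p \<in> atlas M" "p \<in> fst (chart_at M p)"
    unfolding chart_at_def by auto
qed

lemma C1_fun_const: "C1_fun M (\<lambda>p. k)" unfolding C1_fun_def o_def
  by (auto intro!: Ck_on_const riem_chart.V_open chart)

lemma C1_fun_add: "C1_fun M f \<Longrightarrow> C1_fun M h \<Longrightarrow> C1_fun M (\<lambda>p. f p + h p)"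
  unfolding C1_fun_def o_def by (auto intro!: Ck_on_add riem_chart.V_open chart)

lemma C1_fun_mult: "C1_fun M f \<Longrightarrow> C1_fun M h \<Longrightarrow> C1_fun M (\<lambda>p. f p * h p)"
  unfolding C1_fun_def o_def by (auto intro!: Ck_on_mult riem_chart.V_open chart)

lemma C1_fun_inverse: "C1_fun M f \<Longrightarrow> (\<And>p. f p \<noteq> 0) \<Longrightarrow> C1_fun M (\<lambda>p. inverse (f p))"
  unfolding C1_fun_def o_def by (auto intro!: Ck_on_inverse riem_chart.V_open chart)

lemma C1_fun_sum: "(\<And>k. k \<in> A \<Longrightarrow> C1_fun M (f k)) \<Longrightarrow> C1_fun M (\<lambda>p. \<Sum>k\<in>A. f k p)"
  by (induction A rule: infinite_finite_induct) (auto intro: C1_fun_const C1_fun_add)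

lemma smooth_fun_ln: "smooth_fun M f \<Longrightarrow> (\<And>p. f p > 0) \<Longrightarrow> smooth_fun M (\<lambda>p. ln (f p))"
  unfolding smooth_fun_def o_def by (auto intro!: smooth_on_ln riem_chart.V_open chart)

lemma continuous_on_chartsI:
  fixes F :: "'m \<Rightarrow> real"
  assumes "\<And>c. c \<in> atlas M \<Longrightarrow> continuous_on (img_chart c) (F \<circ> inv_chart c)"
  shows "continuous_on UNIV F"
proof -
  have "isCont F p" for p
  proof -
    interpret c: riem_chart M "chart_at M p" by (rule chart[OF chart_at(1)])
    let ?c = "chart_at M p"
    have "continuous_on (fst ?c) (\<lambda>q. (F \<circ> inv_chart ?c) (snd ?c q))"
      by (rule continuous_on_compose2[OF assms[OF chart_at(1)]])
        (use c.homeo in \<open>auto simp: homeomorphism_def\<close>)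
    then have "continuous_on (fst ?c) F"
      by (subst (asm) continuous_on_cong[OF refl, where g = F]) (auto simp: c.inv_coord)
    then show ?thesis using continuous_on_eq_continuous_at c.dom_open chart_at(2) by blast
  qed
  then show ?thesis by (simp add: continuous_on_eq_continuous_at)
qed

section \<open>Change of coordinates and cut-off functions\<close>

lemma transition:
  assumes c: "c \<in> atlas M" and d: "d \<in> atlas M"
  shows "open (snd c ` (fst c \<inter> fst d))" "snd c ` (fst c \<inter> fst d) \<subseteq> img_chart c"
    "smooth_on (snd c ` (fst c \<inter> fst d)) (snd d \<circ> inv_chart c)"
    "(snd d \<circ> inv_chart c) ` (snd c ` (fst c \<inter> fst d)) \<subseteq> img_chart d"
proof -
  interpret c: riem_chart M c by (rule chart[OF c])
  interpret d: riem_chart M d by (rule chart[OF d])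
  show "open (snd c ` (fst c \<inter> fst d))"
  proof -
    have "openin (top_of_set (img_chart c)) (snd c ` (fst c \<inter> fst d))"
      by (rule homeomorphism_imp_open_map[OF c.homeo]) (simp add: d.dom_open openin_open_Int)
    then show ?thesis using c.V_open openin_open_trans by blast
  qed
  show "snd c ` (fst c \<inter> fst d) \<subseteq> img_chart c" using c.coord_img by auto
  show "smooth_on (snd c ` (fst c \<inter> fst d)) (snd d \<circ> inv_chart c)"
    using closed c d unfolding closed_riemannian_manifold_def smooth_atlas_def by blast
  show "(snd d \<circ> inv_chart c) ` (snd c ` (fst c \<inter> fst d)) \<subseteq> img_chart d"
    by (auto simp: c.inv_coord d.coord_img)
qed

lemma pd_transition:
  assumes c: "c \<in> atlas M" and d: "d \<in> atlas M" and p: "p \<in> fst c" "p \<in> fst d"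
    and f: "(f \<circ> inv_chart d) differentiable at (snd d p)"
  shows "(\<chi> i. pd i (f \<circ> inv_chart c) (snd c p)) = transpose (jacobian c d p) *v (\<chi> i. pd i (f \<circ> inv_chart d) (snd d p))"
proof -
  interpret c: riem_chart M c by (rule chart[OF c])
  interpret d: riem_chart M d by (rule chart[OF d])
  note tr = transition[OF c d]
  let ?W = "snd c ` (fst c \<inter> fst d)" and ?T = "snd d \<circ> inv_chart c"
  have y: "snd c p \<in> ?W" and T: "?T (snd c p) = snd d p" using p by (auto simp: c.inv_coord)
  have lin: "linear (frechet_derivative ?T (at (snd c p)))"
    using smooth_on_has_derivative[OF tr(1,3) y] has_derivative_linear by blast
  have J: "frechet_derivative ?T (at (snd c p)) v = jacobian c d p *v v" for v
    unfolding jacobian_def using matrix_works[of "frechet_derivative ?T (at (snd c p))" v] lin by simp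
  have "((\<lambda>y. (f \<circ> inv_chart d) (?T y)) has_derivative
      (\<lambda>v. frechet_derivative (f \<circ> inv_chart d) (at (snd d p)) (jacobian c d p *v v))) (at (snd c p))"
    using has_derivative_compose[OF smooth_on_has_derivative[OF tr(1,3) y], of "f \<circ> inv_chart d", unfolded T,
      OF pd_has_derivative[OF f]] unfolding J .
  then have "pd i (\<lambda>y. (f \<circ> inv_chart d) (?T y)) (snd c p)
      = frechet_derivative (f \<circ> inv_chart d) (at (snd d p)) (jacobian c d p *v axis i 1)" for i
    by (rule pd_eq)
  moreover have "pd i (f \<circ> inv_chart c) (snd c p) = pd i (\<lambda>y. (f \<circ> inv_chart d) (?T y)) (snd c p)" for i
    by (rule pd_cong[OF tr(1) y]) (auto simp: c.inv_coord d.inv_coord)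
  moreover have "(jacobian c d p *v axis i 1) $ j = jacobian c d p $ j $ i" for i j
    by (simp add: matrix_vector_mul_component inner_axis)
  ultimately show ?thesis
    by (simp add: vec_eq_iff frechet_derivative_pd[OF f] matrix_vector_mul_component[of _ "\<chi> i. _ i"] inner_vec_def transpose_def)
qed

lemma gmat_coord: "c \<in> atlas M \<Longrightarrow> p \<in> fst c \<Longrightarrow> gmat M c (snd c p) = metric M c p"
  using riem_chart.inv_coord[OF chart] by (simp add: gmat_def)

lemma inner_c_eq: "inner_c M c v w y = (\<chi> i. pd i v y) \<bullet> (matrix_inv (gmat M c y) *v (\<chi> i. pd i w y))"
  by (simp add: inner_c_def grad_c_def inner_vec_def matrix_vector_mult_def gup_def)

text \<open>If C = J^T D J, then J C^-1 J^T = D^-1, which absorbs the factors J^T acquired by the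
  two differentials. Only first derivatives of the coordinate change occur.\<close>

lemma inner_c_invariant:
  assumes c: "c \<in> atlas M" and d: "d \<in> atlas M" and p: "p \<in> fst c" "p \<in> fst d"
    and f: "(f \<circ> inv_chart d) differentiable at (snd d p)" and h: "(h \<circ> inv_chart d) differentiable at (snd d p)"
  shows "inner_c M c (f \<circ> inv_chart c) (h \<circ> inv_chart c) (snd c p) = inner_c M d (f \<circ> inv_chart d) (h \<circ> inv_chart d) (snd d p)"
proof -
  interpret c: riem_chart M c by (rule chart[OF c])
  interpret d: riem_chart M d by (rule chart[OF d])
  define J where "J = jacobian c d p"
  define C where "C = metric M c p"
  define D where "D = metric M d p"
  have C: "C = transpose J ** D ** J" unfolding C_def D_def J_def
    using closed c d p unfolding closed_riemannian_manifold_def riemannian_metric_def by blast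
  have iC: "invertible C" and iD: "invertible D"
    using c.g_inv[OF c.coord_img[OF p(1)]] d.g_inv[OF d.coord_img[OF p(2)]]
    unfolding C_def D_def gmat_coord[OF c p(1)] gmat_coord[OF d p(2)] by auto
  \<comment> \<open>Multiplying C = J^T D J by the inverse of C exhibits a left inverse of J; for
    square matrices it is a right inverse as well.\<close>
  have "J ** (matrix_inv C ** transpose J ** D) = mat 1"
  proof -
    have "(matrix_inv C ** transpose J ** D) ** J = mat 1"
      using matrix_inv_left[OF iC] by (simp add: C matrix_mul_assoc)
    then show ?thesis using matrix_left_right_inverse by blast
  qed
  then have key: "J ** matrix_inv C ** transpose J = matrix_inv D"
    using matrix_inv_right[OF iD] by (metis matrix_mul_assoc matrix_mul_lid matrix_mul_rid)
  define a where "a = (\<chi> i. pd i (f \<circ> inv_chart d) (snd d p))"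
  define b where "b = (\<chi> i. pd i (h \<circ> inv_chart d) (snd d p))"
  have "inner_c M c (f \<circ> inv_chart c) (h \<circ> inv_chart c) (snd c p) = (transpose J *v a) \<bullet> (matrix_inv C *v (transpose J *v b))"
    unfolding inner_c_eq pd_transition[OF c d p f] pd_transition[OF c d p h] a_def b_def J_def C_def
      gmat_coord[OF c p(1)] ..
  also have "\<dots> = a \<bullet> ((J ** matrix_inv C ** transpose J) *v b)"
    by (metis dot_lmul_matrix matrix_vector_mul_assoc transpose_matrix_vector)
  finally show ?thesis unfolding key inner_c_eq a_def b_def D_def gmat_coord[OF d p(2)] .
qed

text \<open>Frees the pairing from the choice made in \<open>chart_at\<close>, so that near a point
  it has one smooth coordinate expression and can be differentiated.\<close>

lemma ginner_chart:
  assumes f: "C1_fun M f" and h: "C1_fun M h" and c: "c \<in> atlas M" and p: "p \<in> fst c"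
  shows "ginner M f h p = inner_c M c (f \<circ> inv_chart c) (h \<circ> inv_chart c) (snd c p)"
proof -
  interpret c: riem_chart M c by (rule chart[OF c])
  have "ginner M f h p = inner_c M (chart_at M p) (f \<circ> inv_chart (chart_at M p)) (h \<circ> inv_chart (chart_at M p)) (snd (chart_at M p) p)"
    unfolding ginner_def inner_c_eq differential_def grad_def diff_coord_def coord_at_def metric_at_def
      gmat_coord[OF chart_at] ..
  also have "\<dots> = inner_c M c (f \<circ> inv_chart c) (h \<circ> inv_chart c) (snd c p)"
    using f h c Ck_on_1_differentiable[OF _ c.V_open c.coord_img[OF p]] unfolding C1_fun_def
    by (intro inner_c_invariant[OF chart_at(1) c chart_at(2) p]) auto
  finally show ?thesis .
qed

lemma grad_sq_ginner: "grad_sq M f p = ginner M f f p"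
proof -
  interpret c: riem_chart M "chart_at M p" by (rule chart[OF chart_at(1)])
  have inv: "invertible (metric_at M p)"
    unfolding metric_at_def using c.g_inv[OF c.coord_img[OF chart_at(2)]] gmat_coord[OF chart_at] by simp
  show ?thesis unfolding grad_sq_def ginner_def
    by (simp add: grad_def matrix_vector_mul_assoc matrix_inv_right[OF inv] inner_commute)
qed

lemma ginner_continuous:
  assumes "C1_fun M f" "C1_fun M h"
  shows "continuous_on UNIV (ginner M f h)"
proof (rule continuous_on_chartsI)
  fix c assume c: "c \<in> atlas M"
  interpret c: riem_chart M c by (rule chart[OF c])
  have "continuous_on c.V (inner_c M c (f \<circ> inv_chart c) (h \<circ> inv_chart c))"
    unfolding inner_c_def[abs_def] grad_c_def
    using assms c Ck_on_1_pd[OF _ c.V_open] smooth_on_continuous_on[OF c.gi_smooth] unfolding C1_fun_def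
    by (intro continuous_intros) auto
  then show "continuous_on c.V (ginner M f h \<circ> inv_chart c)"
    by (rule continuous_on_eq) (simp add: ginner_chart[OF assms c c.inv_chart_dom] c.coord_inv)
qed

lemma C1_fun_continuous: "C1_fun M f \<Longrightarrow> continuous_on UNIV f"
  unfolding C1_fun_def by (auto intro: continuous_on_chartsI Ck_on_continuous_on)

text \<open>The bump is pulled back from a ball in one chart. Its support lies in a compact set,
  which is closed because the space is Hausdorff; this makes the extension by zero regular in every
  other chart.\<close>

lemma bump_exists:
  assumes U: "open U" "p \<in> U"
  obtains b K where "C1_fun M b" "\<And>q. b q \<ge> 0" "b p > 0" "compact K" "K \<subseteq> U" "\<And>q. q \<notin> K \<Longrightarrow> b q = 0"
proof -
  let ?c = "chart_at M p"
  interpret c: riem_chart M ?c by (rule chart[OF chart_at(1)])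
  define y0 where "y0 = snd ?c p"
  have "openin (top_of_set c.V) (snd ?c ` (fst ?c \<inter> U))"
    by (rule homeomorphism_imp_open_map[OF c.homeo]) (simp add: U openin_open_Int)
  then have o: "open (snd ?c ` (fst ?c \<inter> U))" using c.V_open openin_open_trans by blast
  have "y0 \<in> snd ?c ` (fst ?c \<inter> U)" using U chart_at(2) by (auto simp: y0_def)
  then obtain r where r: "r > 0" "cball y0 r \<subseteq> snd ?c ` (fst ?c \<inter> U)"
    using o open_contains_cball by blast
  have rV: "cball y0 r \<subseteq> c.V" using r(2) c.coord_img by auto
  define \<beta> where "\<beta> y = (max 0 (r\<^sup>2 - (y - y0) \<bullet> (y - y0)))\<^sup>2" for y
  define b where "b q = (if q \<in> fst ?c then \<beta> (snd ?c q) else 0)" for q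
  define K where "K = inv_chart ?c ` cball y0 r"
  have K: "compact K" unfolding K_def by (rule compact_continuous_image)
      (use c.homeo rV continuous_on_subset in \<open>auto simp: homeomorphism_def\<close>)
  have \<beta>0: "\<beta> y = 0" if "y \<notin> cball y0 r" for y
  proof -
    have "r < norm (y - y0)" using that by (simp add: dist_norm norm_minus_commute)
    then have "r\<^sup>2 \<le> (norm (y - y0))\<^sup>2" using r(1) by (intro power_mono) auto
    then show ?thesis by (simp add: \<beta>_def power2_norm_eq_inner max_def)
  qed
  have b0: "b q = 0" if "q \<notin> K" for q
  proof (cases "q \<in> fst ?c")
    case True
    then have "snd ?c q \<notin> cball y0 r" using that c.inv_coord[OF True] unfolding K_def by force
    then show ?thesis using \<beta>0 True by (simp add: b_def)
  qed (simp add: b_def)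
  have "C1_fun M b" unfolding C1_fun_def
  proof
    fix d assume d: "d \<in> atlas M"
    interpret d: riem_chart M d by (rule chart[OF d])
    note tr = transition[OF d chart_at(1)]
    show "Ck_on 1 d.V (b \<circ> inv_chart d)"
    proof (rule Ck_on_1_local[OF d.V_open])
      fix y assume y: "y \<in> d.V"
      show "\<exists>T. open T \<and> y \<in> T \<and> Ck_on 1 T (b \<circ> inv_chart d)"
      \<comment> \<open>Inside the chart that carries the bump, b is a C^1 function composed with a
        transition map; outside it, the complement of K is a neighbourhood on which b is
        zero.\<close>
      proof (cases "inv_chart d y \<in> fst ?c")
        case True
        let ?W = "snd d ` (fst d \<inter> fst ?c)"
        have "y \<in> ?W" using True y d.inv_chart_dom d.coord_inv by force
        moreover have "Ck_on 1 ?W (\<lambda>z. \<beta> ((snd ?c \<circ> inv_chart d) z))"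
          by (rule Ck_on_1_compose[OF tr(1) open_UNIV tr(3)]) (simp_all add: \<beta>_def[abs_def] bump_C1[unfolded One_nat_def])
        then have "Ck_on 1 ?W (b \<circ> inv_chart d)"
          by (rule Ck_on_cong[THEN iffD1, rotated]) (auto simp: b_def d.inv_coord)
        ultimately show ?thesis using tr(1) by blast
      next
        case False
        let ?W = "d.V \<inter> inv_chart d -` (- K)"
        have "open ?W" by (rule continuous_open_preimage[OF _ d.V_open])
            (use d.homeo compact_imp_closed[OF K] in \<open>auto simp: homeomorphism_def\<close>)
        moreover have "y \<in> ?W" using y False c.inv_chart_dom rV unfolding K_def by auto
        moreover have "Ck_on 1 ?W (b \<circ> inv_chart d)"
          by (rule Ck_on_cong[THEN iffD1, rotated, OF Ck_on_const[OF \<open>open ?W\<close>, of 1 0]]) (auto simp: b0)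
        ultimately show ?thesis by blast
      qed
    qed
  qed
  moreover have "K \<subseteq> U" unfolding K_def using r(2) c.inv_coord by force
  moreover have "b p > 0" using r(1) chart_at(2) by (simp add: b_def \<beta>_def y0_def max_def)
  moreover have "b q \<ge> 0" for q by (simp add: b_def \<beta>_def)
  ultimately show ?thesis using that K b0 by blast
qed

end

section \<open>Volume measure and integration by parts\<close>

lemma integrable_compact_support:
  fixes H :: "real ^ 'n \<Rightarrow> real"
  assumes "continuous_on UNIV H" "compact K" "\<And>y. y \<notin> K \<Longrightarrow> H y = 0"
  shows "integrable lborel H"
proof -
  have "integrable lborel (\<lambda>y. indicator K y *\<^sub>R H y)"
    using assms(1,2) continuous_on_subset by (blast intro: borel_integrable_compact)
  moreover have "(\<lambda>y. indicator K y *\<^sub>R H y) = H" by (auto simp: indicator_def fun_eq_iff assms(3))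
  ultimately show ?thesis by simp
qed

text \<open>Translation invariance of Lebesgue measure makes every difference quotient of \<open>H\<close> integrate to zero.\<close>

lemma integral_pd_compact_support:
  fixes H :: "real ^ 'n \<Rightarrow> real"
  assumes H: "Ck_on 1 UNIV H" and K: "compact K" and supp: "\<And>y. y \<notin> K \<Longrightarrow> H y = 0"
  shows "(\<integral>y. pd j H y \<partial>lborel) = 0"
proof -
  define e where "e = (axis j 1 :: real ^ 'n)"
  have ne: "norm e = 1" by (simp add: e_def)
  obtain r where r: "r > 0" "\<And>y. y \<in> K \<Longrightarrow> norm y \<le> r"
    using compact_imp_bounded[OF K] bounded_pos by metis
  have H0: "H y = 0" if "norm y > r" for y using r(2) supp that by force
  have contH: "continuous_on UNIV H" and cont: "continuous_on UNIV (pd j H)"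
    using Ck_on_continuous_on[OF H] Ck_on_1_pd[OF H open_UNIV] by auto
  have diff: "(H has_derivative frechet_derivative H (at y)) (at y)" for y
    using Ck_on_1_differentiable[OF H open_UNIV] pd_has_derivative by blast
  \<comment> \<open>The steps of the difference quotients are at most 1: the quotients vanish
    outside radius r + 1, and from inside it the intermediate point of the mean value theorem gets
    no further than r + 2.\<close>
  have "bounded (pd j H ` cball 0 (r + 2))"
    by (intro compact_imp_bounded compact_continuous_image continuous_on_subset[OF cont]) auto
  then obtain B where B: "\<And>y. norm y \<le> r + 2 \<Longrightarrow> \<bar>pd j H y\<bar> \<le> B"
    unfolding bounded_iff by (metis imageI mem_cball_0 real_norm_def)
  have der: "((\<lambda>s. H (y + s *\<^sub>R e)) has_real_derivative pd j H (y + s *\<^sub>R e)) (at s)" for y s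
  proof -
    have "((\<lambda>s. H (y + s *\<^sub>R e)) has_derivative (\<lambda>h. frechet_derivative H (at (y + s *\<^sub>R e)) (h *\<^sub>R e))) (at s)"
      by (rule has_derivative_compose[where f = "\<lambda>s. y + s *\<^sub>R e", OF _ diff]) (auto intro!: derivative_eq_intros)
    then show ?thesis unfolding has_field_derivative_def pd_def e_def
      using linear_scale[OF has_derivative_linear[OF diff]] by (simp add: mult_commute_abs)
  qed
  define s where "s n = inverse (real (Suc n))" for n
  have s: "s n > 0" "s n \<le> 1" for n by (auto simp: s_def inverse_le_1_iff)
  define D where "D n y = (H (y + s n *\<^sub>R e) - H y) / s n" for n y
  have intH: "integrable lborel H" by (rule integrable_compact_support[OF contH K supp])
  have measH: "H \<in> borel_measurable borel" by (rule borel_measurable_continuous_onI[OF contH])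
  have shift: "integrable lborel (\<lambda>y. H (y + a))" "(\<integral>y. H (y + a) \<partial>lborel) = (\<integral>y. H y \<partial>lborel)" for a
  proof -
    have "integrable (distr lborel borel ((+) a)) H" unfolding lborel_distr_plus by (rule intH)
    then show "integrable lborel (\<lambda>y. H (y + a))"
      by (subst (asm) integrable_distr_eq) (auto simp: measH add.commute)
    have "(\<integral>y. H y \<partial>lborel) = (\<integral>y. H y \<partial>(distr lborel borel ((+) a)))" unfolding lborel_distr_plus ..
    also have "\<dots> = (\<integral>y. H (a + y) \<partial>lborel)" by (rule integral_distr) (auto simp: measH)
    finally show "(\<integral>y. H (y + a) \<partial>lborel) = (\<integral>y. H y \<partial>lborel)" by (simp add: add.commute)
  qed
  have intD: "(\<integral>y. D n y \<partial>lborel) = 0" for n unfolding D_def by (simp add: shift intH)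
  have mH: "(\<lambda>y. H (y + a)) \<in> borel_measurable borel" for a
    by (intro borel_measurable_continuous_onI continuous_on_compose2[OF contH] continuous_intros) auto
  have "(\<lambda>n. \<integral>y. D n y \<partial>lborel) \<longlonglongrightarrow> (\<integral>y. pd j H y \<partial>lborel)"
  proof (rule integral_dominated_convergence[where w = "\<lambda>y. B * indicator (cball 0 (r + 1)) y"])
    show "pd j H \<in> borel_measurable lborel" using borel_measurable_continuous_onI[OF cont] by simp
    show "D n \<in> borel_measurable lborel" for n unfolding D_def[abs_def] using measH mH by measurable
    show "integrable lborel (\<lambda>y. B * indicator (cball 0 (r + 1)) (y :: real ^ 'n))"
      using emeasure_lborel_cball_finite by (intro integrable_mult_right integrable_real_indicator) auto
    show "AE y in lborel. (\<lambda>n. D n y) \<longlonglongrightarrow> pd j H y"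
    proof (rule AE_I2)
      fix y
      have "((\<lambda>h. (H (y + h *\<^sub>R e) - H y) / h) \<longlongrightarrow> pd j H y) (at 0)"
        using der[of y 0] unfolding has_field_derivative_iff by simp
      moreover have "filterlim s (at 0) sequentially"
        unfolding filterlim_at s_def[abs_def] using LIMSEQ_inverse_real_of_nat by simp
      ultimately show "(\<lambda>n. D n y) \<longlonglongrightarrow> pd j H y"
        unfolding D_def by (rule filterlim_compose)
    qed
    show "AE y in lborel. norm (D n y) \<le> B * indicator (cball 0 (r + 1)) y" for n
    proof (rule AE_I2)
      fix y
      show "norm (D n y) \<le> B * indicator (cball 0 (r + 1)) y"
      proof (cases "norm y \<le> r + 1")
        case True
        have "\<exists>z>0. z < s n \<and> H (y + s n *\<^sub>R e) - H (y + 0 *\<^sub>R e) = (s n - 0) * pd j H (y + z *\<^sub>R e)"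
          by (rule MVT2[OF s(1)]) (rule der)
        then obtain z where z: "0 < z" "z < s n" "D n y = pd j H (y + z *\<^sub>R e)"
          using s(1)[of n] by (auto simp: D_def)
        have "norm (y + z *\<^sub>R e) \<le> r + 2"
          using norm_triangle_ineq[of y "z *\<^sub>R e"] z s(2)[of n] True ne by simp
        then show ?thesis using B[of "y + z *\<^sub>R e"] z(3) True by simp
      next
        case False
        have "norm (y + s n *\<^sub>R e) \<ge> norm y - s n"
          using norm_triangle_ineq4[of "y + s n *\<^sub>R e" "s n *\<^sub>R e"] ne s(1)[of n] by simp
        then have "norm (y + s n *\<^sub>R e) > r" using False s(2)[of n] by linarith
        then show ?thesis using H0 False by (simp add: D_def)
      qed
    qed
  qed
  then show ?thesis unfolding intD by (simp add: LIMSEQ_const_iff)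
qed

locale riem_vol = closed_riem M for M :: "('m::t2_space, 'n::finite) riem" +
  fixes \<mu> :: "'m measure"
  assumes volume: "riemannian_volume M \<mu>"
begin

lemma sets_vol: "sets \<mu> = sets borel" using volume unfolding riemannian_volume_def by blast

lemma space_vol: "space \<mu> = UNIV" using sets_eq_imp_space_eq[OF sets_vol] by simp

lemma emeasure_vol:
  "c \<in> atlas M \<Longrightarrow> B \<in> sets borel \<Longrightarrow> B \<subseteq> fst c \<Longrightarrow>
    emeasure \<mu> B = (\<integral>\<^sup>+ y \<in> snd c ` B. ennreal (vol_c M c y) \<partial>lborel)"
  using volume unfolding riemannian_volume_def vol_c_def gmat_def by blast

lemma measurable_vol: "f \<in> borel_measurable borel \<Longrightarrow> f \<in> borel_measurable \<mu>"
  using measurable_cong_sets[OF sets_vol refl] by blast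

text \<open>The characterisation of the volume speaks only of Borel sets inside a chart domain. It
  says that the volume restricted to the domain is the push-forward of sqrt(det g) dy under the
  inverse chart, and integrals are transported accordingly.\<close>

lemma integral_chart:
  fixes F :: "'m \<Rightarrow> real"
  assumes c: "c \<in> atlas M" and F: "F \<in> borel_measurable borel" and supp: "\<And>q. q \<notin> fst c \<Longrightarrow> F q = 0"
  shows "(\<integral>q. F q \<partial>\<mu>) = (\<integral>y. indicator (img_chart c) y * (F (inv_chart c y) * vol_c M c y) \<partial>lborel)"
proof -
  interpret c: riem_chart M c by (rule chart[OF c])
  \<comment> \<open>An arbitrary value that makes J a Borel map on the whole coordinate space; it
    has no influence because W vanishes outside the chart image.\<close>
  define p0 where "p0 = (undefined :: 'm)"
  define J where "J y = (if y \<in> c.V then inv_chart c y else p0)" for y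
  define W where "W y = indicator c.V y *\<^sub>R vol_c M c y" for y
  define N where "N = density lborel (\<lambda>y. ennreal (W y))"
  have W: "W \<in> borel_measurable borel"
    unfolding W_def[abs_def] using Ck_on_continuous_on[OF c.vol_C1] c.V_open
    by (intro borel_measurable_continuous_on_indicator) auto
  have W0: "W y \<ge> 0" for y using c.vol_pos[of y] by (auto simp: W_def indicator_def)
  have J: "J \<in> borel_measurable borel" unfolding J_def[abs_def] using c.homeo c.V_open
    by (intro borel_measurable_continuous_on_if) (auto simp: homeomorphism_def)
  have D: "fst c \<in> sets borel" using c.dom_open by simp
  have eq: "density \<mu> (\<lambda>q. ennreal (indicator (fst c) q)) = distr N borel J"
  proof (rule measure_eqI)
    show "sets (density \<mu> (\<lambda>q. ennreal (indicator (fst c) q))) = sets (distr N borel J)"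
      by (simp add: sets_vol)
    fix A assume "A \<in> sets (density \<mu> (\<lambda>q. ennreal (indicator (fst c) q)))"
    then have A: "A \<in> sets borel" by (simp add: sets_vol)
    have DA: "fst c \<inter> A \<in> sets borel" using A D by auto
    have "emeasure (density \<mu> (\<lambda>q. ennreal (indicator (fst c) q))) A
        = (\<integral>\<^sup>+ q. ennreal (indicator (fst c) q) * indicator A q \<partial>\<mu>)"
      by (rule emeasure_density) (use A D sets_vol in \<open>auto intro!: measurable_vol\<close>)
    also have "\<dots> = (\<integral>\<^sup>+ q. indicator (fst c \<inter> A) q \<partial>\<mu>)"
      by (intro nn_integral_cong) (auto simp: indicator_def)
    also have "\<dots> = emeasure \<mu> (fst c \<inter> A)" using DA sets_vol by simp
    also have "\<dots> = (\<integral>\<^sup>+ y \<in> snd c ` (fst c \<inter> A). ennreal (vol_c M c y) \<partial>lborel)"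
      by (rule emeasure_vol[OF c DA]) simp
    also have "\<dots> = (\<integral>\<^sup>+ y. ennreal (W y) * indicator (J -` A \<inter> space lborel) y \<partial>lborel)"
    proof (intro nn_integral_cong)
      fix y
      have "y \<in> snd c ` (fst c \<inter> A) \<longleftrightarrow> y \<in> c.V \<and> J y \<in> A"
        using c.inv_coord c.coord_img c.inv_chart_dom[of y] c.coord_inv[of y] by (force simp: J_def)
      then show "ennreal (vol_c M c y) * indicator (snd c ` (fst c \<inter> A)) y
          = ennreal (W y) * indicator (J -` A \<inter> space lborel) y" by (auto simp: W_def indicator_def)
    qed
    also have "\<dots> = emeasure N (J -` A \<inter> space N)"
      unfolding N_def by (subst emeasure_density) (use W measurable_sets[OF J A] in auto)
    also have "\<dots> = emeasure (distr N borel J) A"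
      by (rule emeasure_distr[symmetric]) (use J A in \<open>auto simp: N_def\<close>)
    finally show "emeasure (density \<mu> (\<lambda>q. ennreal (indicator (fst c) q))) A = emeasure (distr N borel J) A" .
  qed
  have "(\<integral>q. F q \<partial>\<mu>) = (\<integral>q. indicator (fst c) q *\<^sub>R F q \<partial>\<mu>)"
    by (intro Bochner_Integration.integral_cong) (use supp in \<open>auto simp: indicator_def\<close>)
  also have "\<dots> = (\<integral>q. F q \<partial>(density \<mu> (\<lambda>q. ennreal (indicator (fst c) q))))"
    by (rule integral_density[symmetric]) (use F D in \<open>auto intro!: measurable_vol\<close>)
  also have "\<dots> = (\<integral>y. F (J y) \<partial>N)"
    unfolding eq by (rule integral_distr) (use F J in \<open>auto simp: N_def\<close>)
  also have "\<dots> = (\<integral>y. W y *\<^sub>R F (J y) \<partial>lborel)"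
    unfolding N_def by (rule integral_density) (use F J W W0 in \<open>auto intro: measurable_compose\<close>)
  also have "\<dots> = (\<integral>y. indicator (img_chart c) y * (F (inv_chart c y) * vol_c M c y) \<partial>lborel)"
    by (intro Bochner_Integration.integral_cong) (auto simp: W_def J_def indicator_def)
  finally show ?thesis .
qed

text \<open>Each point has a neighbourhood of finite volume, the preimage of a ball on whose closure
  the density is bounded; by compactness finitely many of them cover the manifold.\<close>

lemma finite_vol: "finite_measure \<mu>"
proof
  have loc: "\<exists>T. open T \<and> p \<in> T \<and> emeasure \<mu> T < \<infinity>" for p
  proof -
    let ?c = "chart_at M p"
    interpret c: riem_chart M ?c by (rule chart[OF chart_at(1)])
    define y0 where "y0 = snd ?c p"
    have "y0 \<in> c.V" using c.coord_img chart_at(2) by (simp add: y0_def)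
    then obtain r where r: "r > 0" "cball y0 r \<subseteq> c.V" using c.V_open open_contains_cball by blast
    define U where "U = fst ?c \<inter> snd ?c -` ball y0 r"
    have U: "open U" unfolding U_def
      by (rule continuous_open_preimage[OF _ c.dom_open]) (use c.homeo in \<open>auto simp: homeomorphism_def\<close>)
    have "bounded (vol_c M ?c ` cball y0 r)" by (intro compact_imp_bounded compact_continuous_image
          continuous_on_subset[OF Ck_on_continuous_on[OF c.vol_C1] r(2)] compact_cball)
    then obtain B where B: "\<And>y. y \<in> cball y0 r \<Longrightarrow> vol_c M ?c y \<le> B"
      unfolding bounded_iff by (metis abs_le_D1 imageI real_norm_def)
    have "emeasure \<mu> U = (\<integral>\<^sup>+ y \<in> snd ?c ` U. ennreal (vol_c M ?c y) \<partial>lborel)"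
      by (rule emeasure_vol[OF chart_at(1)]) (use U in \<open>auto simp: U_def\<close>)
    also have "\<dots> \<le> (\<integral>\<^sup>+ y. ennreal B * indicator (cball y0 r) y \<partial>lborel)"
      by (intro nn_integral_mono) (use B in \<open>auto simp: U_def indicator_def intro!: ennreal_leI\<close>)
    also have "\<dots> = ennreal B * emeasure lborel (cball y0 r)" by (rule nn_integral_cmult_indicator) simp
    also have "\<dots> < \<infinity>" using emeasure_lborel_cball_finite[of y0 r]
      by (simp add: ennreal_mult_less_top less_top)
    finally show ?thesis using U r(1) chart_at(2) by (intro exI[of _ U]) (auto simp: U_def y0_def)
  qed
  then obtain T where T: "\<And>p. open (T p)" "\<And>p. p \<in> T p" "\<And>p. emeasure \<mu> (T p) < \<infinity>" by metis
  obtain P where P: "finite P" "UNIV \<subseteq> (\<Union>p\<in>P. T p)"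
    using compactE_image[OF compact_M, of UNIV T] T by (metis UNIV_I UN_I subsetI)
  have "emeasure \<mu> UNIV = emeasure \<mu> (\<Union>p\<in>P. T p)" using P(2) by (simp add: top.extremum_unique)
  also have "\<dots> \<le> (\<Sum>p\<in>P. emeasure \<mu> (T p))"
    by (rule emeasure_subadditive_finite[OF P(1)]) (use T sets_vol in auto)
  also have "\<dots> < \<infinity>"
    using P(1) by (induction P rule: finite_induct) (use T(3) in \<open>auto simp: ennreal_add_eq_top less_top\<close>)
  finally show "emeasure \<mu> (space \<mu>) \<noteq> \<infinity>" by (simp add: space_vol)
qed

lemma integrable_continuous:
  fixes F :: "'m \<Rightarrow> real"
  assumes "continuous_on UNIV F"
  shows "integrable \<mu> F"
proof -
  interpret finite_measure \<mu> by (rule finite_vol)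
  have "bounded (range F)" by (intro compact_imp_bounded compact_continuous_image assms compact_M)
  then obtain B where "\<And>q. norm (F q) \<le> B" unfolding bounded_iff by auto
  then show ?thesis
    by (intro integrable_const_bound[of F B] measurable_vol borel_measurable_continuous_onI assms) auto
qed

text \<open>The components of f \<nabla>h times the volume density, extended by zero, have compact
  support in the coordinate space, so their divergence integrates to zero. The Laplacian is still
  that of the chart c while the pairing is already invariant; this asymmetry is what later compares
  the Laplacians of two charts.\<close>

lemma local_integration_by_parts:
  assumes c: "c \<in> atlas M" and f: "C1_fun M f" and K: "compact K" "K \<subseteq> fst c" "\<And>q. q \<notin> K \<Longrightarrow> f q = 0"
    and h: "smooth_fun M h"
  shows "(\<integral>q. (if q \<in> fst c then ginner M f h q + f q * lap_c M c (h \<circ> inv_chart c) (snd c q) else 0) \<partial>\<mu>) = 0"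
    (is "(\<integral>q. ?F q \<partial>\<mu>) = 0")
proof -
  interpret c: riem_chart M c by (rule chart[OF c])
  define \<Phi> where "\<Phi> = f \<circ> inv_chart c"
  define w where "w = h \<circ> inv_chart c"
  have w: "smooth_on c.V w" using h c unfolding smooth_fun_def w_def by blast
  have \<Phi>: "Ck_on 1 c.V \<Phi>" using f c unfolding C1_fun_def \<Phi>_def by blast
  note h1 = smooth_fun_C1[OF h]
  define L where "L = snd c ` K"
  have L: "compact L" unfolding L_def
    by (rule compact_continuous_image[OF _ K(1)]) (use c.homeo K(2) continuous_on_subset in \<open>auto simp: homeomorphism_def\<close>)
  have LV: "L \<subseteq> c.V" unfolding L_def using K(2) c.coord_img by auto
  have \<Phi>0: "\<Phi> y = 0" if "y \<in> c.V" "y \<notin> L" for y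
    using K(3)[of "inv_chart c y"] that c.coord_inv unfolding L_def \<Phi>_def by force
  define H where "H j y = (if y \<in> c.V then \<Phi> y * (vol_c M c y * grad_c M c w j y) else 0)" for j y
  have H0: "H j y = 0" if "y \<notin> L" for j y using \<Phi>0[of y] that by (auto simp: H_def)
  have gsm: "Ck_on 1 c.V (grad_c M c w j)" for j using c.grad_c_smooth[OF w] unfolding smooth_on_def by blast
  have H1: "Ck_on 1 UNIV (H j)" for j
  proof (rule Ck_on_1_local[OF open_UNIV])
    fix y
    show "\<exists>T. open T \<and> y \<in> T \<and> Ck_on 1 T (H j)"
    proof (cases "y \<in> c.V")
      case True
      have "Ck_on 1 c.V (\<lambda>y. \<Phi> y * (vol_c M c y * grad_c M c w j y))"
        by (intro Ck_on_mult c.V_open \<Phi> c.vol_C1 gsm)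
      then have "Ck_on 1 c.V (H j)" by (rule Ck_on_cong[THEN iffD1, rotated]) (simp add: H_def)
      then show ?thesis using True c.V_open by blast
    next
      case False
      have o: "open (- L)" using compact_imp_closed[OF L] by auto
      have "Ck_on 1 (- L) (H j)"
        by (rule Ck_on_cong[THEN iffD1, rotated, OF Ck_on_const[OF o, of 1 0]]) (simp add: H0)
      then show ?thesis using o False LV by blast
    qed
  qed
  have pd0: "pd j (H j) y = 0" if "y \<notin> L" for j y
    using pd_cong[of "- L" y "H j" "\<lambda>_. 0" j] compact_imp_closed[OF L] that H0 by (simp add: open_Compl pd_const)
  have ipd: "integrable lborel (pd j (H j))" for j
    by (rule integrable_compact_support[OF Ck_on_1_pd[OF H1 open_UNIV] L pd0])
  have "?F = (\<lambda>q. indicator (fst c) q *\<^sub>R (ginner M f h q + f q * lap_c M c w (snd c q)))"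
    by (auto simp: w_def)
  also have "\<dots> \<in> borel_measurable borel"
  proof (rule borel_measurable_continuous_on_indicator)
    have "continuous_on (fst c) (\<lambda>q. lap_c M c w (snd c q))"
      by (rule continuous_on_compose2[OF smooth_on_continuous_on[OF c.lap_c_smooth[OF w]]])
        (use c.homeo in \<open>auto simp: homeomorphism_def\<close>)
    then show "continuous_on (fst c) (\<lambda>q. ginner M f h q + f q * lap_c M c w (snd c q))"
      by (intro continuous_intros continuous_on_subset[OF ginner_continuous[OF f h1]]
          continuous_on_subset[OF C1_fun_continuous[OF f]]) auto
  qed (use c.dom_open in simp)
  finally have meas: "?F \<in> borel_measurable borel" .
  have "(\<integral>q. ?F q \<partial>\<mu>) = (\<integral>y. indicator c.V y * (?F (inv_chart c y) * vol_c M c y) \<partial>lborel)"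
    by (rule integral_chart[OF c meas]) simp
  also have "\<dots> = (\<integral>y. (\<Sum>j\<in>UNIV. pd j (H j) y) \<partial>lborel)"
  proof (rule Bochner_Integration.integral_cong[OF refl])
    fix y
    show "indicator c.V y * (?F (inv_chart c y) * vol_c M c y) = (\<Sum>j\<in>UNIV. pd j (H j) y)"
    proof (cases "y \<in> c.V")
      case True
      have F: "?F (inv_chart c y) = inner_c M c \<Phi> w y + \<Phi> y * lap_c M c w y"
        using c.inv_chart_dom[OF True] c.coord_inv[OF True]
        by (simp add: ginner_chart[OF f h1 c] w_def \<Phi>_def)
      have d: "\<Phi> differentiable at y" "grad_c M c w j differentiable at y" "vol_c M c differentiable at y" for j
        using Ck_on_1_differentiable[OF \<Phi> c.V_open True] Ck_on_1_differentiable[OF gsm c.V_open True]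
          c.vol_diff[OF True] by auto
      have "pd j (H j) y = pd j (\<lambda>y. \<Phi> y * (vol_c M c y * grad_c M c w j y)) y" for j
        by (rule pd_cong[OF c.V_open True]) (simp add: H_def)
      \<comment> \<open>The derivative of the density produces exactly the \<Gamma> term by which
        the Laplacian differs from the coordinate divergence of the gradient.\<close>
      then have "pd j (H j) y = vol_c M c y * (pd j \<Phi> y * grad_c M c w j y
          + \<Phi> y * pd j (grad_c M c w j) y + \<Phi> y * ((\<Sum>i\<in>UNIV. c.\<Gamma> i i j y) * grad_c M c w j y))" for j
        by (simp add: pd_mult d differentiable_mult c.pd_vol[OF True] algebra_simps)
      then have "(\<Sum>j\<in>UNIV. pd j (H j) y) = vol_c M c y * ((\<Sum>j\<in>UNIV. pd j \<Phi> y * grad_c M c w j y)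
          + \<Phi> y * (\<Sum>j\<in>UNIV. pd j (grad_c M c w j) y) + \<Phi> y * (\<Sum>j\<in>UNIV. (\<Sum>i\<in>UNIV. c.\<Gamma> i i j y) * grad_c M c w j y))"
        by (simp add: sum_distrib_left sum.distrib distrib_left)
      also have "(\<Sum>j\<in>UNIV. (\<Sum>i\<in>UNIV. c.\<Gamma> i i j y) * grad_c M c w j y) = (\<Sum>k\<in>UNIV. \<Sum>l\<in>UNIV. c.\<Gamma> k k l y * grad_c M c w l y)"
        unfolding sum_distrib_right by (rule sum.swap)
      finally show ?thesis using True
        by (simp only: F c.lap_c_divergence[OF True w]) (simp add: inner_c_def algebra_simps)
    next
      case False
      then show ?thesis using LV pd0 by (auto intro!: sum.neutral)
    qed
  qed
  also have "\<dots> = (\<Sum>j\<in>UNIV. \<integral>y. pd j (H j) y \<partial>lborel)" by (rule Bochner_Integration.integral_sum) (rule ipd)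
  also have "\<dots> = 0" by (simp add: integral_pd_compact_support[OF H1 L H0])
  finally show ?thesis .
qed

end

lemma continuous_on_extend_zero:
  fixes F :: "'a::t2_space \<Rightarrow> real"
  assumes "open A" "closed K" "K \<subseteq> A" "continuous_on A F" "\<And>q. q \<notin> K \<Longrightarrow> F q = (0::real)"
  shows "continuous_on UNIV F"
proof -
  have "isCont F q" for q
  proof (cases "q \<in> A")
    case True
    then show ?thesis using assms(1,4) continuous_on_eq_continuous_at by blast
  next
    case False
    have "continuous_on (- K) F"
      by (rule continuous_on_eq[OF continuous_on_const[of _ 0]]) (simp add: assms(5))
    then show ?thesis using False assms(2,3) continuous_on_eq_continuous_at by blast
  qed
  then show ?thesis by (simp add: continuous_on_eq_continuous_at)
qed

section \<open>Calculus rules for the gradient pairing\<close>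

context riem_chart
begin

lemma pd_pd_cong:
  assumes "y \<in> V" "\<And>z. z \<in> V \<Longrightarrow> v z = w z"
  shows "pd i (pd j v) y = pd i (pd j w) y"
  by (rule pd_cong[OF V_open assms(1)]) (rule pd_cong[OF V_open], use assms(2) in auto)

lemma lap_c_cong:
  assumes "y \<in> V" "\<And>z. z \<in> V \<Longrightarrow> v z = w z"
  shows "lap_c M c v y = lap_c M c w y"
proof -
  have "pd i v y = pd i w y" for i by (rule pd_cong[OF V_open assms])
  moreover have "pd i (pd j v) y = pd i (pd j w) y" for i j by (rule pd_pd_cong[OF assms])
  ultimately show ?thesis by (simp add: lap_c_def hess_c_def)
qed

lemma inner_c_cong:
  assumes "y \<in> V" "\<And>z. z \<in> V \<Longrightarrow> v z = w z"
  shows "inner_c M c v f y = inner_c M c w f y"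
proof -
  have "pd i v y = pd i w y" for i by (rule pd_cong[OF V_open assms])
  then show ?thesis by (simp add: inner_c_def)
qed

lemma inner_c_commute: "y \<in> V \<Longrightarrow> inner_c M c v w y = inner_c M c w v y"
  unfolding inner_c_def grad_c_def sum_distrib_left by (subst sum.swap) (simp add: gi_sym[of y] mult_ac)

lemma inner_c_sum_left:
  assumes "\<And>k. k \<in> A \<Longrightarrow> f k differentiable at y"
  shows "inner_c M c (\<lambda>z. \<Sum>k\<in>A. f k z) w y = (\<Sum>k\<in>A. inner_c M c (f k) w y)"
proof -
  have "pd i (\<lambda>z. \<Sum>k\<in>A. f k z) y = (\<Sum>k\<in>A. pd i (f k) y)" for i by (rule pd_sum[OF assms])
  then have "inner_c M c (\<lambda>z. \<Sum>k\<in>A. f k z) w y = (\<Sum>j\<in>UNIV. \<Sum>k\<in>A. pd j (f k) y * grad_c M c w j y)"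
    by (simp add: inner_c_def sum_distrib_right)
  also have "\<dots> = (\<Sum>k\<in>A. inner_c M c (f k) w y)" unfolding inner_c_def by (rule sum.swap)
  finally show ?thesis .
qed

lemma inner_c_mult_left:
  assumes "f differentiable at y" "h differentiable at y"
  shows "inner_c M c (\<lambda>z. f z * h z) w y = f y * inner_c M c h w y + h y * inner_c M c f w y"
  unfolding inner_c_def pd_mult[OF assms] by (simp add: sum_distrib_left sum.distrib algebra_simps)

end

context closed_riem
begin

lemma C1_fun_differentiable:
  "C1_fun M f \<Longrightarrow> c \<in> atlas M \<Longrightarrow> p \<in> fst c \<Longrightarrow> (\<lambda>z. f (inv_chart c z)) differentiable at (snd c p)"
  using Ck_on_1_differentiable[OF _ riem_chart.V_open[OF chart, of c] riem_chart.coord_img[OF chart, of c p], of "f \<circ> inv_chart c"]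
  unfolding C1_fun_def o_def by blast

lemma ginner_chart_at:
  "ginner M f h p = inner_c M (chart_at M p) (\<lambda>z. f (inv_chart (chart_at M p) z)) (\<lambda>z. h (inv_chart (chart_at M p) z))
    (snd (chart_at M p) p)"
  unfolding ginner_def inner_c_eq differential_def grad_def diff_coord_def coord_at_def metric_at_def
      gmat_coord[OF chart_at] o_def ..

lemma ginner_commute: "ginner M f h p = ginner M h f p" unfolding ginner_chart_at
  using riem_chart.inner_c_commute[OF chart[OF chart_at(1)] riem_chart.coord_img[OF chart[OF chart_at(1)] chart_at(2)]] .

lemma ginner_sum_left:
  "(\<And>k. k \<in> A \<Longrightarrow> C1_fun M (f k)) \<Longrightarrow> ginner M (\<lambda>q. \<Sum>k\<in>A. f k q) h p = (\<Sum>k\<in>A. ginner M (f k) h p)"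
  unfolding ginner_chart_at
  by (rule riem_chart.inner_c_sum_left[OF chart[OF chart_at(1)]]) (simp add: C1_fun_differentiable chart_at)

lemma ginner_mult_left:
  "C1_fun M f \<Longrightarrow> C1_fun M h \<Longrightarrow>
    ginner M (\<lambda>q. f q * h q) w p = f p * ginner M h w p + h p * ginner M f w p"
  unfolding ginner_chart_at by (subst riem_chart.inner_c_mult_left[OF chart[OF chart_at(1)]])
    (simp_all add: C1_fun_differentiable chart_at riem_chart.inv_coord[OF chart[OF chart_at(1)] chart_at(2)])

lemma differential_chain:
  assumes "C1_fun M f" "(\<phi> has_real_derivative d) (at (f p))"
  shows "differential M (\<lambda>q. \<phi> (f q)) p = d *\<^sub>R differential M f p"
proof -
  have "pd i (\<lambda>z. \<phi> (f (inv_chart (chart_at M p) z))) (snd (chart_at M p) p)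
      = d * pd i (\<lambda>z. f (inv_chart (chart_at M p) z)) (snd (chart_at M p) p)" for i
    by (rule pd_chain[OF C1_fun_differentiable[OF assms(1) chart_at]])
      (simp add: riem_chart.inv_coord[OF chart[OF chart_at(1)] chart_at(2)] assms(2))
  then show ?thesis by (simp add: differential_def diff_coord_def coord_at_def o_def vec_eq_iff)
qed

lemma ginner_chain_left:
  assumes "C1_fun M f" "(\<phi> has_real_derivative d) (at (f p))"
  shows "ginner M (\<lambda>q. \<phi> (f q)) h p = d * ginner M f h p"
  unfolding ginner_def differential_chain[OF assms] by simp

lemma ginner_vanish:
  assumes "open T" "p \<in> T" "\<And>q. q \<in> T \<Longrightarrow> f q = 0"
  shows "ginner M f h p = 0"
proof -
  let ?c = "chart_at M p"
  interpret c: riem_chart M ?c by (rule chart[OF chart_at(1)])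
  have "open (c.V \<inter> inv_chart ?c -` T)"
    by (rule continuous_open_preimage[OF _ c.V_open assms(1)]) (use c.homeo in \<open>auto simp: homeomorphism_def\<close>)
  then have "pd i (\<lambda>z. f (inv_chart ?c z)) (snd ?c p) = pd i (\<lambda>z. 0) (snd ?c p)" for i
    by (rule pd_cong) (use assms chart_at(2) in \<open>auto simp: c.coord_img c.inv_coord\<close>)
  then show ?thesis unfolding ginner_chart_at inner_c_def by (simp add: pd_const)
qed

lemma smooth_chart: "smooth_fun M h \<Longrightarrow> c \<in> atlas M \<Longrightarrow> smooth_on (img_chart c) (h \<circ> inv_chart c)"
  unfolding smooth_fun_def by blast

end

section \<open>Chart independence of the Laplacian and Green's formula\<close>

context riem_vol
begin

text \<open>The volume has full support. If the integral vanished, the open set near p where G > 0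
  would be null, and so would its chart image since the density is positive; but a nonempty open set
  is not negligible.\<close>

lemma integral_pos:
  assumes G: "continuous_on UNIV G" "\<And>q. G q \<ge> 0" "G p > (0::real)"
  shows "(\<integral>q. G q \<partial>\<mu>) \<noteq> 0"
proof
  assume 0: "(\<integral>q. G q \<partial>\<mu>) = 0"
  let ?c = "chart_at M p"
  interpret c: riem_chart M ?c by (rule chart[OF chart_at(1)])
  define A where "A = fst ?c \<inter> G -` {0<..}"
  have A: "open A" unfolding A_def
    by (rule continuous_open_preimage[OF continuous_on_subset[OF G(1)] c.dom_open]) auto
  have "AE q in \<mu>. G q = 0"
    using 0 integral_nonneg_eq_0_iff_AE[OF integrable_continuous[OF G(1)]] G(2) by simp
  then have "AE q in \<mu>. q \<notin> A" by (rule AE_mp) (auto simp: A_def)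
  then have "emeasure \<mu> A = 0"
    by (subst (asm) AE_iff_measurable[of A]) (use A sets_vol in \<open>auto simp: space_vol\<close>)
  then have 1: "(\<integral>\<^sup>+ y \<in> snd ?c ` A. ennreal (vol_c M ?c y) \<partial>lborel) = 0"
    by (subst (asm) emeasure_vol[OF chart_at(1)]) (use A in \<open>auto simp: A_def\<close>)
  have "openin (top_of_set c.V) (snd ?c ` A)"
    by (rule homeomorphism_imp_open_map[OF c.homeo]) (use A in \<open>auto simp: A_def openin_open\<close>)
  then have oA: "open (snd ?c ` A)" using c.V_open openin_open_trans by blast
  have sub: "snd ?c ` A \<subseteq> c.V" using c.coord_img by (auto simp: A_def)
  have eq: "ennreal (vol_c M ?c y) * indicator (snd ?c ` A) y
      = ennreal (indicator (snd ?c ` A) y *\<^sub>R vol_c M ?c y)" for y by (auto simp: indicator_def)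
  have "(\<lambda>y. indicator (snd ?c ` A) y *\<^sub>R vol_c M ?c y) \<in> borel_measurable borel"
    by (rule borel_measurable_continuous_on_indicator)
      (use oA continuous_on_subset[OF Ck_on_continuous_on[OF c.vol_C1] sub] in auto)
  then have "AE y in lborel. ennreal (indicator (snd ?c ` A) y *\<^sub>R vol_c M ?c y) = 0"
    using 1 unfolding eq by (subst (asm) nn_integral_0_iff_AE) auto
  then have "AE y in lborel. y \<notin> snd ?c ` A"
  proof (rule AE_mp, intro AE_I2 impI notI)
    fix y assume y: "ennreal (indicator (snd ?c ` A) y *\<^sub>R vol_c M ?c y) = 0" "y \<in> snd ?c ` A"
    then show False using c.vol_pos[of y] sub by auto
  qed
  then have "snd ?c ` A \<in> null_sets lborel" using oA by (subst (asm) AE_iff_null_sets[symmetric]) auto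
  then have "negligible (snd ?c ` A)" unfolding negligible_iff_null_sets by (rule null_sets_completionI)
  moreover have "snd ?c p \<in> snd ?c ` A" using chart_at(2) G(3) by (auto simp: A_def)
  ultimately show False using open_not_negligible[OF oA] by blast
qed

text \<open>Both chart expressions are the formal adjoint of the gradient, which does not depend on the chart;
  testing against a bump function where they differ gives a contradiction.\<close>

lemma lap_c_le:
  assumes c: "c \<in> atlas M" and d: "d \<in> atlas M" and p: "p \<in> fst c" "p \<in> fst d" and h: "smooth_fun M h"
  shows "lap_c M c (h \<circ> inv_chart c) (snd c p) \<le> lap_c M d (h \<circ> inv_chart d) (snd d p)"
proof (rule ccontr)
  define l where "l e q = lap_c M e (h \<circ> inv_chart e) (snd e q)" for e q
  assume "\<not> ?thesis"
  then have pos: "l c p - l d p > 0" by (simp add: l_def)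
  have l: "continuous_on (fst e) (l e)" if e: "e \<in> atlas M" for e
  proof -
    interpret e: riem_chart M e by (rule chart[OF e])
    show ?thesis unfolding l_def
      by (rule continuous_on_compose2[OF smooth_on_continuous_on[OF e.lap_c_smooth[OF smooth_chart[OF h e]]]])
        (use e.homeo in \<open>auto simp: homeomorphism_def\<close>)
  qed
  note o = riem_chart.dom_open[OF chart]
  define U where "U = (fst c \<inter> fst d) \<inter> (\<lambda>q. l c q - l d q) -` {0<..}"
  have "open U" unfolding U_def by (rule continuous_open_preimage)
      (auto intro!: continuous_intros continuous_on_subset[OF l] c d o)
  moreover have "p \<in> U" using pos p by (simp add: U_def)
  ultimately obtain b K where b: "C1_fun M b" "\<And>q. b q \<ge> 0" "b p > 0" "compact K" "K \<subseteq> U" "\<And>q. q \<notin> K \<Longrightarrow> b q = 0"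
    using bump_exists by blast
  have K: "K \<subseteq> fst c" "K \<subseteq> fst d" using b(5) by (auto simp: U_def)
  have clK: "closed K" using b(4) compact_imp_closed by blast
  have gv: "ginner M b h q = 0" if "q \<notin> K" for q
    by (rule ginner_vanish[of "- K"]) (use that clK b(6) in auto)
  \<comment> \<open>The integrand of Green's formula read in the chart e. The gradient term is
    common to both charts, so the difference of the two integrands is b times the difference of the
    Laplacians, nonnegative and positive at p.\<close>
  define F where "F e q = (if q \<in> fst e then ginner M b h q + b q * l e q else 0)" for e q
  have F: "continuous_on UNIV (F e)" "(\<integral>q. F e q \<partial>\<mu>) = 0" if e: "e \<in> atlas M" "K \<subseteq> fst e" for e
  proof -
    show "continuous_on UNIV (F e)"
    proof (rule continuous_on_extend_zero[OF o[OF e(1)] clK e(2)])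
      show "continuous_on (fst e) (F e)"
        by (rule continuous_on_eq[where f = "\<lambda>q. ginner M b h q + b q * l e q"])
          (auto intro!: continuous_intros continuous_on_subset[OF C1_fun_continuous[OF b(1)]] l[OF e(1)]
            continuous_on_subset[OF ginner_continuous[OF b(1) smooth_fun_C1[OF h]]] simp: F_def)
    qed (simp add: F_def gv b(6))
    show "(\<integral>q. F e q \<partial>\<mu>) = 0"
      using local_integration_by_parts[OF e(1) b(1,4) e(2) b(6) h] unfolding F_def l_def by auto
  qed
  note Fc = F[OF c K(1)] and Fd = F[OF d K(2)]
  have "(\<integral>q. F c q - F d q \<partial>\<mu>) = 0"
    using integrable_continuous[OF Fc(1)] integrable_continuous[OF Fd(1)] Fc(2) Fd(2) by simp
  moreover have "F c q - F d q \<ge> 0" for q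
  proof (cases "q \<in> K")
    case True
    then have "q \<in> fst c" "q \<in> fst d" "l c q - l d q \<ge> 0" using b(5) by (auto simp: U_def)
    then show ?thesis using b(2)[of q] by (simp add: F_def mult_left_mono)
  qed (simp add: F_def gv b(6))
  moreover have "F c p - F d p = b p * (l c p - l d p)" using p by (simp add: F_def algebra_simps)
  then have "F c p - F d p > 0" using b(3) pos by simp
  ultimately show False
    using integral_pos[of "\<lambda>q. F c q - F d q" p] Fc(1) Fd(1) by (auto intro: continuous_on_diff)
qed

text \<open>The inequality between chart Laplacians, used in both directions. Only now can the
  Laplacian of a function be differentiated and integrated over the manifold.\<close>

lemma laplacian_chart:
  assumes h: "smooth_fun M h" and c: "c \<in> atlas M" and p: "p \<in> fst c"
  shows "laplacian M h p = lap_c M c (h \<circ> inv_chart c) (snd c p)"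
proof -
  have "laplacian M h p = lap_c M (chart_at M p) (h \<circ> inv_chart (chart_at M p)) (snd (chart_at M p) p)"
    unfolding laplacian_def lap_c_def hess_def hess_coord_def hess_c_def gup_def metric_at_def coord_at_def
      gmat_coord[OF chart_at] by simp
  also have "\<dots> = lap_c M c (h \<circ> inv_chart c) (snd c p)"
    using lap_c_le[OF c chart_at(1) p chart_at(2) h] lap_c_le[OF chart_at(1) c chart_at(2) p h] by simp
  finally show ?thesis .
qed

lemma smooth_laplacian:
  assumes h: "smooth_fun M h"
  shows "smooth_fun M (laplacian M h)" unfolding smooth_fun_def
proof
  fix c assume c: "c \<in> atlas M"
  interpret c: riem_chart M c by (rule chart[OF c])
  show "smooth_on c.V (laplacian M h \<circ> inv_chart c)"
    by (rule smooth_on_cong[THEN iffD1, OF _ c.lap_c_smooth[OF smooth_chart[OF h c]]])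
      (simp add: laplacian_chart[OF h c] c.inv_chart_dom c.coord_inv)
qed

lemma smooth_ginner:
  assumes f: "smooth_fun M f" and h: "smooth_fun M h"
  shows "smooth_fun M (ginner M f h)" unfolding smooth_fun_def
proof
  fix c assume c: "c \<in> atlas M"
  interpret c: riem_chart M c by (rule chart[OF c])
  show "smooth_on c.V (ginner M f h \<circ> inv_chart c)"
    by (rule smooth_on_cong[THEN iffD1, OF _ c.inner_c_smooth[OF smooth_chart[OF f c] smooth_chart[OF h c]]])
      (simp add: ginner_chart[OF smooth_fun_C1[OF f] smooth_fun_C1[OF h] c] c.inv_chart_dom c.coord_inv)
qed

text \<open>Green's formula is linear in f. Finitely many bumps with positive sum B cover the
  compact manifold, and the quotients of the bumps by B form a partition of unity of class C^1 that
  splits f into pieces supported in single charts.\<close>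

lemma integration_by_parts:
  assumes f: "C1_fun M f" and h: "smooth_fun M h"
  shows "(\<integral>q. ginner M f h q + f q * laplacian M h q \<partial>\<mu>) = 0"
proof -
  have "\<exists>b K. C1_fun M b \<and> (\<forall>q. b q \<ge> 0) \<and> b p > 0 \<and> compact K \<and> K \<subseteq> fst (chart_at M p) \<and> (\<forall>q. q \<notin> K \<longrightarrow> b q = 0)" for p
    using bump_exists[OF riem_chart.dom_open[OF chart[OF chart_at(1)]] chart_at(2), of p] by metis
  then obtain b K where b: "\<And>p. C1_fun M (b p)" "\<And>p q. b p q \<ge> 0" "\<And>p. b p p > 0" "\<And>p. compact (K p)"
      "\<And>p. K p \<subseteq> fst (chart_at M p)" "\<And>p q. q \<notin> K p \<Longrightarrow> b p q = 0" by metis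
  define T where "T p = b p -` {0<..}" for p
  have T: "open (T p)" for p unfolding T_def
    using continuous_open_preimage[OF C1_fun_continuous[OF b(1)] open_UNIV, of "{0<..}"] by simp
  have "UNIV \<subseteq> (\<Union>p\<in>UNIV. T p)" using b(3) by (auto simp: T_def)
  then obtain P where P: "finite P" "UNIV \<subseteq> (\<Union>p\<in>P. T p)"
    by (rule compactE_image[OF compact_M T])
  define B where "B q = (\<Sum>p\<in>P. b p q)" for q
  have B: "B q > 0" for q
  proof -
    obtain p where "p \<in> P" "b p q > 0" using P(2) by (auto simp: T_def)
    then show ?thesis unfolding B_def using P(1) b(2) by (intro sum_pos2) auto
  qed
  have CB: "C1_fun M B" unfolding B_def by (intro C1_fun_sum b)
  define fp where "fp p q = b p q * (f q * inverse (B q))" for p q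
  have Cfp: "C1_fun M (fp p)" for p unfolding fp_def
    by (intro C1_fun_mult C1_fun_inverse b f CB) (use B in \<open>auto simp: less_le\<close>)
  have fp0: "fp p q = 0" if "q \<notin> K p" for p q using b(6)[OF that] by (simp add: fp_def)
  have f_eq: "f = (\<lambda>q. \<Sum>p\<in>P. fp p q)"
  proof
    fix q
    have "(\<Sum>p\<in>P. fp p q) = B q * (f q * inverse (B q))" by (simp add: fp_def B_def sum_distrib_right)
    then show "f q = (\<Sum>p\<in>P. fp p q)" using B[of q] by simp
  qed
  have "(\<integral>q. ginner M (fp p) h q + fp p q * laplacian M h q \<partial>\<mu>) = 0" for p
  proof -
    have "ginner M (fp p) h q + fp p q * laplacian M h q
      = (if q \<in> fst (chart_at M p) then ginner M (fp p) h q
          + fp p q * lap_c M (chart_at M p) (h \<circ> inv_chart (chart_at M p)) (snd (chart_at M p) q) else 0)" for q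
    proof (cases "q \<in> fst (chart_at M p)")
      case True
      then show ?thesis using laplacian_chart[OF h chart_at(1)] by simp
    next
      case False
      then have "q \<notin> K p" using b(5) by blast
      moreover have "ginner M (fp p) h q = 0"
        by (rule ginner_vanish[of "- K p"]) (use \<open>q \<notin> K p\<close> compact_imp_closed[OF b(4)] fp0 in auto)
      ultimately show ?thesis using False by (simp add: fp0)
    qed
    then show ?thesis using local_integration_by_parts[OF chart_at(1) Cfp b(4,5) fp0 h] by simp
  qed
  moreover have "ginner M f h q + f q * laplacian M h q = (\<Sum>p\<in>P. ginner M (fp p) h q + fp p q * laplacian M h q)" for q
    by (subst (1 2) f_eq) (simp add: ginner_sum_left Cfp sum.distrib sum_distrib_right)
  moreover have "integrable \<mu> (\<lambda>q. ginner M (fp p) h q + fp p q * laplacian M h q)" for p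
    by (intro integrable_continuous continuous_intros ginner_continuous Cfp smooth_fun_C1 h C1_fun_continuous smooth_laplacian)
  ultimately show ?thesis by (simp add: Bochner_Integration.integral_sum)
qed

text \<open>The Hessian and the Ricci term are read at p in the one chart chosen there. Chart
  independence enters only for the functions being differentiated, |\<nabla>h|^2 and the Laplacian
  of h, whose values around p refer to other chosen charts.\<close>

lemma bochner:
  assumes h: "smooth_fun M h"
  shows "laplacian M (ginner M h h) p / 2 = tensor_norm_sq M p (hess M h p)
     + ginner M (laplacian M h) h p + Ric M p (grad M h p) (grad M h p)"
proof -
  let ?c = "chart_at M p"
  interpret c: riem_chart M ?c by (rule chart[OF chart_at(1)])
  define w where "w = h \<circ> inv_chart ?c"
  define y where "y = snd ?c p"
  have y: "y \<in> c.V" using c.coord_img chart_at(2) by (simp add: y_def)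
  have w: "smooth_on c.V w" unfolding w_def by (rule smooth_chart[OF h chart_at(1)])
  note h1 = smooth_fun_C1[OF h]
  have gr: "grad M h p $ m = grad_c M ?c w m y" for m
    by (simp add: grad_def differential_def diff_coord_def coord_at_def metric_at_def grad_c_def gup_def w_def y_def
        matrix_vector_mult_def gmat_coord[OF chart_at])
  have "laplacian M (ginner M h h) p = lap_c M ?c (ginner M h h \<circ> inv_chart ?c) y"
    unfolding y_def by (rule laplacian_chart[OF smooth_ginner[OF h h] chart_at])
  also have "\<dots> = lap_c M ?c (inner_c M ?c w w) y"
    by (rule c.lap_c_cong[OF y]) (simp add: ginner_chart[OF h1 h1 chart_at(1)[of p]] c.inv_chart_dom c.coord_inv w_def)
  finally have l: "laplacian M (ginner M h h) p / 2 = lap_c M ?c (inner_c M ?c w w) y / 2" by simp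
  have "ginner M (laplacian M h) h p = inner_c M ?c (laplacian M h \<circ> inv_chart ?c) w y"
    unfolding ginner_chart_at w_def y_def o_def ..
  also have "\<dots> = inner_c M ?c (lap_c M ?c w) w y"
    by (rule c.inner_c_cong[OF y]) (simp add: laplacian_chart[OF h chart_at(1)[of p]] c.inv_chart_dom c.coord_inv w_def)
  finally have i: "ginner M (laplacian M h) h p = (\<Sum>m\<in>UNIV. grad_c M ?c w m y * pd m (lap_c M ?c w) y)"
    by (simp add: inner_c_def mult.commute)
  have r: "Ric M p (grad M h p) (grad M h p)
     = (\<Sum>m\<in>UNIV. \<Sum>k\<in>UNIV. grad_c M ?c w m y * ricci_coord M ?c y $ m $ k * grad_c M ?c w k y)"
    by (simp add: Ric_def inner_vec_def matrix_vector_mult_def gr coord_at_def y_def[symmetric] sum_distrib_left mult.assoc)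
  have t: "tensor_norm_sq M p (hess M h p)
     = (\<Sum>i\<in>UNIV. \<Sum>j\<in>UNIV. \<Sum>k\<in>UNIV. \<Sum>l\<in>UNIV. c.gi i k y * c.gi j l y * hess_c M ?c w i j y * hess_c M ?c w k l y)"
    unfolding tensor_norm_sq_def Let_def hess_def hess_coord_def hess_c_def gup_def metric_at_def coord_at_def
      y_def w_def gmat_coord[OF chart_at] by simp
  show ?thesis unfolding l i r t by (rule c.bochner_c[OF y w])
qed

end

section \<open>Norms of tensors\<close>

text \<open>A case of the Schur product theorem, by elimination of one index at a time (Schur complements).\<close>

lemma schur_sum_nonneg:
  fixes K P :: "'a \<Rightarrow> 'a \<Rightarrow> real"
  assumes "finite S" and K: "\<And>i k. K i k = K k i" and P: "\<And>i k. P i k = P k i"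
    and K_pos: "\<And>x. (\<exists>i\<in>S. x i \<noteq> 0) \<Longrightarrow> (\<Sum>i\<in>S. \<Sum>k\<in>S. x i * x k * K i k) > 0"
    and P_nonneg: "\<And>x. (\<Sum>i\<in>S. \<Sum>k\<in>S. x i * x k * P i k) \<ge> 0"
  shows "(\<Sum>i\<in>S. \<Sum>k\<in>S. K i k * P i k) \<ge> 0" using assms(1) K K_pos P_nonneg
proof (induction S arbitrary: K rule: finite_induct)
  case empty
  then show ?case by simp
next
  case (insert s S)
  have ins: "(\<Sum>i\<in>insert s S. \<Sum>k\<in>insert s S. f i k)
      = f s s + (\<Sum>k\<in>S. f s k) + (\<Sum>i\<in>S. f i s) + (\<Sum>i\<in>S. \<Sum>k\<in>S. f i k)" for f :: "'a \<Rightarrow> 'a \<Rightarrow> real"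
    using insert.hyps by (simp add: sum.distrib)
  note sym = insert.prems(1)
  have "0 < (\<Sum>i\<in>insert s S. \<Sum>k\<in>insert s S. (if i = s then 1 else 0) * (if k = s then 1 else 0) * K i k)"
    by (rule insert.prems(2)) auto
  also have "\<dots> = K s s"
  proof -
    have "(if i = s then 1 else 0) = (0 :: real)" if "i \<in> S" for i using insert.hyps(2) that by auto
    then show ?thesis unfolding ins by (simp cong: sum.cong_simp)
  qed
  finally have "K s s > 0" .
  define a where "a = K s s"
  define d where "d i = K i s / a" for i
  \<comment> \<open>The Schur complement of the pivot: subtracting this rank-one part clears the row
    and the column of s.\<close>
  define K' where "K' i k = K i k - d i * d k * a" for i k
  have Ks: "a > 0" using \<open>K s s > 0\<close> by (simp add: a_def)
  have dK: "K i s = d i * a" "K s i = d i * a" for i using Ks sym[of s i] by (auto simp: d_def)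
  have ds: "d s = 1" using Ks by (simp add: d_def a_def)
  \<comment> \<open>Stated for arbitrary Q because it serves twice: for the products z i * z k it
    completes the square in the quadratic form of K, and for P it gives the induction step.\<close>
  have expand: "(\<Sum>i\<in>insert s S. \<Sum>k\<in>insert s S. K i k * Q i k)
      = a * (Q s s + (\<Sum>k\<in>S. d k * Q s k) + (\<Sum>k\<in>S. d k * Q k s) + (\<Sum>i\<in>S. \<Sum>k\<in>S. d i * d k * Q i k))
       + (\<Sum>i\<in>S. \<Sum>k\<in>S. K' i k * Q i k)" for Q :: "'a \<Rightarrow> 'a \<Rightarrow> real"
    unfolding ins dK K'_def
    by (simp add: ds distrib_left left_diff_distrib right_diff_distrib sum_subtractf sum_distrib_left mult_ac)
  have "0 \<le> (\<Sum>i\<in>S. \<Sum>k\<in>S. K' i k * P i k)"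
  proof (rule insert.IH)
    show "K' i k = K' k i" for i k by (simp add: K'_def sym[of i k] mult_ac)
    show "(\<Sum>i\<in>S. \<Sum>k\<in>S. x i * x k * K' i k) > 0" if x: "\<exists>i\<in>S. x i \<noteq> 0" for x
    proof -
      define X where "X = (\<Sum>k\<in>S. d k * x k)"
      \<comment> \<open>The value -X minimises the form of K in the coordinate s: it makes the
        square a (z s + X)^2 vanish and leaves the form of K' at x.\<close>
      define z where "z i = (if i = s then - X else x i)" for i
      have z: "z s = - X" "\<And>i. i \<in> S \<Longrightarrow> z i = x i" using insert.hyps(2) by (auto simp: z_def)
      have "0 < (\<Sum>i\<in>insert s S. \<Sum>k\<in>insert s S. z i * z k * K i k)"
        by (rule insert.prems(2)) (use x z(2) in auto)
      also have "\<dots> = (\<Sum>i\<in>insert s S. \<Sum>k\<in>insert s S. K i k * (z i * z k))" by (simp add: mult_ac)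
      also have "\<dots> = a * (X * X - X * X - X * X + (\<Sum>i\<in>S. \<Sum>k\<in>S. d i * d k * (x i * x k)))
         + (\<Sum>i\<in>S. \<Sum>k\<in>S. K' i k * (x i * x k))"
        unfolding expand using z by (simp add: X_def sum_distrib_left sum_negf mult_ac)
      also have "(\<Sum>i\<in>S. \<Sum>k\<in>S. d i * d k * (x i * x k)) = X * X"
        by (simp add: X_def sum_product mult_ac)
      finally show ?thesis by (simp add: mult_ac)
    qed
    show "(\<Sum>i\<in>S. \<Sum>k\<in>S. x i * x k * P i k) \<ge> 0" for x
    proof -
      define z where "z i = (if i = s then 0 else x i)" for i
      have z: "z s = 0" "\<And>i. i \<in> S \<Longrightarrow> z i = x i" using insert.hyps(2) by (auto simp: z_def)
      show ?thesis using insert.prems(3)[of z] unfolding ins using z by simp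
    qed
  qed
  moreover have "0 \<le> P s s + (\<Sum>k\<in>S. d k * P s k) + (\<Sum>k\<in>S. d k * P k s) + (\<Sum>i\<in>S. \<Sum>k\<in>S. d i * d k * P i k)"
  proof -
    \<comment> \<open>The bracket multiplying a in \<open>expand\<close> is the quadratic form of P
      at this vector.\<close>
    define z where "z i = (if i = s then 1 else d i)" for i
    have z: "z s = 1" "\<And>i. i \<in> S \<Longrightarrow> z i = d i" using insert.hyps(2) by (auto simp: z_def)
    show ?thesis using insert.prems(3)[of z] unfolding ins using z by simp
  qed
  ultimately show ?case unfolding expand using Ks by simp
qed

lemma quadratic_form_sum: "v \<bullet> (A *v w) = (\<Sum>i\<in>UNIV. \<Sum>k\<in>UNIV. v $ i * w $ k * A $ i $ k)" for A :: "real ^ 'n ^ 'n"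
  by (simp add: inner_vec_def matrix_vector_mult_def sum_distrib_left mult_ac)

context closed_riem
begin

lemma metric_at_pos_def: "pos_def (metric_at M p)"
  using riem_chart.metric_facts(2)[OF chart[OF chart_at(1)] riem_chart.coord_img[OF chart[OF chart_at(1)] chart_at(2)]]
    gmat_coord[OF chart_at] by (simp add: metric_at_def)

text \<open>|T|^2 is the sum of entrywise products of two matrices, the positive definite inverse
  metric and the Gram matrix of the rows of T with respect to it. The Schur product theorem applies
  without symmetry of T or a diagonalisation of the metric.\<close>

lemma tensor_norm_sq_nonneg: "tensor_norm_sq M p T \<ge> 0"
proof -
  define G where "G = matrix_inv (metric_at M p)"
  have G: "pos_def G" unfolding G_def by (rule pos_def_matrix_inv[OF metric_at_pos_def])
  have nonneg: "v \<bullet> (G *v v) \<ge> 0" for v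
    using G unfolding pos_def_def by (cases "v = 0") (auto simp: less_imp_le)
  have "0 \<le> (\<Sum>i\<in>UNIV. \<Sum>k\<in>UNIV. G $ i $ k * (T $ i \<bullet> (G *v T $ k)))"
  proof (rule schur_sum_nonneg)
    show "T $ i \<bullet> (G *v T $ k) = T $ k \<bullet> (G *v T $ i)" for i k
      by (simp add: quadratic_form_sum, subst sum.swap) (simp add: pos_def_sym[OF G] mult_ac)
    show "(\<Sum>i\<in>UNIV. \<Sum>k\<in>UNIV. x i * x k * G $ i $ k) > 0" if x: "\<exists>i\<in>UNIV. x i \<noteq> 0" for x
    proof -
      have "(\<chi> i. x i) \<noteq> 0" using x by (auto simp: vec_eq_iff)
      then have "(\<chi> i. x i) \<bullet> (G *v (\<chi> i. x i)) > 0" using G unfolding pos_def_def by blast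
      then show ?thesis by (simp add: quadratic_form_sum)
    qed
    show "(\<Sum>i\<in>UNIV. \<Sum>k\<in>UNIV. x i * x k * (T $ i \<bullet> (G *v T $ k))) \<ge> 0" for x
      using nonneg[of "\<Sum>i\<in>UNIV. x i *\<^sub>R T $ i"]
      by (subst sum.swap) (simp add: linear_sum[OF matrix_vector_mul_linear] matrix_vector_mult_scaleR inner_sum_left inner_sum_right
          sum_distrib_left mult_ac)
  qed (simp_all add: pos_def_sym[OF G])
  also have "\<dots> = tensor_norm_sq M p T"
  proof -
    have "(\<Sum>k\<in>UNIV. G $ i $ k * (T $ i \<bullet> (G *v T $ k)))
      = (\<Sum>j\<in>UNIV. \<Sum>k\<in>UNIV. \<Sum>l\<in>UNIV. G $ i $ k * G $ j $ l * T $ i $ j * T $ k $ l)" for i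
      by (simp add: quadratic_form_sum sum_distrib_left, subst sum.swap) (simp add: mult_ac)
    then show ?thesis by (simp add: tensor_norm_sq_def Let_def G_def)
  qed
  finally show ?thesis .
qed

text \<open>Contraction with g is the trace, so both cross terms equal the trace of T, for any T,
  and |g|^2 is the trace of the identity.\<close>

lemma tensor_norm_sq_minus_metric:
  "tensor_norm_sq M p (T - \<kappa> *\<^sub>R metric_at M p) = tensor_norm_sq M p T
    - 2 * \<kappa> * (\<Sum>i\<in>UNIV. \<Sum>j\<in>UNIV. matrix_inv (metric_at M p) $ i $ j * T $ i $ j) + \<kappa>\<^sup>2 * real CARD('n)"
proof -
  let ?U = "UNIV :: 'n set"
  define g where "g = metric_at M p"
  define G where "G = matrix_inv g"
  have g: "pos_def g" unfolding g_def by (rule metric_at_pos_def)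
  have Gp: "pos_def G" unfolding G_def by (rule pos_def_matrix_inv[OF g])
  note sy = pos_def_sym[OF g] pos_def_sym[OF Gp]
  have inv: "(\<Sum>k\<in>?U. G $ i $ k * g $ k $ l) = (if i = l then 1 else 0)" for i l
    using arg_cong[OF matrix_inv_left[OF pos_def_invertible[OF g]], of "\<lambda>A. A $ i $ l"]
    by (simp add: matrix_matrix_mult_def mat_def G_def)
  let ?s = "\<lambda>A B. \<Sum>i\<in>?U. \<Sum>j\<in>?U. \<Sum>k\<in>?U. \<Sum>l\<in>?U. G $ i $ k * G $ j $ l * A $ i $ j * B $ k $ l"
  define tr where "tr = (\<Sum>i\<in>?U. \<Sum>j\<in>?U. G $ i $ j * T $ i $ j)"
  have inner: "(\<Sum>k\<in>?U. \<Sum>l\<in>?U. G $ i $ k * G $ j $ l * g $ k $ l) = G $ i $ j" for i j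
  proof -
    have "(\<Sum>k\<in>?U. \<Sum>l\<in>?U. G $ i $ k * G $ j $ l * g $ k $ l) = (\<Sum>l\<in>?U. (\<Sum>k\<in>?U. G $ i $ k * g $ k $ l) * G $ j $ l)"
      by (subst sum.swap) (simp add: sum_distrib_left sum_distrib_right mult_ac)
    then show ?thesis unfolding inv sum_delta_mult using sy(2) by simp
  qed
  have c1: "?s T g = tr"
  proof -
    have "(\<Sum>k\<in>?U. \<Sum>l\<in>?U. G $ i $ k * G $ j $ l * T $ i $ j * g $ k $ l) = G $ i $ j * T $ i $ j" for i j
      unfolding inner[of i j, symmetric] sum_distrib_right by (simp add: mult_ac)
    then show ?thesis by (simp add: tr_def)
  qed
  have c2: "?s g T = tr"
  proof -
    have "?s g T
      = (\<Sum>k\<in>?U. \<Sum>l\<in>?U. \<Sum>i\<in>?U. \<Sum>j\<in>?U. G $ i $ k * G $ j $ l * g $ i $ j * T $ k $ l)"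
      by (rule trans[OF sum.cong[OF refl sum3_swap(2)] sum3_swap(2)])
    also have "\<dots> = tr" using c1 by (simp add: sy(2)[of _ _] mult_ac)
    finally show ?thesis .
  qed
  have c3: "?s g g = real CARD('n)"
  proof -
    have "(\<Sum>k\<in>?U. \<Sum>l\<in>?U. G $ i $ k * G $ j $ l * g $ i $ j * g $ k $ l) = G $ i $ j * g $ j $ i" for i j
      unfolding inner[of i j, symmetric] sum_distrib_right by (simp add: mult_ac sy(1)[of j i])
    then show ?thesis by (simp add: inv)
  qed
  have "tensor_norm_sq M p (T - \<kappa> *\<^sub>R g) = tensor_norm_sq M p T
     - \<kappa> * ?s T g
     - \<kappa> * ?s g T
     + \<kappa>\<^sup>2 * ?s g g" unfolding tensor_norm_sq_def Let_def g_def[symmetric] G_def[symmetric]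
    by (simp add: sum_distrib_left sum.distrib[symmetric] sum_subtractf[symmetric] algebra_simps power2_eq_square)
  then show ?thesis unfolding c1 c2 c3 by (simp add: tr_def g_def G_def)
qed

end

section \<open>Differentiation under the integral sign\<close>

context riem_vol
begin

text \<open>By the mean value theorem the error of the difference quotient is a difference of two
  values of G' at the same point of the manifold. It is uniformly small by compactness, and the
  total volume is finite. Everything is taken within I, which covers its endpoints.\<close>

lemma integral_time_derivative:
  fixes G G' :: "'m \<Rightarrow> real \<Rightarrow> real"
  assumes I: "is_interval I" and t: "t \<in> I"
    and der: "\<And>p s. s \<in> I \<Longrightarrow> ((\<lambda>s. G p s) has_real_derivative G' p s) (at s within I)"
    and cont: "continuous_on (UNIV \<times> I) (\<lambda>(p, s). G' p s)"
    and G: "\<And>s. s \<in> I \<Longrightarrow> continuous_on UNIV (\<lambda>p. G p s)"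
  shows "((\<lambda>s. \<integral>p. G p s \<partial>\<mu>) has_real_derivative (\<integral>p. G' p t \<partial>\<mu>)) (at t within I)"
proof -
  interpret finite_measure \<mu> by (rule finite_vol)
  \<comment> \<open>Uniformity comes from finitely many neighbourhoods, on each of which G' stays
    within e / 2 of its value at the centre; two such bounds compare the times s and t.\<close>
  have unif: "\<exists>d>0. \<forall>s\<in>I. \<bar>s - t\<bar> < d \<longrightarrow> (\<forall>p. \<bar>G' p s - G' p t\<bar> \<le> e)" if e: "e > 0" for e
  proof -
    have "\<exists>U d. open U \<and> p \<in> U \<and> d > 0 \<and> (\<forall>q\<in>U. \<forall>s\<in>I. \<bar>s - t\<bar> < d \<longrightarrow> \<bar>G' q s - G' p t\<bar> < e / 2)" for p
    proof -
      have "G' p t \<in> ball (G' p t) (e / 2)" using e by simp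
      then obtain A where A: "open A" "(p, t) \<in> A" "\<And>q s. s \<in> I \<Longrightarrow> (q, s) \<in> A \<Longrightarrow> G' q s \<in> ball (G' p t) (e / 2)"
        using cont[unfolded continuous_on_topological, rule_format, of "(p, t)" "ball (G' p t) (e / 2)"] t by auto
      obtain U W where UW: "open U" "open W" "p \<in> U" "t \<in> W" "U \<times> W \<subseteq> A"
        using open_prod_elim[OF A(1,2)] by (metis mem_Sigma_iff)
      obtain d where d: "d > 0" "ball t d \<subseteq> W" using UW(2,4) openE by blast
      have "\<bar>G' q s - G' p t\<bar> < e / 2" if "q \<in> U" "s \<in> I" "\<bar>s - t\<bar> < d" for q s
      proof -
        have "s \<in> W" using d(2) that(3) by (auto simp: dist_real_def abs_minus_commute)
        then have "(q, s) \<in> A" using UW(5) that(1) by auto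
        from A(3)[OF that(2) this] show ?thesis by (simp add: dist_real_def abs_minus_commute)
      qed
      then show ?thesis using UW(1,3) d(1) by blast
    qed
    then obtain U d where Ud: "\<And>p. open (U p)" "\<And>p. p \<in> U p" "\<And>p. d p > 0"
      "\<And>p q s. q \<in> U p \<Longrightarrow> s \<in> I \<Longrightarrow> \<bar>s - t\<bar> < d p \<Longrightarrow> \<bar>G' q s - G' p t\<bar> < e / 2" by metis
    have "UNIV \<subseteq> (\<Union>p\<in>UNIV. U p)" using Ud(2) by auto
    then obtain Q where Q: "finite Q" "UNIV \<subseteq> (\<Union>p\<in>Q. U p)"
      by (rule compactE_image[OF compact_M Ud(1)])
    have "Q \<noteq> {}" using Q(2) by auto
    define \<delta> where "\<delta> = Min (d ` Q)"
    have \<delta>: "\<delta> > 0" "\<And>p. p \<in> Q \<Longrightarrow> \<delta> \<le> d p"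
      using Q(1) \<open>Q \<noteq> {}\<close> Ud(3) by (auto simp: \<delta>_def)
    have "\<bar>G' q s - G' q t\<bar> \<le> e" if "s \<in> I" "\<bar>s - t\<bar> < \<delta>" for q s
    proof -
      obtain p where p: "p \<in> Q" "q \<in> U p" using Q(2) by auto
      have "\<bar>G' q s - G' p t\<bar> < e / 2" "\<bar>G' q t - G' p t\<bar> < e / 2"
        using Ud(4)[OF p(2)] that \<delta>(2)[OF p(1)] Ud(3)[of p] t by auto
      then show ?thesis by linarith
    qed
    then show ?thesis using \<delta>(1) by blast
  qed
  have G't: "continuous_on UNIV (\<lambda>p. G' p t)"
  proof -
    have "continuous_on UNIV (\<lambda>p. (\<lambda>(p, s). G' p s) (p, t))"
      by (rule continuous_on_compose2[OF cont]) (auto intro!: continuous_intros simp: t)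
    then show ?thesis by simp
  qed
  have mvt: "\<exists>\<xi>. \<xi> \<in> I \<and> \<bar>\<xi> - t\<bar> \<le> \<bar>s - t\<bar> \<and> G q s - G q t = (s - t) * G' q \<xi>"
    if s: "s \<in> I" "s \<noteq> t" for q and s :: real
  proof -
    have *: "\<exists>\<xi>\<in>{x<..<y}. G q y - G q x = G' q \<xi> * (y - x)" if xy: "x < y" "x \<in> I" "y \<in> I" for x y
    proof (rule mvt_simple[OF xy(1), where f = "G q" and f' = "\<lambda>z. (*) (G' q z)"])
      fix z assume z: "x \<le> z" "z \<le> y"
      have sub: "{x..y} \<subseteq> I" using mem_is_interval_1_I[OF I xy(2,3)] by auto
      have "(G q has_field_derivative G' q z) (at z within {x..y})"
        by (rule DERIV_subset[OF der sub]) (use z sub in auto)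
      then show "(G q has_derivative (*) (G' q z)) (at z within {x..y})"
        by (simp add: has_field_derivative_def)
    qed
    have inI: "\<xi> \<in> I" if "x < \<xi>" "\<xi> < y" "x \<in> I" "y \<in> I" for x y \<xi>
      using mem_is_interval_1_I[OF I that(3,4)] that(1,2) by simp
    consider "s < t" | "t < s" using s(2) by linarith
    then show ?thesis
    proof cases
      case 1
      then obtain \<xi> where x: "s < \<xi>" "\<xi> < t" "G q t - G q s = G' q \<xi> * (t - s)" using *[OF 1 s(1) t] by auto
      then have "G q s - G q t = (s - t) * G' q \<xi>" by (simp add: algebra_simps)
      then show ?thesis using inI[OF x(1,2) s(1) t] x by (intro exI[of _ \<xi>]) auto
    next
      case 2
      then obtain \<xi> where x: "t < \<xi>" "\<xi> < s" "G q s - G q t = G' q \<xi> * (s - t)" using *[OF 2 t s(1)] by auto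
      then have "G q s - G q t = (s - t) * G' q \<xi>" by (simp add: algebra_simps)
      then show ?thesis using inI[OF x(1,2) t s(1)] x by (intro exI[of _ \<xi>]) auto
    qed
  qed
  define m where "m = measure \<mu> (space \<mu>)"
  have m: "m \<ge> 0" by (simp add: m_def)
  show ?thesis unfolding has_field_derivative_iff
  proof (rule tendstoI)
    fix e :: real assume e: "e > 0"
    \<comment> \<open>Dividing by m + 1 instead of m keeps e' meaningful when m = 0 and still gives
      \<open>e' * m < e\<close>.\<close>
    define e' where "e' = e / (2 * (m + 1))"
    have e': "e' > 0" "e' * m < e" using e m by (auto simp: e'_def field_simps intro!: add_nonneg_pos mult_nonneg_nonneg)
    obtain d where d: "d > 0" "\<And>s p. s \<in> I \<Longrightarrow> \<bar>s - t\<bar> < d \<Longrightarrow> \<bar>G' p s - G' p t\<bar> \<le> e'"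
      using unif[OF e'(1)] by blast
    have "dist (((\<integral>p. G p s \<partial>\<mu>) - (\<integral>p. G p t \<partial>\<mu>)) / (s - t)) (\<integral>p. G' p t \<partial>\<mu>) < e"
      if s: "s \<in> I" "s \<noteq> t" "\<bar>s - t\<bar> < d" for s
    proof -
      note int = integrable_continuous[OF G[OF s(1)]] integrable_continuous[OF G[OF t]] integrable_continuous[OF G't]
      have "((\<integral>p. G p s \<partial>\<mu>) - (\<integral>p. G p t \<partial>\<mu>)) / (s - t) - (\<integral>p. G' p t \<partial>\<mu>)
          = (\<integral>p. (G p s - G p t) / (s - t) - G' p t \<partial>\<mu>)" using int by simp
      also have "\<bar>\<dots>\<bar> \<le> (\<integral>p. e' \<partial>\<mu>)"
      proof (rule integral_abs_bound[THEN order_trans], rule integral_mono)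
        fix p
        obtain \<xi> where "\<xi> \<in> I" "\<bar>\<xi> - t\<bar> \<le> \<bar>s - t\<bar>" "G p s - G p t = (s - t) * G' p \<xi>"
          using mvt[OF s(1,2), of p] by blast
        then show "\<bar>(G p s - G p t) / (s - t) - G' p t\<bar> \<le> e'" using d(2)[of \<xi> p] s by simp
      qed (use int in auto)
      also have "\<dots> = e' * m" by (simp add: m_def mult.commute)
      finally show ?thesis using e'(2) by (simp add: dist_real_def)
    qed
    then show "\<forall>\<^sub>F s in at t within I. dist (((\<integral>p. G p s \<partial>\<mu>) - (\<integral>p. G p t \<partial>\<mu>)) / (s - t)) (\<integral>p. G' p t \<partial>\<mu>) < e"
      unfolding eventually_at using d(1) by (auto simp: dist_real_def)
  qed
qed

end

section \<open>Space-time derivatives\<close>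

text \<open>At points of an open subset the derivative within S is the ordinary one. Used to pass
  from V \<times> I to its open part over the interior of I.\<close>

lemma Ck_on_open_subset:
  assumes T: "open T" "T \<subseteq> S" and "Ck_on k S f"
  shows "Ck_on k T f" using assms(3)
proof (induction k arbitrary: f)
  case 0
  then show ?case using T(2) continuous_on_subset by auto
next
  case (Suc k)
  have f: "f differentiable_on S" "\<And>v. Ck_on k S (\<lambda>x. frechet_derivative f (at x within S) v)"
    using Suc.prems by (simp_all add: Ck_on.simps(2))
  show ?case
  proof (rule Ck_on_SucI[OF T(1)])
    show "(f has_derivative frechet_derivative f (at x within S)) (at x)" if x: "x \<in> T" for x
    proof -
      have "(f has_derivative frechet_derivative f (at x within S)) (at x within S)"
        using f(1) x T(2) unfolding differentiable_on_def frechet_derivative_works by blast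
      then show ?thesis using at_within_open_subset[OF x T] by simp
    qed
  qed (use Suc.IH f(2) in blast)
qed

lemma has_derivative_slice:
  assumes F: "F differentiable_on V \<times> I" and y: "y \<in> V" and t: "t \<in> I"
  shows "((\<lambda>z. F (z, t)) has_derivative (\<lambda>v. frechet_derivative F (at (y, t) within V \<times> I) (v, 0))) (at y within V)"
    and "((\<lambda>s. F (y, s)) has_derivative (\<lambda>h. frechet_derivative F (at (y, t) within V \<times> I) (0, h))) (at t within I)"
proof -
  have D: "(F has_derivative frechet_derivative F (at (y, t) within V \<times> I)) (at (y, t) within V \<times> I)"
    using F y t unfolding differentiable_on_def frechet_derivative_works by auto
  show "((\<lambda>z. F (z, t)) has_derivative (\<lambda>v. frechet_derivative F (at (y, t) within V \<times> I) (v, 0))) (at y within V)"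
    by (rule has_derivative_in_compose[where f = "\<lambda>z. (z, t)", OF _ has_derivative_subset[OF D]])
      (use t in \<open>auto intro!: derivative_eq_intros\<close>)
  show "((\<lambda>s. F (y, s)) has_derivative (\<lambda>h. frechet_derivative F (at (y, t) within V \<times> I) (0, h))) (at t within I)"
    by (rule has_derivative_in_compose[where f = "\<lambda>s. (y, s)", OF _ has_derivative_subset[OF D]])
      (use y in \<open>auto intro!: derivative_eq_intros\<close>)
qed

lemma Ck_on_slice:
  assumes V: "open V" and t: "t \<in> I" and "Ck_on k (V \<times> I) F"
  shows "Ck_on k V (\<lambda>y. F (y, t))" using assms(3)
proof (induction k arbitrary: F)
  case 0
  then show ?case using t by (auto intro!: continuous_on_compose2[of "V \<times> I" F] continuous_intros)
next
  case (Suc k)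
  then have F: "F differentiable_on V \<times> I" "\<And>v. Ck_on k (V \<times> I) (\<lambda>x. frechet_derivative F (at x within V \<times> I) v)"
    unfolding Ck_on.simps(2) by blast+
  show ?case
  proof (rule Ck_on_SucI[OF V])
    show "((\<lambda>z. F (z, t)) has_derivative (\<lambda>v. frechet_derivative F (at (x, t) within V \<times> I) (v, 0))) (at x)"
      if "x \<in> V" for x using has_derivative_slice(1)[OF F(1) that t] unfolding at_within_open[OF that V] .
  qed (rule Suc.IH[OF F(2)])
qed

lemma pd_slice:
  fixes F :: "(real ^ 'n) \<times> real \<Rightarrow> real"
  assumes "F differentiable_on V \<times> I" "open V" "y \<in> V" "t \<in> I"
  shows "pd i (\<lambda>z. F (z, t)) y = frechet_derivative F (at (y, t) within V \<times> I) (axis i 1, 0)"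
  using pd_eq[OF has_derivative_slice(1)[OF assms(1,3,4), unfolded at_within_open[OF assms(3,2)]]] .

lemma time_slice:
  fixes F :: "'a::real_normed_vector \<times> real \<Rightarrow> real"
  assumes F: "F differentiable_on V \<times> I" and y: "y \<in> V" and t: "t \<in> I"
  shows "((\<lambda>s. F (y, s)) has_real_derivative frechet_derivative F (at (y, t) within V \<times> I) (0, 1)) (at t within I)"
proof -
  have D: "(F has_derivative frechet_derivative F (at (y, t) within V \<times> I)) (at (y, t) within V \<times> I)"
    using F y t unfolding differentiable_on_def frechet_derivative_works by auto
  have "(\<lambda>h. frechet_derivative F (at (y, t) within V \<times> I) (0, h))
      = (*) (frechet_derivative F (at (y, t) within V \<times> I) (0, 1))"
  proof
    fix h
    show "frechet_derivative F (at (y, t) within V \<times> I) (0, h)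
      = frechet_derivative F (at (y, t) within V \<times> I) (0, 1) * h"
      using linear_scale[OF has_derivative_linear[OF D], of h "(0, 1)"] by (simp add: mult.commute)
  qed
  then show ?thesis using has_derivative_slice(2)[OF F y t] unfolding has_field_derivative_def by metis
qed

text \<open>Endpoints of I are limits of interior points, so continuity transfers identities that
  calculus on open sets gives only in the interior.\<close>

lemma eq_on_interval_closure:
  fixes A B :: "real \<Rightarrow> real"
  assumes I: "is_interval I" "interior I \<noteq> {}" and A: "continuous_on I A" and B: "continuous_on I B"
    and eq: "\<And>s. s \<in> interior I \<Longrightarrow> A s = B s" and t: "t \<in> I"
  shows "A t = B t"
proof -
  have "t \<in> closure (interior I)"
    using convex_closure_interior[OF is_interval_convex[OF I(1)] I(2)] closure_subset t by blast
  then obtain x where x: "\<And>n. x n \<in> interior I" "x \<longlonglongrightarrow> t" unfolding closure_sequential by blast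
  have xI: "x n \<in> I" for n using x(1) interior_subset by blast
  have "(\<lambda>n. A (x n)) \<longlonglongrightarrow> A t" "(\<lambda>n. B (x n)) \<longlonglongrightarrow> B t"
    using continuous_on_tendsto_compose[OF A x(2) t] continuous_on_tendsto_compose[OF B x(2) t] xI by auto
  then show ?thesis using eq[OF x(1)] LIMSEQ_unique by simp
qed

text \<open>V \<times> I need not be open, so Schwarz's theorem is applied over the interior of I
  only. Both mixed derivatives are continuous up to the endpoints of I, where the equality follows
  in the limit.\<close>

lemma frechet_derivative_time_commute:
  fixes F :: "(real ^ 'n) \<times> real \<Rightarrow> real"
  assumes V: "open V" and I: "is_interval I" "interior I \<noteq> {}" and F: "smooth_on (V \<times> I) F"
    and y: "y \<in> V" and t: "t \<in> I"
  shows "frechet_derivative (\<lambda>x. frechet_derivative F (at x within V \<times> I) v) (at (y, t) within V \<times> I) w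
       = frechet_derivative (\<lambda>x. frechet_derivative F (at x within V \<times> I) w) (at (y, t) within V \<times> I) v"
proof -
  let ?S = "V \<times> I" and ?T = "V \<times> interior I"
  define D where "D v w x = frechet_derivative (\<lambda>x. frechet_derivative F (at x within ?S) v) (at x within ?S) w" for v w x
  have T: "open ?T" "?T \<subseteq> ?S" using V interior_subset by (auto intro: open_Times)
  have C2: "Ck_on (Suc (Suc 0)) ?S F" using F unfolding smooth_on_def by blast
  then have "Ck_on 0 ?S (D v w)" for v w unfolding Ck_on.simps(2) D_def[abs_def] by blast
  then have cont: "continuous_on ?S (D v w)" for v w by simp
  have C2T: "Ck_on 2 ?T F" using Ck_on_open_subset[OF T] F unfolding smooth_on_def by blast
  have 1: "D v w x = frechet_derivative (\<lambda>z. frechet_derivative F (at z) v) (at x) w" if x: "x \<in> ?T" for v w x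
  proof -
    have "frechet_derivative (\<lambda>x. frechet_derivative F (at x within ?S) v) (at x within ?T)
      = frechet_derivative (\<lambda>x. frechet_derivative F (at x) v) (at x within ?T)"
      by (rule frechet_derivative_cong_on[OF x]) (simp add: at_within_open_subset[OF _ T])
    then show ?thesis unfolding D_def at_within_open_subset[OF x T] at_within_open[OF x T(1)] by simp
  qed
  have "D v w (y, t) = D w v (y, t)"
  proof (rule eq_on_interval_closure[OF I, of "\<lambda>s. D v w (y, s)" "\<lambda>s. D w v (y, s)"])
    show "D v w (y, s) = D w v (y, s)" if "s \<in> interior I" for s
      using 1[of "(y, s)"] y that frechet_derivative_commute[OF T(1) C2T, of "(y, s)" v w] by simp
  qed (use y t in \<open>auto intro!: continuous_on_compose2[OF cont] continuous_intros\<close>)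
  then show ?thesis by (simp add: D_def)
qed

section \<open>Entropy production\<close>

context closed_riem
begin

text \<open>Used for both substitutions, the logarithm of u and the potential f as a function of u.
  The connection term is linear in first derivatives, so the only correction is the
  \<open>\<phi>''\<close> term.\<close>

lemma hess_chain:
  assumes w: "smooth_fun M w"
    and d1: "\<And>q. (\<phi> has_real_derivative \<phi>' (w q)) (at (w q))"
    and d2: "\<And>q. (\<phi>' has_real_derivative \<phi>'' (w q)) (at (w q))"
  shows "hess M (\<lambda>q. \<phi> (w q)) p = \<phi>' (w p) *\<^sub>R hess M w p
    + \<phi>'' (w p) *\<^sub>R tensor_prod (differential M w p) (differential M w p)"
proof -
  let ?c = "chart_at M p"
  interpret c: riem_chart M ?c by (rule chart[OF chart_at(1)])
  define W where "W = w \<circ> inv_chart ?c"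
  define y where "y = snd ?c p"
  have y: "y \<in> c.V" using c.coord_img chart_at(2) by (simp add: y_def)
  have Wy: "W y = w p" by (simp add: W_def y_def c.inv_coord chart_at(2))
  have W: "smooth_on c.V W" unfolding W_def by (rule smooth_chart[OF w chart_at(1)])
  have eq: "(\<lambda>q. \<phi> (w q)) \<circ> inv_chart ?c = (\<lambda>z. \<phi> (W z))" by (auto simp: W_def)
  have 1: "pd j (\<lambda>z. \<phi> (W z)) z = \<phi>' (W z) * pd j W z" if "z \<in> c.V" for j z
    by (rule pd_chain[OF c.differentiable_in_chart[OF that W]]) (simp add: W_def d1)
  have dW: "W differentiable at y" "pd j W differentiable at y" for j
    using c.differentiable_in_chart[OF y] W smooth_on_pd[OF c.V_open W] by auto
  have d\<phi>': "(\<phi>' has_real_derivative \<phi>'' (W y)) (at (W y))" by (simp add: W_def d2)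
  have c\<phi>': "(\<lambda>z. \<phi>' (W z)) differentiable at y"
    using has_derivative_compose[OF pd_has_derivative[OF dW(1)] d\<phi>'[unfolded has_field_derivative_def]]
    unfolding differentiable_def by blast
  have 2: "pd i (pd j (\<lambda>z. \<phi> (W z))) y = \<phi>'' (W y) * pd i W y * pd j W y + \<phi>' (W y) * pd i (pd j W) y" for i j
  proof -
    have "pd i (pd j (\<lambda>z. \<phi> (W z))) y = pd i (\<lambda>z. \<phi>' (W z) * pd j W z) y"
      by (rule pd_cong[OF c.V_open y 1])
    also have "\<dots> = pd i (\<lambda>z. \<phi>' (W z)) y * pd j W y + \<phi>' (W y) * pd i (pd j W) y"
      by (rule pd_mult[OF c\<phi>' dW(2)])
    finally show ?thesis by (simp add: pd_chain[OF dW(1) d\<phi>'])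
  qed
  show ?thesis unfolding hess_def hess_coord_def differential_def diff_coord_def coord_at_def eq
      y_def[symmetric] W_def[symmetric] Wy[symmetric]
    by (simp add: vec_eq_iff tensor_prod_def 1[OF y] 2 right_diff_distrib sum_distrib_left mult_ac)
qed

lemma laplacian_chain:
  assumes w: "smooth_fun M w"
    and d1: "\<And>q. (\<phi> has_real_derivative \<phi>' (w q)) (at (w q))"
    and d2: "\<And>q. (\<phi>' has_real_derivative \<phi>'' (w q)) (at (w q))"
  shows "laplacian M (\<lambda>q. \<phi> (w q)) p = \<phi>' (w p) * laplacian M w p + \<phi>'' (w p) * ginner M w w p"
proof -
  have "ginner M w w p = (\<Sum>i\<in>UNIV. \<Sum>j\<in>UNIV. matrix_inv (metric_at M p) $ i $ j
      * (differential M w p $ i * differential M w p $ j))"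
    by (simp add: ginner_def grad_def quadratic_form_sum mult_ac)
  then show ?thesis unfolding laplacian_def hess_chain[OF assms]
    by (simp add: tensor_prod_def distrib_left sum.distrib sum_distrib_left mult_ac)
qed

lemma grad_chain:
  assumes "C1_fun M f" "(\<phi> has_real_derivative d) (at (f p))"
  shows "grad M (\<lambda>q. \<phi> (f q)) p = d *\<^sub>R grad M f p"
  unfolding grad_def differential_chain[OF assms] by (rule matrix_vector_mult_scaleR)

lemma Ric_scaleR: "Ric M p (k *\<^sub>R v) (k *\<^sub>R v) = k\<^sup>2 * Ric M p v v"
  by (simp add: Ric_def matrix_vector_mult_scaleR power2_eq_square)

lemma tensor_norm_sq_scaleR: "tensor_norm_sq M p (k *\<^sub>R T) = k\<^sup>2 * tensor_norm_sq M p T"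
  by (simp add: tensor_norm_sq_def Let_def sum_distrib_left power2_eq_square mult_ac)

lemma ginner_add_left:
  "C1_fun M f \<Longrightarrow> C1_fun M h \<Longrightarrow> ginner M (\<lambda>q. f q + h q) w p = ginner M f w p + ginner M h w p"
  unfolding ginner_chart_at inner_c_def
  by (subst pd_add) (simp_all add: C1_fun_differentiable chart_at distrib_right sum.distrib)

lemma smooth_fun_divide:
  "smooth_fun M f \<Longrightarrow> smooth_fun M h \<Longrightarrow> (\<And>p. h p \<noteq> 0) \<Longrightarrow> smooth_fun M (\<lambda>p. f p / h p)"
  unfolding smooth_fun_def o_def by (auto intro!: smooth_on_divide riem_chart.V_open chart)

lemma smooth_fun_add: "smooth_fun M f \<Longrightarrow> smooth_fun M h \<Longrightarrow> smooth_fun M (\<lambda>p. f p + h p)"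
  unfolding smooth_fun_def o_def by (auto intro!: smooth_on_add riem_chart.V_open chart)

end

context riem_vol
begin

text \<open>At a fixed time the asserted bound is an equality. Here v is the right-hand side of the
  evolution equation; once everything is written in h = ln w, both sides reduce to the integrals a1
  to a7 with weight w^2, up to constants, and Green's formula supplies the linear relations between
  them.\<close>

lemma entropy_production:
  fixes w :: "'m \<Rightarrow> real" and a :: real
  defines "n \<equiv> real CARD('n)"
  defines "v \<equiv> \<lambda>q. laplacian M w q + grad_sq M w q / w q"
  defines "\<omega> \<equiv> omega M \<mu> w a"
  assumes w: "smooth_fun M w" and pos: "\<And>q. w q > 0" and mass: "(\<integral>q. (w q)\<^sup>2 \<partial>\<mu>) = 1" and \<omega>: "\<omega> > 0"
  shows "n / (4 * \<omega>) * (\<integral>q. (tensor_norm_sq M q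
        (- (2 / w q) *\<^sub>R hess M w q + (2 / (w q)\<^sup>2) *\<^sub>R tensor_prod (differential M w q) (differential M w q)
          - (4 * \<omega> / n) *\<^sub>R metric_at M q)
      + 4 * Ric M q ((1 / w q) *\<^sub>R grad M w q) ((1 / w q) *\<^sub>R grad M w q)) * (w q)\<^sup>2 \<partial>\<mu>)
    = (\<integral>q. 2 * w q * v q * (ln ((w q)\<^sup>2) + 1) \<partial>\<mu>) - n / 2 * ((\<integral>q. 2 * ginner M w v q \<partial>\<mu>) / \<omega>) + 4 * a"
    (is "_ * (\<integral>q. ?R q \<partial>\<mu>) = _")
proof -
  define h where "h q = ln (w q)" for q
  define P where "P = ginner M h h"
  define L where "L = laplacian M h"
  define k where "k = 4 * \<omega> / n"
  have n: "n > 0" by (simp add: n_def)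
  have h: "smooth_fun M h" unfolding h_def by (rule smooth_fun_ln[OF w pos])
  have P: "smooth_fun M P" unfolding P_def by (rule smooth_ginner[OF h h])
  have L: "smooth_fun M L" unfolding L_def by (rule smooth_laplacian[OF h])
  note C1 = smooth_fun_C1[OF w] smooth_fun_C1[OF h] smooth_fun_C1[OF P] smooth_fun_C1[OF L]
  have dln: "((\<lambda>s. ln s) has_real_derivative 1 / w q) (at (w q))" for q
    using pos[of q] by (auto intro!: derivative_eq_intros)
  have dln': "((\<lambda>s. 1 / s) has_real_derivative - 1 / (w q)\<^sup>2) (at (w q))" for q
    using pos[of q] by (auto intro!: derivative_eq_intros simp: power2_eq_square field_simps)
  have hess_h: "hess M h q = (1 / w q) *\<^sub>R hess M w q + (- 1 / (w q)\<^sup>2) *\<^sub>R tensor_prod (differential M w q) (differential M w q)" for q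
    unfolding h_def[abs_def] by (rule hess_chain[where \<phi>' = "\<lambda>s. 1 / s", OF w dln dln'])
  have L_eq: "L q = (1 / w q) * laplacian M w q + (- 1 / (w q)\<^sup>2) * ginner M w w q" for q
    unfolding L_def h_def[abs_def] by (rule laplacian_chain[where \<phi>' = "\<lambda>s. 1 / s", OF w dln dln'])
  have grad_h: "grad M h q = (1 / w q) *\<^sub>R grad M w q" for q
    unfolding h_def[abs_def] by (rule grad_chain[OF C1(1) dln])
  have gw: "ginner M w f q = w q * ginner M h f q" for f q
  proof -
    have "ginner M h f q = 1 / w q * ginner M w f q"
      unfolding h_def[abs_def] by (rule ginner_chain_left[OF C1(1) dln])
    then show ?thesis using pos[of q] by simp
  qed
  have gww: "ginner M w w q = (w q)\<^sup>2 * P q" for q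
    unfolding P_def gw[of w] ginner_commute[of h w] gw[of h] by (simp add: power2_eq_square)
  have lw: "laplacian M w q = w q * (L q + P q)" for q
    using L_eq[of q] pos[of q] unfolding gww by (simp add: field_simps power2_eq_square)
  have v: "v = (\<lambda>q. w q * (L q + 2 * P q))"
  proof
    fix q
    show "v q = w q * (L q + 2 * P q)"
      using pos[of q] unfolding v_def grad_sq_ginner gww lw by (simp add: field_simps power2_eq_square)
  qed
  have g2: "ginner M (\<lambda>q. w q * w q) f q = 2 * (w q)\<^sup>2 * ginner M h f q" for f q
    unfolding ginner_mult_left[OF C1(1) C1(1)] gw by (simp add: power2_eq_square)
  have gconst: "ginner M (\<lambda>q. c * f q + d) g q = c * ginner M f g q" if "C1_fun M f" for c d f g q
    by (rule ginner_chain_left[OF that]) (auto intro!: derivative_eq_intros)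
  have C2: "C1_fun M (\<lambda>q. w q * w q)" "C1_fun M (\<lambda>q. w q * w q * P q)" "C1_fun M (\<lambda>q. 2 * h q + 1)"
    "C1_fun M (\<lambda>q. w q * w q * (2 * h q + 1))" "C1_fun M (\<lambda>q. 2 * P q)"
    by (intro C1_fun_mult C1_fun_add C1_fun_const C1)+
  have dlap: "smooth_fun M (laplacian M P)" by (rule smooth_laplacian[OF P])
  define a1 where "a1 = (\<integral>q. (w q)\<^sup>2 * laplacian M P q \<partial>\<mu>)"
  define a2 where "a2 = (\<integral>q. (w q)\<^sup>2 * ginner M L h q \<partial>\<mu>)"
  define a3 where "a3 = (\<integral>q. (w q)\<^sup>2 * L q \<partial>\<mu>)"
  define a4 where "a4 = (\<integral>q. (w q)\<^sup>2 * P q \<partial>\<mu>)"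
  define a5 where "a5 = (\<integral>q. (w q)\<^sup>2 * ginner M P h q \<partial>\<mu>)"
  define a6 where "a6 = (\<integral>q. (w q)\<^sup>2 * (P q * L q) \<partial>\<mu>)"
  define a7 where "a7 = (\<integral>q. (w q)\<^sup>2 * (P q * P q) \<partial>\<mu>)"
  have cw: "continuous_on UNIV w" "continuous_on UNIV h" "continuous_on UNIV P" "continuous_on UNIV L"
    using C1 C1_fun_continuous by auto
  have int: "integrable \<mu> (\<lambda>q. (w q)\<^sup>2 * F q)" if "continuous_on UNIV F" for F
    by (intro integrable_continuous continuous_intros cw that)
  have ints: "integrable \<mu> (\<lambda>q. (w q)\<^sup>2 * laplacian M P q)" "integrable \<mu> (\<lambda>q. (w q)\<^sup>2 * ginner M L h q)"
    "integrable \<mu> (\<lambda>q. (w q)\<^sup>2 * L q)" "integrable \<mu> (\<lambda>q. (w q)\<^sup>2 * P q)" "integrable \<mu> (\<lambda>q. (w q)\<^sup>2 * ginner M P h q)"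
    "integrable \<mu> (\<lambda>q. (w q)\<^sup>2 * (P q * L q))" "integrable \<mu> (\<lambda>q. (w q)\<^sup>2 * (P q * P q))" "integrable \<mu> (\<lambda>q. (w q)\<^sup>2)"
    using int[of "\<lambda>q. 1"] by (auto intro!: int ginner_continuous C1 continuous_intros cw C1_fun_continuous[OF smooth_fun_C1[OF dlap]])
  \<comment> \<open>Green's formula for the pairs (w^2, P), (w^2 P, h) and (w^2, h). In turn they
    remove the Laplacian of P left by Bochner's formula, the terms quadratic in P and L from the
    energy rate, and the trace term of the expanded square.\<close>
  have e1: "2 * a5 + a1 = 0"
  proof -
    have "(\<integral>q. 2 * ((w q)\<^sup>2 * ginner M P h q) + (w q)\<^sup>2 * laplacian M P q \<partial>\<mu>) = 0"
      using integration_by_parts[OF C2(1) P] unfolding g2 ginner_commute[of h] by (simp add: power2_eq_square mult_ac)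
    then show ?thesis using ints by (simp add: a5_def a1_def)
  qed
  have e2: "a5 + 2 * a7 + a6 = 0"
  proof -
    have "ginner M (\<lambda>q. w q * w q * P q) h q = (w q)\<^sup>2 * ginner M P h q + 2 * ((w q)\<^sup>2 * (P q * P q))" for q
      unfolding ginner_mult_left[OF C2(1) C1(3)] g2 by (simp add: P_def power2_eq_square)
    then have "(\<integral>q. (w q)\<^sup>2 * ginner M P h q + 2 * ((w q)\<^sup>2 * (P q * P q)) + (w q)\<^sup>2 * (P q * L q) \<partial>\<mu>) = 0"
      using integration_by_parts[OF C2(2) h] by (simp add: L_def power2_eq_square mult_ac)
    then show ?thesis using ints by (simp add: a5_def a6_def a7_def)
  qed
  have e3: "2 * a4 + a3 = 0"
  proof -
    have "(\<integral>q. 2 * ((w q)\<^sup>2 * P q) + (w q)\<^sup>2 * L q \<partial>\<mu>) = 0"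
      using integration_by_parts[OF C2(1) h] unfolding g2 by (simp add: P_def L_def power2_eq_square mult_ac)
    then show ?thesis using ints by (simp add: a3_def a4_def)
  qed
  have S: "(\<integral>q. 2 * w q * v q * (ln ((w q)\<^sup>2) + 1) \<partial>\<mu>) = - 4 * a4"
  proof -
    \<comment> \<open>Half the integrand of the entropy rate. Tested with w^2 (2 h + 1), Green's
      formula cancels it up to the contribution 2 w^2 P from differentiating the factor 2 h +
      1.\<close>
    define Z where "Z q = (w q)\<^sup>2 * ((2 * h q + 1) * (L q + 2 * P q))" for q
    have iZ: "integrable \<mu> Z" unfolding Z_def by (intro int continuous_intros cw)
    have "ginner M (\<lambda>q. w q * w q * (2 * h q + 1)) h q = 2 * (w q)\<^sup>2 * P q * (2 * h q + 1) + 2 * ((w q)\<^sup>2 * P q)" for q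
      unfolding ginner_mult_left[OF C2(1,3)] g2 gconst[OF C1(2)] by (simp add: P_def power2_eq_square)
    then have "(\<integral>q. Z q + 2 * ((w q)\<^sup>2 * P q) \<partial>\<mu>) = 0"
      using integration_by_parts[OF C2(4) h] by (simp add: L_def Z_def power2_eq_square algebra_simps)
    then have Z: "(\<integral>q. Z q \<partial>\<mu>) = - 2 * a4" using ints iZ by (simp add: a4_def)
    have eqZ: "2 * w q * v q * (ln ((w q)\<^sup>2) + 1) = 2 * Z q" for q
    proof -
      have "ln ((w q)\<^sup>2) = 2 * h q" using ln_realpow[of "w q" 2] pos[of q] by (simp add: h_def)
      then show ?thesis unfolding v Z_def by (simp add: power2_eq_square)
    qed
    show ?thesis unfolding eqZ by (simp add: Z)
  qed
  have E: "(\<integral>q. 2 * ginner M w v q \<partial>\<mu>) = 2 * (a2 + a5)"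
  proof -
    have "ginner M w v q = (w q)\<^sup>2 * ginner M L h q + 2 * ((w q)\<^sup>2 * ginner M P h q)
        + (w q)\<^sup>2 * (P q * L q) + 2 * ((w q)\<^sup>2 * (P q * P q))" for q
    proof -
      have "ginner M (\<lambda>q. 2 * P q) h q = 2 * ginner M P h q" using gconst[OF C1(3), of 2 0] by simp
      then have "ginner M (\<lambda>q. L q + 2 * P q) h q = ginner M L h q + 2 * ginner M P h q"
        by (simp add: ginner_add_left[OF C1(4) C2(5)])
      then have "ginner M v h q = w q * (ginner M L h q + 2 * ginner M P h q) + (L q + 2 * P q) * (w q * P q)"
        unfolding v ginner_mult_left[OF C1(1) C1_fun_add[OF C1(4) C2(5)]] gw[of h] by (simp add: P_def)
      then show ?thesis unfolding gw[of v] ginner_commute[of h v] by (simp add: power2_eq_square algebra_simps)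
    qed
    then have "(\<integral>q. 2 * ginner M w v q \<partial>\<mu>) = 2 * (a2 + 2 * a5 + a6 + 2 * a7)"
      using ints by (simp add: a2_def a5_def a6_def a7_def)
    then show ?thesis using e2 by simp
  qed
  have \<omega>_eq: "\<omega> = a4 + a" unfolding \<omega>_def omega_def grad_sq_ginner gww a4_def ..
  \<comment> \<open>Besides eliminating the Hessian and the Ricci term, this settles integrability:
    those are read in charts depending on q, whereas the right-hand side is a sum of continuous
    functions.\<close>
  have R: "?R q = 2 * ((w q)\<^sup>2 * laplacian M P q) - 4 * ((w q)\<^sup>2 * ginner M L h q)
      + 4 * k * ((w q)\<^sup>2 * L q) + k\<^sup>2 * n * (w q)\<^sup>2" for q
  proof -
    have T: "- (2 / w q) *\<^sub>R hess M w q + (2 / (w q)\<^sup>2) *\<^sub>R tensor_prod (differential M w q) (differential M w q)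
        = (- 2) *\<^sub>R hess M h q" unfolding hess_h by (simp add: vec_eq_iff algebra_simps)
    have "tensor_norm_sq M q ((- 2) *\<^sub>R hess M h q - k *\<^sub>R metric_at M q)
        = 4 * tensor_norm_sq M q (hess M h q) + 4 * k * L q + k\<^sup>2 * n"
      unfolding tensor_norm_sq_minus_metric tensor_norm_sq_scaleR L_def laplacian_def n_def
      by (simp add: sum_distrib_left sum_negf mult_ac)
    moreover have "laplacian M P q / 2 = tensor_norm_sq M q (hess M h q) + ginner M L h q + Ric M q (grad M h q) (grad M h q)"
      unfolding P_def L_def by (rule bochner[OF h])
    ultimately show ?thesis unfolding T k_def[symmetric] grad_h[symmetric] by (simp add: field_simps)
  qed
  have "(\<integral>q. ?R q \<partial>\<mu>) = 2 * a1 - 4 * a2 + 4 * k * a3 + k\<^sup>2 * n"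
    unfolding R using ints mass by (simp add: a1_def a2_def a3_def)
  moreover have "n / (4 * \<omega>) * (2 * a1 - 4 * a2 + 4 * k * a3 + k\<^sup>2 * n)
      = - 4 * a4 - n / 2 * (2 * (a2 + a5) / \<omega>) + 4 * a"
  proof -
    have a1: "a1 = - 2 * a5" and a3: "a3 = - 2 * a4" using e1 e3 by auto
    \<comment> \<open>With this k the trace term contributes -8 a4 and the term k^2 n contributes 4
      \<omega> = 4 a4 + 4 a. Their sum is the entropy rate -4 a4 plus 4 a.\<close>
    have "n / (4 * \<omega>) * (2 * a1 - 4 * a2 + 4 * k * a3 + k\<^sup>2 * n) = - (n / \<omega>) * (a2 + a5) - 8 * a4 + 4 * \<omega>"
      using n \<omega> unfolding a1 a3 k_def by (simp add: field_simps power2_eq_square)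
    also have "\<dots> = - 4 * a4 - n / 2 * (2 * (a2 + a5) / \<omega>) + 4 * a"
      using \<omega> unfolding \<omega>_eq by (simp add: field_simps)
    finally show ?thesis .
  qed
  ultimately show ?thesis unfolding S E by simp
qed

end

section \<open>Evolution of the entropy\<close>

context closed_riem
begin

lemma continuous_on_Times_chartsI:
  fixes G :: "'m \<Rightarrow> real \<Rightarrow> real"
  assumes "\<And>c. c \<in> atlas M \<Longrightarrow> continuous_on (img_chart c \<times> I) (\<lambda>(y, t). G (inv_chart c y) t)"
  shows "continuous_on (UNIV \<times> I) (\<lambda>(p, t). G p t)"
  unfolding continuous_on_eq_continuous_within
proof
  fix x assume x: "x \<in> (UNIV :: 'm set) \<times> I"
  define p where "p = fst x"
  let ?c = "chart_at M p"
  interpret c: riem_chart M ?c by (rule chart[OF chart_at(1)])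
  have "continuous_on (fst ?c) (snd ?c)" using c.homeo by (simp add: homeomorphism_def)
  then have "continuous_on (fst ?c \<times> I) (\<lambda>z. (snd ?c (fst z), snd z))"
    by (intro continuous_on_Pair continuous_on_compose2[of "fst ?c" "snd ?c" "fst ?c \<times> I" fst]
        continuous_on_fst continuous_on_snd continuous_on_id) auto
  then have "continuous_on (fst ?c \<times> I) (\<lambda>z. (\<lambda>(y, t). G (inv_chart ?c y) t) (snd ?c (fst z), snd z))"
    by (rule continuous_on_compose2[OF assms[OF chart_at(1)[of p]]]) (auto simp: c.coord_img)
  then have "continuous_on (fst ?c \<times> I) (\<lambda>(p, t). G p t)"
    by (rule continuous_on_eq) (auto simp: c.inv_coord)
  moreover have xc: "x \<in> fst ?c \<times> I" using x chart_at(2)[of p] by (auto simp: p_def mem_Times_iff)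
  ultimately have "continuous (at x within fst ?c \<times> I) (\<lambda>(p, t). G p t)"
    using continuous_on_eq_continuous_within by blast
  moreover have "at x within UNIV \<times> I = at x within fst ?c \<times> I"
    by (rule at_within_nhd[of _ "fst ?c \<times> UNIV"]) (use xc c.dom_open in \<open>auto intro: open_Times\<close>)
  ultimately show "continuous (at x within UNIV \<times> I) (\<lambda>(p, t). G p t)" by simp
qed

end

text \<open>An interval with nonempty interior has no isolated points, so one-sided derivatives at
  its endpoints are unique too. This identifies the time derivative given by the equation with the
  one of the chart expression.\<close>

lemma has_real_derivative_within_interval_unique:
  fixes f :: "real \<Rightarrow> real"
  assumes I: "is_interval I" "interior I \<noteq> {}" and t: "t \<in> I"
    and "(f has_real_derivative D) (at t within I)" "(f has_real_derivative E) (at t within I)"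
  shows "D = E"
proof -
  have "\<not> (\<exists>x. I = {x})" using I(2) interior_singleton by blast
  then have "t islimpt I" using connected_imp_perfect is_interval_connected[OF I(1)] t by blast
  then have "at t within I \<noteq> bot" using trivial_limit_within by blast
  then show ?thesis using assms(4,5) unfolding has_field_derivative_iff by (metis tendsto_unique)
qed

section \<open>Time derivatives along a solution\<close>

locale riem_flow = riem_vol M \<mu> for M :: "('m::t2_space, 'n::finite) riem" and \<mu> +
  fixes I :: "real set" and u :: "'m \<Rightarrow> real \<Rightarrow> real"
  assumes interval: "is_interval I" "interior I \<noteq> {}"
    and smooth: "smooth_spacetime M I u"
    and pos: "\<And>p t. t \<in> I \<Longrightarrow> u p t > 0"
    and pde: "\<And>p t. t \<in> I \<Longrightarrow> ((\<lambda>s. u p s) has_real_derivative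
        laplacian M (\<lambda>q. u q t) p + grad_sq M (\<lambda>q. u q t) p / u p t) (at t within I)"
begin

text \<open>The time derivative of u, encoded by the right-hand side of the equation: spatial
  smoothness is inherited from the operators, while \<open>ut_chart\<close> supplies joint
  continuity in space and time.\<close>

definition ut :: "real \<Rightarrow> 'm \<Rightarrow> real" where
  "ut t p = laplacian M (\<lambda>q. u q t) p + grad_sq M (\<lambda>q. u q t) p / u p t"

definition uc :: "('m, 'n) chart \<Rightarrow> (real ^ 'n) \<times> real \<Rightarrow> real" where
  "uc c = (\<lambda>(y, t). u (inv_chart c y) t)"

definition Du :: "('m, 'n) chart \<Rightarrow> (real ^ 'n) \<times> real \<Rightarrow> (real ^ 'n) \<times> real \<Rightarrow> real" where
  "Du c v x = frechet_derivative (uc c) (at x within img_chart c \<times> I) v"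

lemma uc_smooth: "c \<in> atlas M \<Longrightarrow> Ck_on k (img_chart c \<times> I) (uc c)"
  using smooth unfolding smooth_spacetime_def smooth_on_def uc_def by blast

lemma uc_differentiable: "c \<in> atlas M \<Longrightarrow> uc c differentiable_on img_chart c \<times> I"
  using uc_smooth[of c "Suc 0"] unfolding Ck_on.simps(2) by blast

lemma Du_smooth: "c \<in> atlas M \<Longrightarrow> Ck_on k (img_chart c \<times> I) (Du c v)"
  using uc_smooth[of c "Suc k"] unfolding Ck_on.simps(2) Du_def[abs_def] by blast

lemma Du_differentiable: "c \<in> atlas M \<Longrightarrow> Du c v differentiable_on img_chart c \<times> I"
  using Du_smooth[of c "Suc 0"] unfolding Ck_on.simps(2) by blast

lemma smooth_slice: "t \<in> I \<Longrightarrow> smooth_fun M (\<lambda>p. u p t)"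
  unfolding smooth_fun_def smooth_on_def
  using Ck_on_slice[OF riem_chart.V_open[OF chart] _ uc_smooth] by (fastforce simp: uc_def o_def)

lemma smooth_ut: "t \<in> I \<Longrightarrow> smooth_fun M (ut t)" unfolding ut_def[abs_def] grad_sq_ginner
  by (intro smooth_fun_add smooth_fun_divide smooth_laplacian smooth_ginner smooth_slice)
    (use pos in \<open>auto simp: less_le\<close>)

lemma ut_chart:
  assumes c: "c \<in> atlas M" and y: "y \<in> img_chart c" and t: "t \<in> I"
  shows "ut t (inv_chart c y) = Du c (0, 1) (y, t)"
  using has_real_derivative_within_interval_unique[OF interval t pde[OF t]
      time_slice[OF uc_differentiable[OF c] y t, unfolded uc_def prod.case]]
  unfolding ut_def Du_def uc_def by simp

lemma pd_u_chart:
  assumes c: "c \<in> atlas M" and y: "y \<in> img_chart c" and t: "t \<in> I"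
  shows "pd i (\<lambda>z. u (inv_chart c z) t) y = Du c (axis i 1, 0) (y, t)"
  using pd_slice[OF uc_differentiable[OF c] riem_chart.V_open[OF chart[OF c]] y t, of i]
  unfolding Du_def by (simp add: uc_def)

lemma pd_ut_chart:
  assumes c: "c \<in> atlas M" and y: "y \<in> img_chart c" and t: "t \<in> I"
  shows "pd i (\<lambda>z. ut t (inv_chart c z)) y
    = frechet_derivative (Du c (0, 1)) (at (y, t) within img_chart c \<times> I) (axis i 1, 0)"
proof -
  have "pd i (\<lambda>z. ut t (inv_chart c z)) y = pd i (\<lambda>z. Du c (0, 1) (z, t)) y"
    by (rule pd_cong[OF riem_chart.V_open[OF chart[OF c]] y]) (rule ut_chart[OF c _ t])
  also have "\<dots> = frechet_derivative (Du c (0, 1)) (at (y, t) within img_chart c \<times> I) (axis i 1, 0)"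
    by (rule pd_slice[OF Du_differentiable[OF c] riem_chart.V_open[OF chart[OF c]] y t])
  finally show ?thesis .
qed

text \<open>Both sides are mixed derivatives of the chart expression on V \<times> I, one taken in
  space first and the other in time first.\<close>

lemma pd_u_time_derivative:
  assumes c: "c \<in> atlas M" and y: "y \<in> img_chart c" and t: "t \<in> I"
  shows "((\<lambda>s. pd i (\<lambda>z. u (inv_chart c z) s) y) has_real_derivative pd i (\<lambda>z. ut t (inv_chart c z)) y) (at t within I)"
proof -
  have s: "smooth_on (img_chart c \<times> I) (uc c)" using uc_smooth[OF c] unfolding smooth_on_def by blast
  have "((\<lambda>s. Du c (axis i 1, 0) (y, s)) has_real_derivative
      frechet_derivative (Du c (axis i 1, 0)) (at (y, t) within img_chart c \<times> I) (0, 1)) (at t within I)"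
    by (rule time_slice[OF Du_differentiable[OF c] y t])
  also have "frechet_derivative (Du c (axis i 1, 0)) (at (y, t) within img_chart c \<times> I) (0, 1)
      = pd i (\<lambda>z. ut t (inv_chart c z)) y" unfolding pd_ut_chart[OF c y t] Du_def[abs_def]
    by (rule frechet_derivative_time_commute[OF riem_chart.V_open[OF chart[OF c]] interval s y t])
  finally show ?thesis
    by (rule has_field_derivative_transform_within[OF _ zero_less_one t]) (simp add: pd_u_chart[OF c y])
qed

text \<open>The metric does not depend on time, so only the two differentials of u contribute,
  equally by symmetry of the pairing.\<close>

lemma grad_sq_time_derivative:
  assumes t: "t \<in> I"
  shows "((\<lambda>s. grad_sq M (\<lambda>q. u q s) p) has_real_derivative 2 * ginner M (\<lambda>q. u q t) (ut t) p) (at t within I)"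
proof -
  let ?c = "chart_at M p"
  interpret c: riem_chart M ?c by (rule chart[OF chart_at(1)])
  define y where "y = snd ?c p"
  have y: "y \<in> c.V" using c.coord_img chart_at(2) by (simp add: y_def)
  let ?U = "\<lambda>s z. u (inv_chart ?c z) s"
  let ?W = "\<lambda>z. ut t (inv_chart ?c z)"
  note d = pd_u_time_derivative[OF chart_at(1)[of p] y t]
  have "((\<lambda>s. inner_c M ?c (?U s) (?U s) y) has_real_derivative
      (\<Sum>j\<in>UNIV. pd j ?W y * grad_c M ?c (?U t) j y + (\<Sum>a\<in>UNIV. c.gi j a y * pd a ?W y) * pd j (?U t) y)) (at t within I)"
    unfolding inner_c_def grad_c_def by (intro DERIV_sum DERIV_mult DERIV_cmult d)
  also have "(\<Sum>j\<in>UNIV. pd j ?W y * grad_c M ?c (?U t) j y + (\<Sum>a\<in>UNIV. c.gi j a y * pd a ?W y) * pd j (?U t) y)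
      = inner_c M ?c ?W (?U t) y + inner_c M ?c (?U t) ?W y"
    by (simp add: inner_c_def sum.distrib grad_c_def[of _ _ ?W] mult.commute)
  also have "\<dots> = 2 * inner_c M ?c (?U t) ?W y" using c.inner_c_commute[OF y, of ?W "?U t"] by simp
  finally show ?thesis unfolding grad_sq_ginner ginner_chart_at y_def .
qed

lemma ut_continuous: "continuous_on (UNIV \<times> I) (\<lambda>(p, t). ut t p)"
proof (rule continuous_on_Times_chartsI)
  fix c assume c: "c \<in> atlas M"
  show "continuous_on (img_chart c \<times> I) (\<lambda>(y, t). ut t (inv_chart c y))"
    by (rule continuous_on_eq[OF Ck_on_continuous_on[OF Du_smooth[OF c]]]) (auto simp: ut_chart[OF c])
qed

lemma u_continuous: "continuous_on (UNIV \<times> I) (\<lambda>(p, t). u p t)"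
  by (rule continuous_on_Times_chartsI) (use Ck_on_continuous_on[OF uc_smooth] in \<open>simp add: uc_def\<close>)

lemma ginner_ut_continuous: "continuous_on (UNIV \<times> I) (\<lambda>(p, t). ginner M (\<lambda>q. u q t) (ut t) p)"
proof (rule continuous_on_Times_chartsI)
  fix c assume c: "c \<in> atlas M"
  interpret c: riem_chart M c by (rule chart[OF c])
  have gi: "continuous_on (c.V \<times> I) (\<lambda>x. c.gi i j (fst x))" for i j
    by (rule continuous_on_compose2[OF smooth_on_continuous_on[OF c.gi_smooth]]) (auto intro!: continuous_intros)
  have D2: "continuous_on (c.V \<times> I) (\<lambda>x. frechet_derivative (Du c (0, 1)) (at x within c.V \<times> I) v)" for v
  proof -
    have "Ck_on 0 (c.V \<times> I) (\<lambda>x. frechet_derivative (Du c (0, 1)) (at x within c.V \<times> I) v)"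
      using Du_smooth[OF c, of "Suc 0"] unfolding Ck_on.simps(2) by blast
    then show ?thesis by simp
  qed
  have "continuous_on (c.V \<times> I) (\<lambda>x. \<Sum>j\<in>UNIV. Du c (axis j 1, 0) x * (\<Sum>a\<in>UNIV. c.gi j a (fst x)
      * frechet_derivative (Du c (0, 1)) (at x within c.V \<times> I) (axis a 1, 0)))"
    by (intro continuous_intros gi D2 Ck_on_continuous_on[OF Du_smooth[OF c]])
  then show "continuous_on (c.V \<times> I) (\<lambda>(y, t). ginner M (\<lambda>q. u q t) (ut t) (inv_chart c y))"
  proof (rule continuous_on_eq)
    fix x assume "x \<in> c.V \<times> I"
    then obtain y t where x: "x = (y, t)" "y \<in> c.V" "t \<in> I" by auto
    have "ginner M (\<lambda>q. u q t) (ut t) (inv_chart c y)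
        = inner_c M c (\<lambda>z. u (inv_chart c z) t) (\<lambda>z. ut t (inv_chart c z)) y"
      using ginner_chart[OF smooth_fun_C1[OF smooth_slice[OF x(3)]] smooth_fun_C1[OF smooth_ut[OF x(3)]] c c.inv_chart_dom[OF x(2)]]
      by (simp add: c.coord_inv[OF x(2)] o_def)
    then show "(\<Sum>j\<in>UNIV. Du c (axis j 1, 0) x * (\<Sum>a\<in>UNIV. c.gi j a (fst x)
      * frechet_derivative (Du c (0, 1)) (at x within c.V \<times> I) (axis a 1, 0)))
      = (case x of (y, t) \<Rightarrow> ginner M (\<lambda>q. u q t) (ut t) (inv_chart c y))"
      by (simp add: x(1) inner_c_def grad_c_def pd_u_chart[OF c x(2,3)] pd_ut_chart[OF c x(2,3)])
  qed
qed

text \<open>The integrals are left unevaluated, in the shape of the right-hand side of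
  \<open>entropy_production\<close>; the summand 1 beside the logarithm comes from differentiating
  the latter.\<close>

lemma log_entropy_derivative:
  assumes t: "t \<in> I" and \<omega>: "omega M \<mu> (\<lambda>p. u p t) a > 0"
  shows "((\<lambda>s. log_entropy M \<mu> a (\<lambda>p. u p s) s) has_real_derivative
      - (\<integral>q. 2 * u q t * ut t q * (ln ((u q t)\<^sup>2) + 1) \<partial>\<mu>)
      + real CARD('n) / 2 * ((\<integral>q. 2 * ginner M (\<lambda>q. u q t) (ut t) q \<partial>\<mu>) / omega M \<mu> (\<lambda>p. u p t) a) - 4 * a) (at t within I)"
proof -
  let ?S = "\<integral>q. 2 * u q t * ut t q * (ln ((u q t)\<^sup>2) + 1) \<partial>\<mu>" and ?w = "omega M \<mu> (\<lambda>p. u p t) a" and ?E = "\<integral>q. 2 * ginner M (\<lambda>q. u q t) (ut t) q \<partial>\<mu>"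
  have cu: "continuous_on UNIV (\<lambda>p. u p s)" if "s \<in> I" for s
    by (rule C1_fun_continuous[OF smooth_fun_C1[OF smooth_slice[OF that]]])
  have 1: "((\<lambda>s. \<integral>p. (u p s)\<^sup>2 * ln ((u p s)\<^sup>2) \<partial>\<mu>) has_real_derivative
      ?S) (at t within I)"
  proof (rule integral_time_derivative[OF interval(1) t])
    show "((\<lambda>s. (u p s)\<^sup>2 * ln ((u p s)\<^sup>2)) has_real_derivative 2 * u p s * ut s p * (ln ((u p s)\<^sup>2) + 1)) (at s within I)"
      if s: "s \<in> I" for p s
    proof -
      have d: "((\<lambda>s. u p s) has_real_derivative ut s p) (at s within I)" using pde[OF s] by (simp add: ut_def)
      show ?thesis
        using pos[OF s, of p] by (auto intro!: derivative_eq_intros d simp: field_simps power2_eq_square)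
    qed
    have "continuous_on (UNIV \<times> I) (\<lambda>x. 2 * (\<lambda>(p, t). u p t) x * (\<lambda>(p, t). ut t p) x * (ln (((\<lambda>(p, t). u p t) x)\<^sup>2) + 1))"
      by (intro continuous_intros u_continuous ut_continuous) (use pos in \<open>force simp: less_le\<close>)
    then show "continuous_on (UNIV \<times> I) (\<lambda>(p, s). 2 * u p s * ut s p * (ln ((u p s)\<^sup>2) + 1))"
      by (simp add: case_prod_unfold)
    show "continuous_on UNIV (\<lambda>p. (u p s)\<^sup>2 * ln ((u p s)\<^sup>2))" if "s \<in> I" for s
      by (intro continuous_intros cu that) (use pos[OF that] in \<open>force simp: less_le\<close>)
  qed
  have 2: "((\<lambda>s. \<integral>p. grad_sq M (\<lambda>q. u q s) p \<partial>\<mu>) has_real_derivative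
      ?E) (at t within I)"
  proof (rule integral_time_derivative[OF interval(1) t])
    show "((\<lambda>s. grad_sq M (\<lambda>q. u q s) p) has_real_derivative 2 * ginner M (\<lambda>q. u q s) (ut s) p) (at s within I)"
      if "s \<in> I" for p s by (rule grad_sq_time_derivative[OF that])
    have "continuous_on (UNIV \<times> I) (\<lambda>x. 2 * (\<lambda>(p, t). ginner M (\<lambda>q. u q t) (ut t) p) x)"
      by (intro continuous_intros ginner_ut_continuous)
    then show "continuous_on (UNIV \<times> I) (\<lambda>(p, s). 2 * ginner M (\<lambda>q. u q s) (ut s) p)"
      by (simp add: case_prod_unfold)
    show "continuous_on UNIV (\<lambda>p. grad_sq M (\<lambda>q. u q s) p)" if "s \<in> I" for s
      unfolding grad_sq_ginner by (intro ginner_continuous smooth_fun_C1 smooth_slice that)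
  qed
  have 3: "((\<lambda>s. ln (omega M \<mu> (\<lambda>p. u p s) a)) has_real_derivative
      inverse (?w) * ?E) (at t within I)"
  proof (rule DERIV_chain2[where f = ln and g = "\<lambda>s. omega M \<mu> (\<lambda>p. u p s) a"])
    show "(ln has_real_derivative inverse (?w)) (at (?w))" by (rule DERIV_ln[OF \<omega>])
    show "((\<lambda>s. omega M \<mu> (\<lambda>p. u p s) a) has_real_derivative
        ?E) (at t within I)" using DERIV_add[OF 2 DERIV_const[of a]] by (simp add: omega_def)
  qed
  have "((\<lambda>s. log_entropy M \<mu> a (\<lambda>p. u p s) s) has_real_derivative
      - ?S + real CARD('n) / 2 *
      (inverse (?w) * ?E) - 4 * a * 1) (at t within I)"
    unfolding log_entropy_def by (intro DERIV_diff DERIV_add DERIV_minus DERIV_cmult 1 3 DERIV_ident)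
  then show ?thesis by (simp only: divide_inverse mult.commute[of "inverse _"] mult_1_right)
qed

end

theorem theorem2p3:
  fixes M :: "('m::t2_space, 'n::finite) riem"
    and \<mu> :: "'m measure"
    and lam a :: real
    and I :: "real set"
    and u f :: "'m \<Rightarrow> real \<Rightarrow> real"
  defines "n \<equiv> real CARD('n)"
  defines "\<omega> \<equiv> \<lambda>t. omega M \<mu> (\<lambda>p. u p t) a"
  defines "R \<equiv> \<lambda>t. n / (4 * \<omega> t) *
            (\<integral>p. (tensor_norm_sq M p
                    (- (2 / u p t) *\<^sub>R hess M (\<lambda>q. u q t) p
                     + (2 / (u p t)\<^sup>2) *\<^sub>R
                         tensor_prod (differential M (\<lambda>q. u q t) p) (differential M (\<lambda>q. u q t) p)
                     - (4 * \<omega> t / n) *\<^sub>R metric_at M p)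
                  + 4 * Ric M p ((1 / u p t) *\<^sub>R grad M (\<lambda>q. u q t) p)
                                ((1 / u p t) *\<^sub>R grad M (\<lambda>q. u q t) p)) * (u p t)\<^sup>2 \<partial>\<mu>)"
  assumes manifold: "closed_riemannian_manifold M"
    and volume: "riemannian_volume M \<mu>"
    and ricci: "nonneg_ricci M"
    and eigenvalue: "first_nonzero_eigenvalue M lam"
    and a: "a > - lam"
    and interval: "is_interval I" "interior I \<noteq> {}" "I \<subseteq> {0<..}"
    and smooth: "smooth_spacetime M I u"
    and pos: "\<forall>p. \<forall>t\<in>I. u p t > 0"
    and pde: "\<forall>p. \<forall>t\<in>I. ((\<lambda>s. u p s) has_real_derivative
        laplacian M (\<lambda>q. u q t) p + grad_sq M (\<lambda>q. u q t) p / u p t) (at t within I)"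
    and normalized: "\<forall>t\<in>I. (\<integral>p. (u p t)\<^sup>2 \<partial>\<mu>) = 1"
    and omega_pos: "\<forall>t\<in>I. \<omega> t > 0"
    and f_bar: "\<forall>p. \<forall>t\<in>I. u p t = (4 * pi * t) powr (- n / 4) * exp (- f p t / 2)"
  shows "antimono_on I (\<lambda>t. log_entropy M \<mu> a (\<lambda>p. u p t) t)
    \<and> (\<forall>t\<in>I.
        (\<exists>D. ((\<lambda>s. log_entropy M \<mu> a (\<lambda>p. u p s) s) has_real_derivative D) (at t within I) \<and>
          - D \<ge> R t)
      \<and> R t
        = n / (4 * \<omega> t) *
            (\<integral>p. (tensor_norm_sq M p
                    (hess M (\<lambda>q. f q t) p - (4 * \<omega> t / n) *\<^sub>R metric_at M p)
                  + Ric M p (grad M (\<lambda>q. f q t) p) (grad M (\<lambda>q. f q t) p))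
                 * (exp (- f p t) / (4 * pi * t) powr (n / 2)) \<partial>\<mu>))"
proof -
  note I_pos = interval(3)
  interpret riem_flow M \<mu> I u using manifold volume interval smooth pos pde by unfold_locales auto
  have n: "n > 0" by (simp add: n_def)
  \<comment> \<open>The bound holds with equality: -R t is the derivative itself, and both the
    monotonicity and the existence of D rest on this.\<close>
  have D: "((\<lambda>s. log_entropy M \<mu> a (\<lambda>p. u p s) s) has_real_derivative - R t) (at t within I)" if t: "t \<in> I" for t
  proof -
    have "R t = (\<integral>q. 2 * u q t * ut t q * (ln ((u q t)\<^sup>2) + 1) \<partial>\<mu>)
        - n / 2 * ((\<integral>q. 2 * ginner M (\<lambda>q. u q t) (ut t) q \<partial>\<mu>) / \<omega> t) + 4 * a"
      using entropy_production[OF smooth_slice[OF t], of a] pos t normalized omega_pos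
      unfolding R_def ut_def[abs_def] \<omega>_def n_def by simp
    then show ?thesis
      using log_entropy_derivative[OF t, of a] omega_pos t unfolding \<omega>_def n_def by simp
  qed
  have R_nonneg: "R t \<ge> 0" if t: "t \<in> I" for t
  proof -
    have "0 \<le> n / (4 * \<omega> t)" using n omega_pos t by (simp add: less_imp_le)
    moreover have "Ric M p v v \<ge> 0" for p v using ricci unfolding nonneg_ricci_def by blast
    ultimately show ?thesis
      unfolding R_def by (intro mult_nonneg_nonneg Bochner_Integration.integral_nonneg add_nonneg_nonneg tensor_norm_sq_nonneg) auto
  qed
  have "antimono_on I (\<lambda>t. log_entropy M \<mu> a (\<lambda>p. u p t) t)" (is "antimono_on I ?Y")
  proof (rule monotone_onI)
    fix x y assume xy: "x \<in> I" "y \<in> I" "x \<le> y"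
    have sub: "{x..y} \<subseteq> I" using mem_is_interval_1_I[OF interval(1) xy(1,2)] by auto
    have "\<exists>z\<in>{x..y}. ?Y y - ?Y x = - R z * (y - x)"
    proof (rule mvt_very_simple[OF xy(3), where f' = "\<lambda>z. (*) (- R z)"])
      fix z assume "x \<le> z" "z \<le> y"
      then have "(?Y has_real_derivative - R z) (at z within {x..y})"
        by (intro DERIV_subset[OF D sub]) (use sub in auto)
      then show "(?Y has_derivative (*) (- R z)) (at z within {x..y})" by (simp add: has_field_derivative_def)
    qed
    then obtain z where "z \<in> {x..y}" "?Y y - ?Y x = - R z * (y - x)" by blast
    moreover have "R z * (y - x) \<ge> 0"
      using R_nonneg[of z] sub \<open>z \<in> {x..y}\<close> xy(3) by (intro mult_nonneg_nonneg) auto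
    ultimately show "?Y y \<le> ?Y x" by simp
  qed
  moreover have "R t = n / (4 * \<omega> t) *
            (\<integral>p. (tensor_norm_sq M p
                    (hess M (\<lambda>q. f q t) p - (4 * \<omega> t / n) *\<^sub>R metric_at M p)
                  + Ric M p (grad M (\<lambda>q. f q t) p) (grad M (\<lambda>q. f q t) p))
                 * (exp (- f p t) / (4 * pi * t) powr (n / 2)) \<partial>\<mu>)" if t: "t \<in> I" for t
  proof -
    define w where "w q = u q t" for q
    \<comment> \<open>Taking logarithms in the relation between u and f gives f = -2 ln u + l. At a
      fixed time l is constant on the manifold, so it drops out of gradient and Hessian.\<close>
    define l where "l = - (n / 2) * ln (4 * pi * t)"
    define \<phi> where "\<phi> s = - 2 * ln s + l" for s :: real
    have t0: "t > 0" using I_pos t by auto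
    have w: "smooth_fun M w" unfolding w_def by (rule smooth_slice[OF t])
    have wpos: "w q > 0" for q using pos t by (simp add: w_def)
    have w_f: "w q = (4 * pi * t) powr (- n / 4) * exp (- f q t / 2)" for q using f_bar t by (simp add: w_def)
    have f: "(\<lambda>q. f q t) = (\<lambda>q. \<phi> (w q))"
    proof
      fix q
      have "ln (w q) = - n / 4 * ln (4 * pi * t) - f q t / 2"
        unfolding w_f using t0 by (simp add: ln_mult ln_powr)
      then show "f q t = \<phi> (w q)" by (simp add: \<phi>_def l_def field_simps)
    qed
    have d1: "(\<phi> has_real_derivative - 2 / w q) (at (w q))" for q
      unfolding \<phi>_def using wpos[of q] by (auto intro!: derivative_eq_intros)
    have d2: "((\<lambda>s. - 2 / s) has_real_derivative 2 / (w q)\<^sup>2) (at (w q))" for q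
      using wpos[of q] by (auto intro!: derivative_eq_intros simp: power2_eq_square)
    have hess_f: "hess M (\<lambda>q. f q t) p = - (2 / w p) *\<^sub>R hess M w p
        + (2 / (w p)\<^sup>2) *\<^sub>R tensor_prod (differential M w p) (differential M w p)" for p
      unfolding f using hess_chain[where \<phi>' = "\<lambda>s. - 2 / s", OF w d1 d2] by simp
    \<comment> \<open>The factor -2, squared by \<open>Ric_scaleR\<close>, accounts for the
      coefficient 4 of the Ricci term in u.\<close>
    have grad_f: "grad M (\<lambda>q. f q t) p = (- 2) *\<^sub>R ((1 / w p) *\<^sub>R grad M w p)" for p
      unfolding f grad_chain[OF smooth_fun_C1[OF w] d1] by simp
    have "exp (- f p t) / (4 * pi * t) powr (n / 2) = (w p)\<^sup>2" for p
    proof -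
      have "(w p)\<^sup>2 = ((4 * pi * t) powr (- n / 4))\<^sup>2 * (exp (- f p t / 2))\<^sup>2"
        unfolding w_f by (simp add: power_mult_distrib)
      also have "((4 * pi * t) powr (- n / 4))\<^sup>2 = (4 * pi * t) powr (- (n / 2))"
        by (simp add: power2_eq_square powr_add[symmetric])
      also have "(exp (- f p t / 2))\<^sup>2 = exp (- f p t)"
        by (simp add: power2_eq_square exp_add[symmetric])
      finally show ?thesis unfolding powr_minus_divide by simp
    qed
    moreover have "w = (\<lambda>q. u q t)" by (simp add: w_def fun_eq_iff)
    moreover have "(- 2)\<^sup>2 = (4 :: real)" by simp
    ultimately show ?thesis unfolding R_def hess_f grad_f Ric_scaleR by (simp only:)
  qed
  moreover have "\<exists>D. ((\<lambda>s. log_entropy M \<mu> a (\<lambda>p. u p s) s) has_real_derivative D) (at t within I) \<and> - D \<ge> R t"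
    if t: "t \<in> I" for t by (rule exI[of _ "- R t"]) (simp add: D[OF t])
  ultimately show ?thesis by blast
qed

end
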